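(* Let $(X_i)_{i\in\mathbb{Z}}$ be a stationary sequence of centered real random variables adapted to the filtration $(\mathcal{F}_i)_{i\in\mathbb{Z}}$ as described in the context, let $m=m(n)\in[1,n]$ be a sequence of integers, and let $\sigma>0$. Assume that there exists $\rho\in(0,1]$ such that $\max\{\varepsilon_m,\gamma_m,\delta_m,m/n\}\to0$ as $n\to\infty$, where $\varepsilon_m,\gamma_m,\delta_m$ and the block self-normalized sum $W_n^\circ$ are defined in the context. Let $(a_n)_{n\ge1}$ be any sequence of real numbers satisfying $a_n\to0$ and $a_n\min\{\varepsilon_m^{-1},\sqrt{n/m}\}\to\infty$ as $n\to\infty$. Then, for each Borel set $B\subset\mathbb{R}$, $$-\inf_{x\in B^o}\frac{x^2}{2}\le\liminf_{n\to\infty}a_n^2\ln\mathbb{P}\big(a_nW_n^\circ\in B\big)\le\limsup_{n\to\infty}a_n^2\ln\mathbb{P}\big(a_nW_n^\circ\in B\big)\le-\inf_{x\in\overline{B}}\frac{x^2}{2},$$ where $B^o$ and $\overline{B}$ denote the interior and the closure of $B$, respectively.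
   Context: Setting. $(\Omega,\mathcal{F},\mathbb{P})$ is a probability space and $T:\Omega\to\Omega$ is a bijective bimeasurable transformation preserving $\mathbb{P}$. $\mathcal{F}_0\subseteq\mathcal{F}$ is a sub-$\sigma$-field with $\mathcal{F}_0\subseteq T^{-1}(\mathcal{F}_0)$, and $\mathcal{F}_i=T^{-i}(\mathcal{F}_0)$. $X_0$ is an $\mathcal{F}_0$-measurable real random variable with $\mathbb{E}X_0=0$, and $X_i=X_0\circ T^i$, $i\in\mathbb{Z}$. Notation. $k=\lfloor n/m\rfloor$, $S_l=\sum_{i=1}^l X_i$, $\|X\|_\infty$ is the $\mathbb{L}^\infty$-norm. Block sums: $H_j=\{i: m(j-1)+1\le i\le mj\}$, $S_j^\circ=\sum_{i\in H_j}X_i$ for $1\le j\le k$, $(V_k^\circ)^2=\sum_{j=1}^k(S_j^\circ)^2$, and $W_n^\circ=\big(\sum_{j=1}^kS_j^\circ\big)/V_k^\circ$ (with the convention $W_n^\circ=0$ when $V_k^\circ=0$). For $\rho,\sigma>0$, $$\varepsilon_m=\frac{1}{n^{1/2}m^{1/\rho}\sigma^{2/\rho+1}}\Big\|\mathbb{E}[|S_m|^{2+\rho}|\mathcal{F}_0]\Big\|_\infty^{1/\rho},\qquad \gamma_m=\frac{1}{m^{1/2}\sigma}\sum_{j=1}^\infty\frac{1}{j^{3/2}}\Big\|\mathbb{E}[S_{mj}|\mathcal{F}_0]\Big\|_\infty,$$ $$\delta_m^2=\frac{1}{m\sigma^2}\Big\|\mathbb{E}[S_m|\mathcal{F}_0]\Big\|_\infty^2+\Big\|\frac{1}{m\sigma^2}\mathbb{E}[S_m^2|\mathcal{F}_0]-1\Big\|_\infty.$$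 Conventions: $\inf\emptyset=+\infty$, $\ln0=-\infty$. *)

theory Defs
  imports "HOL-Probability.Probability"
begin

text \<open>The two-sided iterates of a bijection of \<open>\<Omega>\<close>; the inverse is taken on \<open>\<Omega>\<close>, since \<open>T\<close> is
  unconstrained outside of it.\<close>

definition int_iterate :: "'a set \<Rightarrow> ('a \<Rightarrow> 'a) \<Rightarrow> int \<Rightarrow> 'a \<Rightarrow> 'a" where
  "int_iterate \<Omega> T i = (if 0 \<le> i then T ^^ nat i else inv_into \<Omega> T ^^ nat (- i))"

definition mp_automorphism :: "'a measure \<Rightarrow> ('a \<Rightarrow> 'a) \<Rightarrow> bool" where
  "mp_automorphism M T \<longleftrightarrow>
     bij_betw T (space M) (space M) \<and>
     T \<in> measurable M M \<and>
     inv_into (space M) T \<in> measurable M M \<and>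
     distr M M T = M"

definition shift_seq :: "'a measure \<Rightarrow> ('a \<Rightarrow> 'a) \<Rightarrow> ('a \<Rightarrow> real) \<Rightarrow> int \<Rightarrow> 'a \<Rightarrow> real" where
  "shift_seq M T X0 i = (\<lambda>\<omega>. X0 (int_iterate (space M) T i \<omega>))"

text \<open>The \<open>\<sigma>\<close>-field \<open>T\<^sup>-\<^sup>i \<F>\<^sub>0\<close>. Only \<open>space\<close> and \<open>sets\<close> of the result are meaningful, not its measure.\<close>

definition shift_algebra :: "'a measure \<Rightarrow> ('a \<Rightarrow> 'a) \<Rightarrow> 'a measure \<Rightarrow> int \<Rightarrow> 'a measure" where
  "shift_algebra M T F0 i = vimage_algebra (space M) (int_iterate (space M) T i) F0"

lemma shift_algebra_1: "shift_algebra M T F0 1 = vimage_algebra (space M) T F0"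
  by (simp add: shift_algebra_def int_iterate_def)

lemma int_iterate_in_space:
  assumes "mp_automorphism M T" "\<omega> \<in> space M"
  shows "int_iterate (space M) T i \<omega> \<in> space M"
proof -
  have *: "(f ^^ k) \<omega> \<in> space M" if "f \<in> measurable M M" for f :: "'a \<Rightarrow> 'a" and k
    using assms(2) by (induction k) (auto intro: measurable_space[OF that])
  show ?thesis
    using assms(1) by (auto simp: int_iterate_def mp_automorphism_def intro: *)
qed

lemma shift_seq_adapted:
  assumes "mp_automorphism M T" "subalgebra M F0" "X0 \<in> borel_measurable F0"
  shows "shift_seq M T X0 i \<in> borel_measurable (shift_algebra M T F0 i)"
proof -
  have "int_iterate (space M) T i \<in> measurable (shift_algebra M T F0 i) F0"
    unfolding shift_algebra_def
    using int_iterate_in_space[OF assms(1)] assms(2)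
    by (intro measurable_vimage_algebra1) (auto simp: subalgebra_def)
  from measurable_compose[OF this assms(3)] show ?thesis
    by (simp add: shift_seq_def)
qed

definition psum :: "(int \<Rightarrow> 'a \<Rightarrow> real) \<Rightarrow> nat \<Rightarrow> 'a \<Rightarrow> real" where
  "psum X l \<omega> = (\<Sum>i\<in>{1..l}. X (int i) \<omega>)"

text \<open>Block \<open>j\<close> is meant for \<open>j \<ge> 1\<close>.\<close>

definition block :: "nat \<Rightarrow> nat \<Rightarrow> nat set" where
  "block m j = {m * (j - 1) + 1 .. m * j}"

definition block_sum :: "(int \<Rightarrow> 'a \<Rightarrow> real) \<Rightarrow> nat \<Rightarrow> nat \<Rightarrow> 'a \<Rightarrow> real" where
  "block_sum X m j \<omega> = (\<Sum>i\<in>block m j. X (int i) \<omega>)"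

definition block_V :: "(int \<Rightarrow> 'a \<Rightarrow> real) \<Rightarrow> nat \<Rightarrow> nat \<Rightarrow> 'a \<Rightarrow> real" where
  "block_V X m k \<omega> = sqrt (\<Sum>j\<in>{1..k}. (block_sum X m j \<omega>)\<^sup>2)"

text \<open>The convention that the ratio is \<open>0\<close> for a vanishing denominator is that of HOL division.\<close>

definition block_W :: "(int \<Rightarrow> 'a \<Rightarrow> real) \<Rightarrow> nat \<Rightarrow> nat \<Rightarrow> 'a \<Rightarrow> real" where
  "block_W X n m \<omega> = (\<Sum>j\<in>{1..n div m}. block_sum X m j \<omega>) / block_V X m (n div m) \<omega>"

text \<open>The quantities below take values in \<open>[0,\<infinity>]\<close>, so that an infinite norm or a divergent series
  is not confused with a junk real value.\<close>

definition Linf_norm :: "'a measure \<Rightarrow> ('a \<Rightarrow> ereal) \<Rightarrow> ennreal" where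
  "Linf_norm M f = esssup M (\<lambda>\<omega>. e2ennreal \<bar>f \<omega>\<bar>)"

text \<open>Meant for \<open>p > 0\<close>.\<close>

definition enn_powr :: "ennreal \<Rightarrow> real \<Rightarrow> ennreal" where
  "enn_powr x p = (if x = \<infinity> then \<infinity> else ennreal (enn2real x powr p))"

text \<open>Conditional expectations of nonnegative functions are taken with the \<open>[0,\<infinity>]\<close>-valued
  \<^const>\<open>nn_cond_exp\<close>, because \<^const>\<open>real_cond_exp\<close> is meaningful for integrable functions only and
  no moment of \<open>S\<^sub>m\<close> beyond the first is assumed to be finite.\<close>

definition eps_m ::
  "'a measure \<Rightarrow> 'a measure \<Rightarrow> (int \<Rightarrow> 'a \<Rightarrow> real) \<Rightarrow> real \<Rightarrow> real \<Rightarrow> nat \<Rightarrow> nat \<Rightarrow> ennreal" where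
  "eps_m M F0 X \<rho> \<sigma> n m =
     ennreal (1 / (real n powr (1/2) * real m powr (1/\<rho>) * \<sigma> powr (2/\<rho> + 1))) *
     enn_powr
       (Linf_norm M (\<lambda>\<omega>. enn2ereal
          (nn_cond_exp M F0 (\<lambda>\<omega>. ennreal (\<bar>psum X m \<omega>\<bar> powr (2 + \<rho>))) \<omega>)))
       (1/\<rho>)"

text \<open>The series over \<open>j \<ge> 1\<close> is indexed by \<open>j = Suc i\<close>.\<close>

definition gamma_m ::
  "'a measure \<Rightarrow> 'a measure \<Rightarrow> (int \<Rightarrow> 'a \<Rightarrow> real) \<Rightarrow> real \<Rightarrow> nat \<Rightarrow> ennreal" where
  "gamma_m M F0 X \<sigma> m =
     ennreal (1 / (real m powr (1/2) * \<sigma>)) *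
     (\<Sum>i. ennreal (1 / real (Suc i) powr (3/2)) *
           Linf_norm M (\<lambda>\<omega>. ereal (real_cond_exp M F0 (psum X (m * Suc i)) \<omega>)))"

definition delta_sq_m ::
  "'a measure \<Rightarrow> 'a measure \<Rightarrow> (int \<Rightarrow> 'a \<Rightarrow> real) \<Rightarrow> real \<Rightarrow> nat \<Rightarrow> ennreal" where
  "delta_sq_m M F0 X \<sigma> m =
     ennreal (1 / (real m * \<sigma>\<^sup>2)) *
       (Linf_norm M (\<lambda>\<omega>. ereal (real_cond_exp M F0 (psum X m) \<omega>)))\<^sup>2 +
     Linf_norm M (\<lambda>\<omega>. ereal (1 / (real m * \<sigma>\<^sup>2)) *
       enn2ereal (nn_cond_exp M F0 (\<lambda>\<omega>. ennreal ((psum X m \<omega>)\<^sup>2)) \<omega>) - 1)"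

definition delta_m ::
  "'a measure \<Rightarrow> 'a measure \<Rightarrow> (int \<Rightarrow> 'a \<Rightarrow> real) \<Rightarrow> real \<Rightarrow> nat \<Rightarrow> ennreal" where
  "delta_m M F0 X \<sigma> m = enn_powr (delta_sq_m M F0 X \<sigma> m) (1/2)"

text \<open>Logarithm on \<open>[0,\<infinity>)\<close> with \<open>ln 0 = -\<infinity>\<close>.\<close>

definition eln :: "real \<Rightarrow> ereal" where
  "eln p = (if p = 0 then -\<infinity> else ereal (ln p))"

end

theory Submission
  imports Defs
begin

text \<open>Write \<open>x = 1 / a\<^sub>n\<close> and normalise the block sums to variables \<open>U\<^sub>j\<close> of conditional variance close
  to \<open>\<tau> = x\<^sup>2 / k\<close>, adapted to the filtration of the blocks. Truncated at level \<open>1\<close>, a third order Taylor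
  expansion shows that conditional exponential moments of the \<open>U\<^sub>j\<close> are Gaussian up to a factor
  \<open>exp (\<tau> o(1))\<close>, hence so are those of the sum up to \<open>exp (x\<^sup>2 o(1))\<close>, after the drifts
  \<open>E[U\<^sub>j | F\<^bsub>m(j-1)\<^esub>]\<close> are subtracted. On the scale \<open>exp (- x\<^sup>2)\<close> three things are negligible: that the sum of
  the squares of the truncated variables deviates from \<open>x\<^sup>2\<close>, that more than \<open>\<eta> x\<^sup>2\<close> of the variables exceed the truncation
  level, and that the sum of the drifts is not \<open>o(x\<^sup>2)\<close>; the last one is where \<open>\<gamma>\<^sub>m\<close> enters.
  For the upper bound, the Cauchy-Schwarz inequality shows that a few large variables contribute at most
  \<open>sqrt \<eta> x\<close> to the self-normalised sum, whatever their size. For the lower bound, one tilts the measure restricted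
  to the event that no variable is large.\<close>

section \<open>Exponential moments along a filtration\<close>

text \<open>The blocks are scaled by \<open>s = x / (\<sigma> * sqrt (m * k))\<close>, a factor
  which the self-normalised sum does not see. The two growth conditions on \<open>a n\<close> are
  what this scaling asks for: \<open>a n * sqrt (n / m)\<close> tending to infinity means that
  \<tau> tends to 0, and \<open>a n\<close> being much larger than \<open>eps_m\<close> makes the
  conditional moments of order 2 + \<rho> equal to \<tau> times o(1). The obstacle is the drift. A
  single drift is only known to be at most \<open>sqrt (\<tau> * r)\<close>, and adding up
  \<open>k\<close> such bounds gives \<open>x * sqrt (k * r)\<close>, which need not be of smaller
  order than \<open>x^2\<close>; the sum of the squares of the drifts, however, is at most
  \<open>x^2 * r\<close>. So the drifts travel through the exponential moments as predictable
  factors, which costs only their squares, and their sum is treated apart as a random variable with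
  sub-Gaussian tails on the scale \<open>x * o(1)\<close>. In the lower bound the tilted measure is
  never normalised and no limit theorem is proved under it: its mass away from
  \<open>y * x^2\<close> is compared with the total masses at the slopes \<open>y + \<eta>\<close>
  and \<open>y - \<eta>\<close>, and the strict convexity of \<theta>^2/2 makes it
  negligible.\<close>

locale filtered_prob_space = prob_space M for M :: "'a measure" +
  fixes G :: "nat \<Rightarrow> 'a measure"
  assumes subalg_G: "subalgebra M (G j)"
    and mono_G: "i \<le> j \<Longrightarrow> sets (G i) \<subseteq> sets (G j)"
begin

sublocale sub: sigma_finite_subalgebra M "G j" for j
proof -
  have "finite_measure_subalgebra M (G j)"
    by unfold_locales (rule subalg_G)
  then show "sigma_finite_subalgebra M (G j)"
    by (rule finite_measure_subalgebra_is_sigma_finite)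
qed

lemma space_G: "space (G j) = space M"
  using subalg_G[of j] by (simp add: subalgebra_def)

lemma subalgebra_G_mono: "i \<le> j \<Longrightarrow> subalgebra (G j) (G i)"
  using mono_G[of i j] by (simp add: subalgebra_def space_G)

lemma measurable_G_mono: "f \<in> measurable (G i) N \<Longrightarrow> i \<le> j \<Longrightarrow> f \<in> measurable (G j) N"
  by (rule measurable_from_subalg[OF subalgebra_G_mono])

lemma measurable_G: "f \<in> measurable (G i) N \<Longrightarrow> f \<in> measurable M N"
  by (rule measurable_from_subalg[OF subalg_G])

text \<open>Conditioning on \<open>G k\<close> replaces the last factor by its conditional
  expectation, and induction peels off the factors one by one. Independence is replaced by
  conditional bounds that are constants; the almost sure bound \<open>b\<close> provides
  integrability.\<close>

lemma prod_cond_exp_bounds: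
  assumes meas: "\<And>j. j < k \<Longrightarrow> g j \<in> borel_measurable (G (Suc j))"
    and bd: "\<And>j. j < k \<Longrightarrow> AE \<omega> in M. 0 \<le> g j \<omega> \<and> g j \<omega> \<le> b"
    and ce: "\<And>j. j < k \<Longrightarrow> AE \<omega> in M. l \<le> real_cond_exp M (G j) (g j) \<omega> \<and>
                                      real_cond_exp M (G j) (g j) \<omega> \<le> u"
    and "0 \<le> l"
  shows "integrable M (\<lambda>\<omega>. \<Prod>j<k. g j \<omega>)"
    and "l ^ k \<le> expectation (\<lambda>\<omega>. \<Prod>j<k. g j \<omega>)"
    and "expectation (\<lambda>\<omega>. \<Prod>j<k. g j \<omega>) \<le> u ^ k"
proof -
  have "(\<lambda>\<omega>. \<Prod>j<k. g j \<omega>) \<in> borel_measurable (G k) \<and>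
      (AE \<omega> in M. 0 \<le> (\<Prod>j<k. g j \<omega>) \<and> (\<Prod>j<k. g j \<omega>) \<le> \<bar>b\<bar> ^ k) \<and>
      l ^ k \<le> expectation (\<lambda>\<omega>. \<Prod>j<k. g j \<omega>) \<and> expectation (\<lambda>\<omega>. \<Prod>j<k. g j \<omega>) \<le> u ^ k"
    using meas bd ce
  proof (induction k)
    case 0
    show ?case by (simp add: prob_space)
  next
    case (Suc k)
    let ?P = "\<lambda>\<omega>. \<Prod>j<k. g j \<omega>"
    let ?E = "real_cond_exp M (G k) (g k)"
    have IH: "?P \<in> borel_measurable (G k)" "AE \<omega> in M. 0 \<le> ?P \<omega> \<and> ?P \<omega> \<le> \<bar>b\<bar> ^ k"
      "l ^ k \<le> expectation ?P" "expectation ?P \<le> u ^ k"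
      using Suc.IH Suc.prems by auto
    have gk: "g k \<in> borel_measurable (G (Suc k))" "AE \<omega> in M. 0 \<le> g k \<omega> \<and> g k \<omega> \<le> b"
      "AE \<omega> in M. l \<le> ?E \<omega> \<and> ?E \<omega> \<le> u"
      using Suc.prems by auto
    have [measurable]: "g k \<in> borel_measurable M" "?P \<in> borel_measurable M"
      using gk(1) IH(1) by (auto intro: measurable_G)
    have meas': "(\<lambda>\<omega>. \<Prod>j<Suc k. g j \<omega>) \<in> borel_measurable (G (Suc k))"
      using measurable_G_mono[OF IH(1), of "Suc k"] gk(1) by (simp add: mult.commute)
    have bd': "AE \<omega> in M. 0 \<le> (\<Prod>j<Suc k. g j \<omega>) \<and> (\<Prod>j<Suc k. g j \<omega>) \<le> \<bar>b\<bar> ^ Suc k"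
      using IH(2) gk(2)
    proof eventually_elim
      case (elim \<omega>)
      then have "?P \<omega> * g k \<omega> \<le> \<bar>b\<bar> ^ k * \<bar>b\<bar>"
        by (intro mult_mono) auto
      with elim show ?case by (simp add: mult.commute)
    qed
    have intP: "integrable M ?P"
      by (rule integrable_const_bound[where B = "\<bar>b\<bar> ^ k"]) (use IH(2) in auto)
    have intPg: "integrable M (\<lambda>\<omega>. ?P \<omega> * g k \<omega>)"
      by (rule integrable_const_bound[where B = "\<bar>b\<bar> ^ Suc k"]) (use bd' in \<open>auto simp: mult.commute\<close>)
    have intPE: "integrable M (\<lambda>\<omega>. ?P \<omega> * ?E \<omega>)"
      and eq: "expectation (\<lambda>\<omega>. ?P \<omega> * ?E \<omega>) = expectation (\<lambda>\<omega>. ?P \<omega> * g k \<omega>)"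
      using sub.real_cond_exp_intg[OF intPg IH(1)] by auto
    have "expectation (\<lambda>\<omega>. ?P \<omega> * ?E \<omega>) \<le> expectation (\<lambda>\<omega>. ?P \<omega> * u)"
      by (rule integral_mono_AE)
         (use IH(2) gk(3) intP intPE in \<open>auto elim!: eventually_elim2 intro!: mult_left_mono\<close>)
    moreover have "expectation (\<lambda>\<omega>. ?P \<omega> * l) \<le> expectation (\<lambda>\<omega>. ?P \<omega> * ?E \<omega>)"
      by (rule integral_mono_AE)
         (use IH(2) gk(3) intP intPE in \<open>auto elim!: eventually_elim2 intro!: mult_left_mono\<close>)
    \<comment> \<open>In a probability space an almost sure inequality between constants is
      true.\<close>
    moreover have "0 \<le> u"
    proof -
      have "AE \<omega> in M. 0 \<le> u"
        using gk(3) by eventually_elim (use \<open>0 \<le> l\<close> in linarith)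
      then show ?thesis by simp
    qed
    then have "expectation ?P * u \<le> u ^ k * u"
      using IH(4) by (intro mult_right_mono) auto
    moreover have "l ^ k * l \<le> expectation ?P * l"
      using IH(3) \<open>0 \<le> l\<close> by (intro mult_right_mono) auto
    ultimately have "l ^ Suc k \<le> expectation (\<lambda>\<omega>. \<Prod>j<Suc k. g j \<omega>)"
      "expectation (\<lambda>\<omega>. \<Prod>j<Suc k. g j \<omega>) \<le> u ^ Suc k"
      using eq by (auto simp: mult.commute)
    with meas' bd' show ?case by blast
  qed
  then show "l ^ k \<le> expectation (\<lambda>\<omega>. \<Prod>j<k. g j \<omega>)" "expectation (\<lambda>\<omega>. \<Prod>j<k. g j \<omega>) \<le> u ^ k"
    "integrable M (\<lambda>\<omega>. \<Prod>j<k. g j \<omega>)"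
    by (auto intro!: integrable_const_bound[where B = "\<bar>b\<bar> ^ k"] dest: measurable_G)
qed

end

section \<open>Exponential form of a second order expansion\<close>

text \<open>\<open>p\<close> is meant as a conditional exponential moment, \<open>v\<close> as its
  drift term, \<open>\<beta> * \<tau>\<close> as its second order term. Since
  \<open>1 + t \<le> exp t\<close>, the factor \<open>exp (- v)\<close> removes the drift without
  any loss.\<close>

lemma exp_upper_quadratic:
  fixes v \<tau> r \<beta> K p :: real
  assumes "\<bar>p - (1 + v + \<beta> * \<tau>)\<bar> \<le> K * \<tau> * r"
  shows "exp (- v) * p \<le> exp (\<tau> * (\<beta> + K * r))"
proof -
  have "p \<le> 1 + (v + \<beta> * \<tau> + K * \<tau> * r)" using assms by linarith
  also have "\<dots> \<le> exp (v + \<beta> * \<tau> + K * \<tau> * r)" by (rule exp_ge_add_one_self)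
  finally have "exp (- v) * p \<le> exp (- v) * exp (v + \<beta> * \<tau> + K * \<tau> * r)" by simp
  also have "\<dots> = exp (\<tau> * (\<beta> + K * r))" by (simp flip: exp_add add: algebra_simps)
  finally show ?thesis .
qed

text \<open>For small \<open>z\<close> one has \<open>ln (1 + z) \<ge> z - 2 * z^2\<close>. Although
  \<open>v\<close> may be as large as \<open>sqrt (\<tau> * r)\<close>, after multiplication by
  \<open>exp (- v)\<close> only its square is left, and this is of order \<open>\<tau> * r\<close>.
  The total loss is therefore \<tau> times a small quantity.\<close>

lemma exp_lower_quadratic:
  fixes v \<tau> r \<alpha> \<beta> K p :: real
  assumes p: "\<bar>p - (1 + v + \<beta> * \<tau>)\<bar> \<le> K * \<tau> * r"
    and v: "v\<^sup>2 \<le> \<alpha>\<^sup>2 * (\<tau> * r)" and "\<bar>\<beta>\<bar> \<le> K" "0 \<le> \<tau>" "0 \<le> r" "r \<le> 1"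
    and small: "\<tau> * (2 * \<alpha>\<^sup>2 * r + 8 * K\<^sup>2 * \<tau>) \<le> 1 / 4"
  shows "exp (\<tau> * (\<beta> - (K * r + 4 * \<alpha>\<^sup>2 * r + 16 * K\<^sup>2 * \<tau>))) \<le> exp (- v) * p"
proof -
  \<comment> \<open>\<open>w\<close> collects the terms that are not random: \<open>1 + z\<close>
    bounds \<open>p\<close> from below and \<open>exp (- v) * exp z = exp w\<close>.\<close>
  define w where "w = \<beta> * \<tau> - K * \<tau> * r"
  define z where "z = v + w"
  have "K \<ge> 0" using assms(3) by linarith
  have "\<bar>\<beta> * \<tau>\<bar> \<le> K * \<tau>" using assms by (simp add: abs_mult mult_right_mono)
  moreover have "K * \<tau> * r \<le> K * \<tau>" "0 \<le> K * \<tau> * r"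
    using \<open>K \<ge> 0\<close> assms by (auto intro!: mult_left_le)
  ultimately have "\<bar>w\<bar> \<le> 2 * K * \<tau>" unfolding w_def by linarith
  then have "w\<^sup>2 \<le> (2 * K * \<tau>)\<^sup>2" by (meson abs_ge_zero order_trans power2_le_iff_abs_le)
  then have w2: "w\<^sup>2 \<le> 4 * K\<^sup>2 * \<tau>\<^sup>2" by (simp add: power_mult_distrib)
  have "z\<^sup>2 \<le> 2 * v\<^sup>2 + 2 * w\<^sup>2"
    using sum_squares_bound[of v w] unfolding z_def power2_sum by simp
  also have "\<dots> \<le> \<tau> * (2 * \<alpha>\<^sup>2 * r + 8 * K\<^sup>2 * \<tau>)"
    using v w2 by (simp add: algebra_simps power2_eq_square)
  finally have z2: "z\<^sup>2 \<le> \<tau> * (2 * \<alpha>\<^sup>2 * r + 8 * K\<^sup>2 * \<tau>)" .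
  with small have "z\<^sup>2 \<le> (1 / 2)\<^sup>2" by (simp add: power2_eq_square)
  then have zabs: "\<bar>z\<bar> \<le> 1 / 2" by (simp add: abs_le_square_iff[symmetric])
  then have "\<bar>ln (1 + z) - z\<bar> \<le> 2 * z\<^sup>2" by (rule abs_ln_one_plus_x_minus_x_bound)
  then have "z - 2 * z\<^sup>2 \<le> ln (1 + z)" by linarith
  then have "exp (z - 2 * z\<^sup>2) \<le> 1 + z" using zabs by (subst (asm) ln_ge_iff) auto
  also have "1 + z \<le> p" using p unfolding z_def w_def by linarith
  finally have "exp (- v) * exp (z - 2 * z\<^sup>2) \<le> exp (- v) * p" by simp
  moreover have "exp (- v) * exp (z - 2 * z\<^sup>2) = exp (w - 2 * z\<^sup>2)"
    unfolding z_def by (simp flip: exp_add add: algebra_simps)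
  moreover have "\<tau> * (\<beta> - (K * r + 4 * \<alpha>\<^sup>2 * r + 16 * K\<^sup>2 * \<tau>)) \<le> w - 2 * z\<^sup>2"
    using z2 unfolding w_def by (simp add: algebra_simps)
  ultimately show ?thesis by (smt (verit) exp_le_cancel_iff)
qed

section \<open>Exponential moments of one normalised array\<close>

text \<open>All errors are measured in units of \<tau> by the single number \<open>r\<close>. The
  drift is bounded through its square: it is of order \<open>sqrt (\<tau> * r)\<close>, which is too
  large to count as an error of order \<open>\<tau> * r\<close>.\<close>

locale block_array = filtered_prob_space M G for M :: "'a measure" and G +
  fixes U :: "nat \<Rightarrow> 'a \<Rightarrow> real" and k :: nat and \<tau> r \<rho> :: real
  assumes U_meas: "U j \<in> borel_measurable (G (Suc j))"
    and U_int: "integrable M (U j)"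
    and U2_int: "integrable M (\<lambda>\<omega>. (U j \<omega>)\<^sup>2)"
    and Up_int: "integrable M (\<lambda>\<omega>. \<bar>U j \<omega>\<bar> powr (2 + \<rho>))"
    and drift_bound: "AE \<omega> in M. (real_cond_exp M (G j) (U j) \<omega>)\<^sup>2 \<le> \<tau> * r"
    and variance_bound: "AE \<omega> in M. \<bar>real_cond_exp M (G j) (\<lambda>\<omega>. (U j \<omega>)\<^sup>2) \<omega> - \<tau>\<bar> \<le> \<tau> * r"
    and moment_bound: "AE \<omega> in M. real_cond_exp M (G j) (\<lambda>\<omega>. \<bar>U j \<omega>\<bar> powr (2 + \<rho>)) \<omega> \<le> \<tau> * r"
    and \<tau>_pos: "0 < \<tau>" and r_nonneg: "0 \<le> r" and \<rho>_pos: "0 < \<rho>" and \<rho>_le1: "\<rho> \<le> 1"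
begin

definition drift :: "nat \<Rightarrow> 'a \<Rightarrow> real" where
  "drift j = real_cond_exp M (G j) (U j)"

lemma drift_meas: "drift j \<in> borel_measurable (G j)"
  by (simp add: drift_def)

lemma U_meas_M [measurable]: "U j \<in> borel_measurable M"
  using U_meas by (rule measurable_G)

lemma drift_meas_M [measurable]: "drift j \<in> borel_measurable M"
  using drift_meas by (rule measurable_G)

lemma drift_abs: "AE \<omega> in M. \<bar>drift j \<omega>\<bar> \<le> sqrt (\<tau> * r)"
  using drift_bound[of j] by eventually_elim (simp add: drift_def real_le_rsqrt)

text \<open>The function \<open>h\<close> is squeezed between its quadratic approximation plus and
  minus \<open>C * \<bar>u\<bar> powr (2 + \<rho>)\<close>. Under the conditional expectation the
  linear term becomes the drift, the quadratic term \<tau> up to \<open>\<tau> * r\<close>, and the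
  remainder at most \<open>C * \<tau> * r\<close>.\<close>

lemma cond_exp_approx:
  assumes [measurable]: "h \<in> borel_measurable borel" and hb: "\<And>u. 0 \<le> h u \<and> h u \<le> H"
    and happ: "\<And>u. \<bar>h u - (1 + \<alpha> * u + \<beta> * u\<^sup>2)\<bar> \<le> C * \<bar>u\<bar> powr (2 + \<rho>)" and "0 \<le> C"
  shows "AE \<omega> in M. \<bar>real_cond_exp M (G j) (\<lambda>\<omega>. h (U j \<omega>)) \<omega> - (1 + \<alpha> * drift j \<omega> + \<beta> * \<tau>)\<bar>
           \<le> (\<bar>\<beta>\<bar> + C) * \<tau> * r"
proof -
  let ?E = "\<lambda>f. real_cond_exp M (G j) f"
  let ?h = "\<lambda>\<omega>. h (U j \<omega>)"
  let ?q = "\<lambda>\<omega>. (1 + \<alpha> * U j \<omega>) + \<beta> * (U j \<omega>)\<^sup>2"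
  let ?p = "\<lambda>\<omega>. \<bar>U j \<omega>\<bar> powr (2 + \<rho>)"
  have inth: "integrable M ?h"
    by (rule integrable_const_bound[where B = H]) (use hb in auto)
  have int1: "integrable M (\<lambda>\<omega>. 1 + \<alpha> * U j \<omega>)" and int2: "integrable M (\<lambda>\<omega>. \<beta> * (U j \<omega>)\<^sup>2)"
    using U_int U2_int by auto
  have intq: "integrable M ?q" using int1 int2 by auto
  have intp: "integrable M (\<lambda>\<omega>. C * ?p \<omega>)" using Up_int by auto
  have q: "AE \<omega> in M. ?E ?q \<omega> = 1 + \<alpha> * drift j \<omega> + \<beta> * ?E (\<lambda>\<omega>. (U j \<omega>)\<^sup>2) \<omega>"
  proof -
    have "AE \<omega> in M. ?E (\<lambda>\<omega>. 1) \<omega> = 1" by (rule sub.real_cond_exp_F_meas) auto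
    moreover have "AE \<omega> in M. ?E (\<lambda>\<omega>. \<alpha> * U j \<omega>) \<omega> = \<alpha> * drift j \<omega>"
      unfolding drift_def by (rule sub.real_cond_exp_cmult) (rule U_int)
    moreover have "AE \<omega> in M. ?E (\<lambda>\<omega>. 1 + \<alpha> * U j \<omega>) \<omega> = ?E (\<lambda>\<omega>. 1) \<omega> + ?E (\<lambda>\<omega>. \<alpha> * U j \<omega>) \<omega>"
      by (rule sub.real_cond_exp_add) (use U_int in auto)
    moreover have "AE \<omega> in M. ?E (\<lambda>\<omega>. \<beta> * (U j \<omega>)\<^sup>2) \<omega> = \<beta> * ?E (\<lambda>\<omega>. (U j \<omega>)\<^sup>2) \<omega>"
      by (rule sub.real_cond_exp_cmult) (rule U2_int)
    moreover have "AE \<omega> in M. ?E ?q \<omega> = ?E (\<lambda>\<omega>. 1 + \<alpha> * U j \<omega>) \<omega> + ?E (\<lambda>\<omega>. \<beta> * (U j \<omega>)\<^sup>2) \<omega>"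
      by (rule sub.real_cond_exp_add[OF int1 int2])
    ultimately show ?thesis by eventually_elim simp
  qed
  have "AE \<omega> in M. ?E ?h \<omega> \<le> ?E (\<lambda>\<omega>. ?q \<omega> + C * ?p \<omega>) \<omega>"
    using happ by (intro sub.real_cond_exp_mono AE_I2 inth Bochner_Integration.integrable_add intq intp)
      (smt (verit))
  moreover have "AE \<omega> in M. ?E (\<lambda>\<omega>. ?q \<omega> - C * ?p \<omega>) \<omega> \<le> ?E ?h \<omega>"
    using happ by (intro sub.real_cond_exp_mono AE_I2 inth Bochner_Integration.integrable_diff intq intp)
      (smt (verit))
  moreover have "AE \<omega> in M. ?E (\<lambda>\<omega>. ?q \<omega> + C * ?p \<omega>) \<omega> = ?E ?q \<omega> + ?E (\<lambda>\<omega>. C * ?p \<omega>) \<omega>"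
    by (rule sub.real_cond_exp_add[OF intq intp])
  moreover have "AE \<omega> in M. ?E (\<lambda>\<omega>. ?q \<omega> - C * ?p \<omega>) \<omega> = ?E ?q \<omega> - ?E (\<lambda>\<omega>. C * ?p \<omega>) \<omega>"
    by (rule sub.real_cond_exp_diff[OF intq intp])
  moreover have "AE \<omega> in M. ?E (\<lambda>\<omega>. C * ?p \<omega>) \<omega> = C * ?E ?p \<omega>"
    by (rule sub.real_cond_exp_cmult[OF Up_int])
  ultimately show ?thesis
    using q moment_bound[of j] variance_bound[of j]
  proof eventually_elim
    case (elim \<omega>)
    let ?v = "?E (\<lambda>\<omega>. (U j \<omega>)\<^sup>2) \<omega>"
    have "C * ?E ?p \<omega> \<le> C * (\<tau> * r)" using elim \<open>0 \<le> C\<close> by (intro mult_left_mono) auto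
    moreover have "\<bar>\<beta> * ?v - \<beta> * \<tau>\<bar> \<le> \<bar>\<beta>\<bar> * (\<tau> * r)"
      using elim(8) by (simp flip: right_diff_distrib add: abs_mult mult_left_mono)
    moreover have "(\<bar>\<beta>\<bar> + C) * \<tau> * r = \<bar>\<beta>\<bar> * (\<tau> * r) + C * (\<tau> * r)" by (simp add: algebra_simps)
    ultimately show ?case using elim by (simp add: abs_le_iff)
  qed
qed

text \<open>Common source of all exponential moments below: \<open>h\<close> will be the exponential
  of the truncated variable, the same set to 0 at large values, the exponential of the truncated
  square, and the exponential of the indicator of a large value. The factor
  \<open>exp (- \<alpha> * drift j \<omega>)\<close> is known at time \<open>j\<close>, hence leaves
  the conditional expectation and cancels the linear term.\<close>

lemma prod_tilted_bounds:
  assumes h_meas [measurable]: "h \<in> borel_measurable borel" and hb: "\<And>u. 0 \<le> h u \<and> h u \<le> H"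
    and happ: "\<And>u. \<bar>h u - (1 + \<alpha> * u + \<beta> * u\<^sup>2)\<bar> \<le> C * \<bar>u\<bar> powr (2 + \<rho>)" and "0 \<le> C"
    and K: "K = \<bar>\<beta>\<bar> + C"
  shows "integrable M (\<lambda>\<omega>. \<Prod>j<k. h (U j \<omega>) * exp (- \<alpha> * drift j \<omega>))"
    and "expectation (\<lambda>\<omega>. \<Prod>j<k. h (U j \<omega>) * exp (- \<alpha> * drift j \<omega>)) \<le> exp (real k * \<tau> * (\<beta> + K * r))"
    and "r \<le> 1 \<Longrightarrow> \<tau> * (2 * \<alpha>\<^sup>2 * r + 8 * K\<^sup>2 * \<tau>) \<le> 1 / 4 \<Longrightarrow>
      exp (real k * \<tau> * (\<beta> - (K * r + 4 * \<alpha>\<^sup>2 * r + 16 * K\<^sup>2 * \<tau>))) \<le>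
      expectation (\<lambda>\<omega>. \<Prod>j<k. h (U j \<omega>) * exp (- \<alpha> * drift j \<omega>))"
proof -
  let ?g = "\<lambda>j \<omega>. h (U j \<omega>) * exp (- \<alpha> * drift j \<omega>)"
  define b where "b = H * exp (\<bar>\<alpha>\<bar> * sqrt (\<tau> * r))"
  have meas: "?g j \<in> borel_measurable (G (Suc j))" for j
    using measurable_G_mono[OF drift_meas, of j "Suc j"] U_meas[of j] by measurable
  have bd: "AE \<omega> in M. 0 \<le> ?g j \<omega> \<and> ?g j \<omega> \<le> b" for j
    using drift_abs[of j]
  proof eventually_elim
    case (elim \<omega>)
    have "- \<alpha> * drift j \<omega> \<le> \<bar>\<alpha>\<bar> * \<bar>drift j \<omega>\<bar>" by (metis abs_ge_self abs_minus_cancel abs_mult mult_minus_left)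
    also have "\<dots> \<le> \<bar>\<alpha>\<bar> * sqrt (\<tau> * r)" using elim by (intro mult_left_mono) auto
    finally have "exp (- \<alpha> * drift j \<omega>) \<le> exp (\<bar>\<alpha>\<bar> * sqrt (\<tau> * r))" by simp
    then show ?case unfolding b_def using hb[of "U j \<omega>"] by (auto intro!: mult_mono)
  qed
  have ce: "AE \<omega> in M. real_cond_exp M (G j) (?g j) \<omega>
      = exp (- \<alpha> * drift j \<omega>) * real_cond_exp M (G j) (\<lambda>\<omega>. h (U j \<omega>)) \<omega>" for j
  proof -
    have "integrable M (?g j)"
      by (rule integrable_const_bound[where B = b]) (use bd[of j] in auto)
    then have "AE \<omega> in M. real_cond_exp M (G j) (\<lambda>\<omega>. exp (- \<alpha> * drift j \<omega>) * h (U j \<omega>)) \<omega>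
      = exp (- \<alpha> * drift j \<omega>) * real_cond_exp M (G j) (\<lambda>\<omega>. h (U j \<omega>)) \<omega>"
      using drift_meas by (intro sub.real_cond_exp_mult) (auto simp: mult.commute)
    then show ?thesis by (simp add: mult.commute)
  qed
  note approx = cond_exp_approx[OF h_meas hb happ \<open>0 \<le> C\<close>, folded K]
  have up: "AE \<omega> in M. 0 \<le> real_cond_exp M (G j) (?g j) \<omega> \<and>
      real_cond_exp M (G j) (?g j) \<omega> \<le> exp (\<tau> * (\<beta> + K * r))" for j
  proof -
    have "AE \<omega> in M. 0 \<le> real_cond_exp M (G j) (?g j) \<omega>"
      using bd[of j] by (intro sub.real_cond_exp_pos) auto
    then show ?thesis
      using ce[of j] approx[of j] by eventually_elim (auto intro!: exp_upper_quadratic)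
  qed
  \<comment> \<open>For the upper estimate the trivial lower bound 0 is enough, so \<tau> and
    \<open>r\<close> need not be small here.\<close>
  note B = prod_cond_exp_bounds[where k = k and g = ?g and b = b, OF meas bd up]
  show "integrable M (\<lambda>\<omega>. \<Prod>j<k. ?g j \<omega>)" by (rule B) simp
  show "expectation (\<lambda>\<omega>. \<Prod>j<k. ?g j \<omega>) \<le> exp (real k * \<tau> * (\<beta> + K * r))"
    using B(3) by (simp flip: exp_of_nat_mult add: mult.assoc)
  assume small: "r \<le> 1" "\<tau> * (2 * \<alpha>\<^sup>2 * r + 8 * K\<^sup>2 * \<tau>) \<le> 1 / 4"
  let ?l = "\<tau> * (\<beta> - (K * r + 4 * \<alpha>\<^sup>2 * r + 16 * K\<^sup>2 * \<tau>))"
  have low: "AE \<omega> in M. exp ?l \<le> real_cond_exp M (G j) (?g j) \<omega> \<and>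
      real_cond_exp M (G j) (?g j) \<omega> \<le> exp (\<tau> * (\<beta> + K * r))" for j
    using ce[of j] approx[of j] up[of j] drift_bound[of j]
  proof eventually_elim
    case (elim \<omega>)
    have "(\<alpha> * drift j \<omega>)\<^sup>2 \<le> \<alpha>\<^sup>2 * (\<tau> * r)"
      using elim(4) by (simp add: power_mult_distrib drift_def mult_left_mono)
    with elim show ?case
      using small \<tau>_pos r_nonneg \<open>0 \<le> C\<close> K by (auto intro!: exp_lower_quadratic)
  qed
  show "exp (real k * \<tau> * (\<beta> - (K * r + 4 * \<alpha>\<^sup>2 * r + 16 * K\<^sup>2 * \<tau>))) \<le> expectation (\<lambda>\<omega>. \<Prod>j<k. ?g j \<omega>)"
    using prod_cond_exp_bounds(2)[where k = k and g = ?g and b = b, OF meas bd low]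
    by (simp flip: exp_of_nat_mult add: mult.assoc)
qed

end

section \<open>Sub-Gaussian bounds for the drift\<close>

lemma sum_pairs: "(\<Sum>i<k. f i) = (\<Sum>i<k div 2. f (2 * i) + f (2 * i + 1)) + (if odd k then f (k - 1) else 0)"
  for f :: "nat \<Rightarrow> real"
proof -
  have *: "(\<Sum>i<2 * q. f i) = (\<Sum>i<q. f (2 * i) + f (2 * i + 1))" for q
    by (induction q) auto
  show ?thesis
  proof (cases "even k")
    case True
    then show ?thesis using *[of "k div 2"] by simp
  next
    case False
    then obtain q where "k = Suc (2 * q)" by (metis oddE Suc_eq_plus1)
    then show ?thesis using *[of q] by simp
  qed
qed

text \<open>The linear term appears exactly, so it disappears under a conditional expectation when
  \<open>u\<close> is a martingale difference, and the rest is quadratic for \<open>u\<close> of any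
  size.\<close>

lemma exp_le_self_plus_exp_square: "exp u \<le> u + exp (u\<^sup>2)" for u :: real
proof -
  have sq: "1 + u\<^sup>2 \<le> exp (u\<^sup>2)" by (rule exp_ge_add_one_self)
  consider "\<bar>u\<bar> \<le> 1" | "u > 1" | "u < -1" by linarith
  then show ?thesis
  proof cases
    case 1
    show ?thesis
    proof (cases "0 \<le> u")
      case True
      then have "exp u \<le> 1 + u + u\<^sup>2" using 1 by (intro exp_bound) auto
      with sq show ?thesis by linarith
    next
      case False
      \<comment> \<open>For negative \<open>u\<close> Taylor's bound is available for
        \<open>exp (- u)\<close> only. It is inverted with \<open>1 + u + u^2\<close>, whose product
        with \<open>1 - u + u^2 / 2\<close> is at least 1.\<close>
      have "1 + (- u) + (- u)\<^sup>2 / 2 \<le> exp (- u)" using False by (intro exp_lower_Taylor_quadratic) auto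
      then have "1 \<le> exp u * exp (- u) \<and> exp u * (1 - u + u\<^sup>2 / 2) \<le> exp u * exp (- u)"
        by (intro conjI mult_left_mono) (auto simp flip: exp_add)
      then have *: "exp u * (1 - u + u\<^sup>2 / 2) \<le> 1" by (simp flip: exp_add)
      have "(1 + u + u\<^sup>2) * (1 - u + u\<^sup>2 / 2) = 1 + u\<^sup>2 / 2 * (1 - u + u\<^sup>2)"
        by (simp add: power2_eq_square field_simps)
      moreover have "0 \<le> u\<^sup>2 / 2 * (1 - u + u\<^sup>2)" using False by simp
      ultimately have "exp u * (1 - u + u\<^sup>2 / 2) \<le> (1 + u + u\<^sup>2) * (1 - u + u\<^sup>2 / 2)"
        using * by linarith
      moreover have "0 < 1 - u + u\<^sup>2 / 2" using False by (intro add_pos_nonneg) auto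
      ultimately have "exp u \<le> 1 + u + u\<^sup>2" by simp
      with sq show ?thesis by linarith
    qed
  next
    case 2
    then have "u \<le> u\<^sup>2" by (simp add: power2_eq_square)
    then have "exp u \<le> exp (u\<^sup>2)" by simp
    with 2 show ?thesis by linarith
  next
    case 3
    have "1 * (- u) \<le> (- u) * (- u)" using 3 by (intro mult_right_mono) auto
    then have "- u \<le> u\<^sup>2" by (simp add: power2_eq_square)
    moreover have "exp u \<le> 1" using 3 by simp
    ultimately show ?thesis using sq by linarith
  qed
qed

lemma mult_le_abs_mult: "\<bar>y\<bar> \<le> b \<Longrightarrow> t * y \<le> \<bar>t\<bar> * b" for t y b :: real
  using mult_left_mono[of "\<bar>y\<bar>" b "\<bar>t\<bar>"] abs_ge_self[of "t * y"] by (simp add: abs_mult)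

lemma exp_le_exp_abs: "\<bar>y\<bar> \<le> b \<Longrightarrow> exp (\<theta> * y) \<le> exp (\<bar>\<theta>\<bar> * b)" for \<theta> y b :: real
  using mult_le_abs_mult[of y b \<theta>] by simp

section \<open>Sub-Gaussian variables without independence\<close>

context prob_space
begin

text \<open>The term \<open>1 / 2\<close> in the exponent makes room for bounded variables that are not centered.\<close>

definition subgaussian :: "('a \<Rightarrow> real) \<Rightarrow> real \<Rightarrow> bool" where
  "subgaussian A s \<longleftrightarrow> A \<in> borel_measurable M \<and>
     (\<forall>t. integrable M (\<lambda>\<omega>. exp (t * A \<omega>)) \<and>
          expectation (\<lambda>\<omega>. exp (t * A \<omega>)) \<le> exp (1 / 2 + t\<^sup>2 * s\<^sup>2 / 2))"

lemma subgaussian_mono: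
  assumes "subgaussian A s" "0 \<le> s" "s \<le> s'"
  shows "subgaussian A s'"
proof -
  have "exp (1 / 2 + t\<^sup>2 * s\<^sup>2 / 2) \<le> exp (1 / 2 + t\<^sup>2 * s'\<^sup>2 / 2)" for t
    using assms(2,3) by (auto intro!: mult_left_mono power_mono)
  with assms(1) show ?thesis unfolding subgaussian_def by (meson order_trans)
qed

text \<open>Convexity of \<open>exp\<close> with the weights \<open>s / (s + s')\<close> and
  \<open>s' / (s + s')\<close> takes the place of independence; the parameters add up instead of
  their squares. These weights make both exponents equal, and as the combination is convex, the
  additive \<open>1 / 2\<close> does not accumulate.\<close>

lemma subgaussian_add:
  assumes A: "subgaussian A s" and B: "subgaussian B s'" and "0 < s" "0 < s'"
  shows "subgaussian (\<lambda>\<omega>. A \<omega> + B \<omega>) (s + s')"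
  unfolding subgaussian_def
proof (intro conjI allI)
  note [measurable] = A[unfolded subgaussian_def, THEN conjunct1] B[unfolded subgaussian_def, THEN conjunct1]
  show "(\<lambda>\<omega>. A \<omega> + B \<omega>) \<in> borel_measurable M" by measurable
  fix t
  define w where "w = s / (s + s')"
  have w: "0 < w" "0 < 1 - w" "1 - w = s' / (s + s')"
    using assms by (auto simp: w_def field_simps)
  have conv: "exp (t * (A \<omega> + B \<omega>)) \<le> w * exp (t / w * A \<omega>) + (1 - w) * exp (t / (1 - w) * B \<omega>)" for \<omega>
  proof -
    have "convex_on UNIV (exp :: real \<Rightarrow> real)" using convex_on_exp[of 1] by simp
    from convex_onD[OF this, of "1 - w" "t / w * A \<omega>" "t / (1 - w) * B \<omega>"] w(1,2)
    have "exp (w * (t / w * A \<omega>) + (1 - w) * (t / (1 - w) * B \<omega>)) \<le>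
        w * exp (t / w * A \<omega>) + (1 - w) * exp (t / (1 - w) * B \<omega>)" by simp
    moreover have "w * (t / w * A \<omega>) + (1 - w) * (t / (1 - w) * B \<omega>) = t * (A \<omega> + B \<omega>)"
      using w(1,2) by (simp add: distrib_left)
    ultimately show ?thesis by simp
  qed
  have iA: "integrable M (\<lambda>\<omega>. exp (t / w * A \<omega>))" and iB: "integrable M (\<lambda>\<omega>. exp (t / (1 - w) * B \<omega>))"
    using A B unfolding subgaussian_def by blast+
  have i: "integrable M (\<lambda>\<omega>. w * exp (t / w * A \<omega>) + (1 - w) * exp (t / (1 - w) * B \<omega>))"
    using iA iB by auto
  show int: "integrable M (\<lambda>\<omega>. exp (t * (A \<omega> + B \<omega>)))"
    by (rule Bochner_Integration.integrable_bound[OF i])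
       (measurable, use conv w in \<open>force intro: order_trans[OF _ abs_ge_self]\<close>)
  have e: "(t / w)\<^sup>2 * s\<^sup>2 = t\<^sup>2 * (s + s')\<^sup>2" "(t / (1 - w))\<^sup>2 * s'\<^sup>2 = t\<^sup>2 * (s + s')\<^sup>2"
    using assms unfolding w(3) by (simp_all add: w_def power_divide power_mult_distrib)
  have "expectation (\<lambda>\<omega>. exp (t * (A \<omega> + B \<omega>))) \<le>
      expectation (\<lambda>\<omega>. w * exp (t / w * A \<omega>) + (1 - w) * exp (t / (1 - w) * B \<omega>))"
    by (rule integral_mono[OF int i conv])
  also have "\<dots> = w * expectation (\<lambda>\<omega>. exp (t / w * A \<omega>)) + (1 - w) * expectation (\<lambda>\<omega>. exp (t / (1 - w) * B \<omega>))"
    using iA iB by simp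
  also have "\<dots> \<le> w * exp (1 / 2 + (t / w)\<^sup>2 * s\<^sup>2 / 2) + (1 - w) * exp (1 / 2 + (t / (1 - w))\<^sup>2 * s'\<^sup>2 / 2)"
    using w(1,2) A[unfolded subgaussian_def, THEN conjunct2, THEN spec, of "t / w"]
      B[unfolded subgaussian_def, THEN conjunct2, THEN spec, of "t / (1 - w)"]
    by (intro add_mono mult_left_mono) auto
  also have "\<dots> = exp (1 / 2 + t\<^sup>2 * (s + s')\<^sup>2 / 2)" unfolding e by (simp flip: distrib_right)
  finally show "expectation (\<lambda>\<omega>. exp (t * (A \<omega> + B \<omega>))) \<le> exp (1 / 2 + t\<^sup>2 * (s + s')\<^sup>2 / 2)" .
qed

text \<open>The inequality between the arithmetic and the geometric mean turns
  \<open>\<bar>t\<bar> * b\<close> into \<open>1 / 2 + t^2 * b^2 / 2\<close>.\<close>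

lemma subgaussian_bounded:
  assumes [measurable]: "A \<in> borel_measurable M" and bd: "AE \<omega> in M. \<bar>A \<omega>\<bar> \<le> b"
  shows "subgaussian A b"
  unfolding subgaussian_def
proof (intro conjI allI)
  fix t
  have *: "AE \<omega> in M. exp (t * A \<omega>) \<le> exp (1 / 2 + t\<^sup>2 * b\<^sup>2 / 2)"
    using bd
  proof eventually_elim
    case (elim \<omega>)
    have "t * A \<omega> \<le> \<bar>t\<bar> * b"
      using elim by (rule mult_le_abs_mult)
    also have "\<dots> \<le> 1 / 2 + t\<^sup>2 * b\<^sup>2 / 2"
      using sum_squares_bound[of "1" "\<bar>t\<bar> * b"] by (simp add: power_mult_distrib)
    finally show ?case by simp
  qed
  show int: "integrable M (\<lambda>\<omega>. exp (t * A \<omega>))"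
    by (rule integrable_const_bound[where B = "exp (1 / 2 + t\<^sup>2 * b\<^sup>2 / 2)"]) (use * in auto)
  show "expectation (\<lambda>\<omega>. exp (t * A \<omega>)) \<le> exp (1 / 2 + t\<^sup>2 * b\<^sup>2 / 2)"
    using integral_mono_AE[OF int _ *] by (simp add: prob_space)
qed simp

lemma subgaussian_tail:
  assumes A: "subgaussian A s" and "0 < s" "0 \<le> u"
  shows "prob {\<omega> \<in> space M. u \<le> \<bar>A \<omega>\<bar>} \<le> 2 * exp (1 / 2 - u\<^sup>2 / (2 * s\<^sup>2))"
proof -
  note [measurable] = A[unfolded subgaussian_def, THEN conjunct1]
  have one: "prob {\<omega> \<in> space M. u \<le> \<epsilon> * A \<omega>} \<le> exp (1 / 2 - u\<^sup>2 / (2 * s\<^sup>2))"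
    if "\<epsilon> = 1 \<or> \<epsilon> = -1" for \<epsilon> :: real
  proof -
    \<comment> \<open>The minimiser of the Chernoff exponent
      \<open>t^2 * s^2 / 2 - t * u\<close>.\<close>
    define t where "t = u / s\<^sup>2"
    have int: "integrable M (\<lambda>\<omega>. exp ((t * \<epsilon>) * A \<omega>))" and
      le: "expectation (\<lambda>\<omega>. exp ((t * \<epsilon>) * A \<omega>)) \<le> exp (1 / 2 + (t * \<epsilon>)\<^sup>2 * s\<^sup>2 / 2)"
      using A unfolding subgaussian_def by blast+
    have "prob {\<omega> \<in> space M. u \<le> \<epsilon> * A \<omega>} \<le> prob {\<omega> \<in> space M. exp (t * u) \<le> exp ((t * \<epsilon>) * A \<omega>)}"
      using assms by (intro finite_measure_mono) (auto simp: t_def mult.assoc intro!: mult_left_mono divide_right_mono)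
    also have "\<dots> \<le> expectation (\<lambda>\<omega>. exp ((t * \<epsilon>) * A \<omega>)) / exp (t * u)"
      by (rule integral_Markov_inequality_measure[OF int, where A = "{}"]) auto
    also have "\<dots> \<le> exp (1 / 2 + (t * \<epsilon>)\<^sup>2 * s\<^sup>2 / 2) / exp (t * u)"
      by (intro divide_right_mono le) auto
    also have "\<dots> = exp (1 / 2 + (t * \<epsilon>)\<^sup>2 * s\<^sup>2 / 2 - t * u)" by (simp add: exp_diff)
    also have "1 / 2 + (t * \<epsilon>)\<^sup>2 * s\<^sup>2 / 2 - t * u = 1 / 2 - u\<^sup>2 / (2 * s\<^sup>2)"
    proof -
      have "(t * \<epsilon>)\<^sup>2 * s\<^sup>2 = u\<^sup>2 / s\<^sup>2" "t * u = u\<^sup>2 / s\<^sup>2"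
        using that \<open>0 < s\<close> by (auto simp: t_def power2_eq_square)
      then show ?thesis by simp
    qed
    finally show ?thesis .
  qed
  have "prob {\<omega> \<in> space M. u \<le> \<bar>A \<omega>\<bar>} \<le>
      prob ({\<omega> \<in> space M. u \<le> 1 * A \<omega>} \<union> {\<omega> \<in> space M. u \<le> (-1) * A \<omega>})"
    by (intro finite_measure_mono) auto
  also have "\<dots> \<le> prob {\<omega> \<in> space M. u \<le> 1 * A \<omega>} + prob {\<omega> \<in> space M. u \<le> (-1) * A \<omega>}"
    by (intro measure_Un_le) auto
  also have "\<dots> \<le> 2 * exp (1 / 2 - u\<^sup>2 / (2 * s\<^sup>2))" using one[of 1] one[of "-1"] by simp
  finally show ?thesis .
qed

end

section \<open>Dyadic martingale decomposition of sums of drifts\<close>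

context filtered_prob_space
begin

text \<open>Each difference contributes \<open>exp (t^2 * b^2)\<close> by
  \<open>exp_le_self_plus_exp_square\<close>, twice the exponent of Hoeffding's inequality; this is
  the factor 2 in the condition on \<open>s\<close>.\<close>

lemma subgaussian_martingale:
  assumes meas: "\<And>i. D i \<in> borel_measurable (G (Suc i))"
    and bd: "\<And>i. AE \<omega> in M. \<bar>D i \<omega>\<bar> \<le> b"
    and mart: "\<And>i. AE \<omega> in M. real_cond_exp M (G i) (D i) \<omega> = 0"
    and s: "2 * real p * b\<^sup>2 \<le> s\<^sup>2"
  shows "subgaussian (\<lambda>\<omega>. \<Sum>i<p. D i \<omega>) s"
  unfolding subgaussian_def
proof (intro conjI allI)
  have [measurable]: "D i \<in> borel_measurable M" for i using meas by (rule measurable_G)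
  show "(\<lambda>\<omega>. \<Sum>i<p. D i \<omega>) \<in> borel_measurable M" by measurable
  fix t
  have intD: "integrable M (D i)" for i
    by (rule integrable_const_bound[where B = b]) (use bd[of i] in auto)
  have bde: "AE \<omega> in M. 0 \<le> exp (t * D i \<omega>) \<and> exp (t * D i \<omega>) \<le> exp (\<bar>t\<bar> * b)" for i
    using bd[of i]
  proof eventually_elim
    case (elim \<omega>)
    then have "t * D i \<omega> \<le> \<bar>t\<bar> * b"
      by (rule mult_le_abs_mult)
    then show ?case by simp
  qed
  have ce: "AE \<omega> in M. 0 \<le> real_cond_exp M (G i) (\<lambda>\<omega>. exp (t * D i \<omega>)) \<omega> \<and>
      real_cond_exp M (G i) (\<lambda>\<omega>. exp (t * D i \<omega>)) \<omega> \<le> exp (t\<^sup>2 * b\<^sup>2)" for i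
  proof -
    have "AE \<omega> in M. exp (t * D i \<omega>) \<le> t * D i \<omega> + exp (t\<^sup>2 * b\<^sup>2)"
      using bd[of i]
    proof eventually_elim
      case (elim \<omega>)
      then have "(D i \<omega>)\<^sup>2 \<le> b\<^sup>2" by (meson abs_ge_zero order_trans power2_le_iff_abs_le)
      then have "exp ((t * D i \<omega>)\<^sup>2) \<le> exp (t\<^sup>2 * b\<^sup>2)" by (simp add: power_mult_distrib mult_left_mono)
      then show ?case using exp_le_self_plus_exp_square[of "t * D i \<omega>"] by linarith
    qed
    moreover have "integrable M (\<lambda>\<omega>. exp (t * D i \<omega>))"
      by (rule integrable_const_bound[where B = "exp (\<bar>t\<bar> * b)"]) (use bde[of i] in auto)
    ultimately have "AE \<omega> in M. real_cond_exp M (G i) (\<lambda>\<omega>. exp (t * D i \<omega>)) \<omega> \<le>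
        real_cond_exp M (G i) (\<lambda>\<omega>. t * D i \<omega> + exp (t\<^sup>2 * b\<^sup>2)) \<omega>"
      using intD by (intro sub.real_cond_exp_mono) auto
    moreover have "AE \<omega> in M. real_cond_exp M (G i) (\<lambda>\<omega>. t * D i \<omega> + exp (t\<^sup>2 * b\<^sup>2)) \<omega> =
        real_cond_exp M (G i) (\<lambda>\<omega>. t * D i \<omega>) \<omega> + real_cond_exp M (G i) (\<lambda>\<omega>. exp (t\<^sup>2 * b\<^sup>2)) \<omega>"
      using intD by (intro sub.real_cond_exp_add) auto
    moreover have "AE \<omega> in M. real_cond_exp M (G i) (\<lambda>\<omega>. t * D i \<omega>) \<omega> = t * real_cond_exp M (G i) (D i) \<omega>"
      using intD by (intro sub.real_cond_exp_cmult)
    moreover have "AE \<omega> in M. real_cond_exp M (G i) (\<lambda>\<omega>. exp (t\<^sup>2 * b\<^sup>2)) \<omega> = exp (t\<^sup>2 * b\<^sup>2)"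
      by (intro sub.real_cond_exp_F_meas) auto
    moreover have "AE \<omega> in M. 0 \<le> real_cond_exp M (G i) (\<lambda>\<omega>. exp (t * D i \<omega>)) \<omega>"
      by (intro sub.real_cond_exp_pos) auto
    ultimately show ?thesis using mart[of i] by eventually_elim simp
  qed
  have meas': "(\<lambda>\<omega>. exp (t * D i \<omega>)) \<in> borel_measurable (G (Suc i))" for i
    using meas[of i] by measurable
  note P = prod_cond_exp_bounds[where k = p and g = "\<lambda>i \<omega>. exp (t * D i \<omega>)", OF meas' bde ce]
  show "integrable M (\<lambda>\<omega>. exp (t * (\<Sum>i<p. D i \<omega>)))"
    using P(1) by (simp add: sum_distrib_left exp_sum)
  have "expectation (\<lambda>\<omega>. exp (t * (\<Sum>i<p. D i \<omega>))) \<le> exp (t\<^sup>2 * b\<^sup>2) ^ p"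
    using P(3) by (simp add: sum_distrib_left exp_sum)
  also have "\<dots> = exp (t\<^sup>2 * (2 * real p * b\<^sup>2) / 2)" by (simp flip: exp_of_nat_mult add: algebra_simps)
  also have "\<dots> \<le> exp (1 / 2 + t\<^sup>2 * s\<^sup>2 / 2)"
    using mult_left_mono[OF s, of "t\<^sup>2"] by simp
  finally show "expectation (\<lambda>\<omega>. exp (t * (\<Sum>i<p. D i \<omega>))) \<le> exp (1 / 2 + t\<^sup>2 * s\<^sup>2 / 2)" .
qed

definition block_drift :: "(nat \<Rightarrow> 'a \<Rightarrow> real) \<Rightarrow> nat \<Rightarrow> nat \<Rightarrow> 'a \<Rightarrow> real" where
  "block_drift Y l i = real_cond_exp M (G (i * 2 ^ l)) (\<lambda>\<omega>. \<Sum>j\<in>{i * 2 ^ l..<Suc i * 2 ^ l}. Y j \<omega>)"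

text \<open>The dyadic argument of Peligrad, Utev and Wu: replacing the pairs of consecutive drifts by their
  conditional expectations leaves a bounded martingale, and the sequence of the conditional
  expectations is half as long.\<close>

lemma subgaussian_block_drift:
  assumes Y_int: "\<And>j. integrable M (Y j)"
    and bd: "\<And>l i. AE \<omega> in M. \<bar>block_drift Y l i \<omega>\<bar> \<le> B l"
    and B_pos: "\<And>l. 0 < B l" and B_Suc: "\<And>l. B (Suc l) \<le> 2 * B l"
    and a_pos: "\<And>l. 0 < a l" and a_Suc: "\<And>l. B l + a (Suc l) / sqrt 2 \<le> a l"
  shows "subgaussian (\<lambda>\<omega>. \<Sum>i<k. block_drift Y l i \<omega>) (5 * sqrt k * a l)"
proof (induction k arbitrary: l rule: less_induct)
  case (less k)
  let ?e = "block_drift Y"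
  have e_meas: "?e l i \<in> borel_measurable (G (i * 2 ^ l))" for l i
    by (simp add: block_drift_def)
  then have e_meas_M [measurable]: "?e l i \<in> borel_measurable M" for l i
    by (rule measurable_G)
  have a_ge: "B l \<le> a l" using a_pos[of "Suc l"] a_Suc[of l] by (smt (verit) divide_pos_pos real_sqrt_gt_zero)
  define p where "p = k div 2"
  \<comment> \<open>\<open>D\<close> consists of martingale differences for the filtration sampled
    at the starts of the blocks of length \<open>2 ^ Suc l\<close>, and \<open>L\<close> is the
    block left unpaired when \<open>k\<close> is odd.\<close>
  define D where "D i \<omega> = ?e l (2 * i) \<omega> + ?e l (2 * i + 1) \<omega> - ?e (Suc l) i \<omega>" for i \<omega>
  define L where "L \<omega> = (if odd k then ?e l (k - 1) \<omega> else 0)" for \<omega>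
  have [measurable]: "L \<in> borel_measurable M" unfolding L_def by measurable
  have decomp: "(\<Sum>i<k. ?e l i \<omega>) = ((\<Sum>i<p. D i \<omega>) + (\<Sum>i<p. ?e (Suc l) i \<omega>)) + L \<omega>" for \<omega>
    unfolding sum_pairs[of "\<lambda>i. ?e l i \<omega>" k] D_def L_def p_def by (simp add: sum_subtractf)
  have L_sub: "subgaussian L (B l)"
    by (rule subgaussian_bounded, simp)
       (use bd[of l "k - 1"] B_pos[of l] in \<open>auto simp: L_def elim: eventually_mono\<close>)
  have sqp: "sqrt (real p) \<le> sqrt (real k) / sqrt 2"
    unfolding p_def by (simp flip: real_sqrt_divide)
  consider "k = 0" | "k = 1" | "k \<ge> 2" by linarith
  then show ?case
  proof cases
    case 1
    show ?thesis using subgaussian_bounded[of "\<lambda>_. 0" 0] by (simp add: 1)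
  next
    case 2
    then have "(\<lambda>\<omega>. \<Sum>i<k. ?e l i \<omega>) = L" by (auto simp: L_def)
    then show ?thesis
      using subgaussian_mono[OF L_sub, of "5 * sqrt (real k) * a l"] B_pos[of l] a_ge 2 by simp
  next
    case 3
    then have "p < k" "p > 0" by (auto simp: p_def)
    define F where "F i = G (i * 2 ^ Suc l)" for i
    interpret F: filtered_prob_space M F
      by unfold_locales (auto simp only: F_def intro!: subalg_G mono_G mult_right_mono)
    have D_meas: "D i \<in> borel_measurable (F (Suc i))" for i
      unfolding D_def F_def
      using measurable_G_mono[OF e_meas[of l "2 * i"], of "Suc i * 2 ^ Suc l"]
        measurable_G_mono[OF e_meas[of l "2 * i + 1"], of "Suc i * 2 ^ Suc l"]
        measurable_G_mono[OF e_meas[of "Suc l" i], of "Suc i * 2 ^ Suc l"]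
      by (simp add: algebra_simps)
    have D_bd: "AE \<omega> in M. \<bar>D i \<omega>\<bar> \<le> 4 * B l" for i
      using bd[of l "2 * i"] bd[of l "2 * i + 1"] bd[of "Suc l" i]
      by eventually_elim (use B_Suc[of l] in \<open>simp add: D_def\<close>)
    have D_mart: "AE \<omega> in M. real_cond_exp M (F i) (D i) \<omega> = 0" for i
    proof -
      define S where "S q \<omega> = (\<Sum>j\<in>{q * 2 ^ l..<Suc q * 2 ^ l}. Y j \<omega>)" for q \<omega>
      have S_int: "integrable M (S q)" for q unfolding S_def using Y_int by auto
      have e_eq: "?e l q = real_cond_exp M (G (q * 2 ^ l)) (S q)" for q
        unfolding block_drift_def S_def ..
      have e_int: "integrable M (?e l q)" for q
        unfolding e_eq using S_int by (rule sub.real_cond_exp_int)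
      have S2: "?e (Suc l) i = real_cond_exp M (F i) (\<lambda>\<omega>. S (2 * i) \<omega> + S (2 * i + 1) \<omega>)"
      proof -
        have "(\<Sum>j\<in>{i * 2 ^ Suc l..<Suc i * 2 ^ Suc l}. Y j \<omega>) = S (2 * i) \<omega> + S (2 * i + 1) \<omega>" for \<omega>
        proof -
          have "i * 2 ^ Suc l = 2 * i * 2 ^ l" "Suc i * 2 ^ Suc l = Suc (2 * i + 1) * 2 ^ l"
            "(2 * i + 1) * 2 ^ l = Suc (2 * i) * 2 ^ l" by simp_all
          then show ?thesis
            unfolding S_def by (simp only:) (intro sum.atLeastLessThan_concat[symmetric] mult_right_mono; simp)
        qed
        then show ?thesis unfolding block_drift_def F_def by simp
      qed
      have e2_int: "integrable M (?e (Suc l) i)"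
        unfolding S2 by (rule F.sub.real_cond_exp_int) (use S_int in auto)
      \<comment> \<open>Tower property: both halves of a double block start no earlier than the
        double block itself.\<close>
      have nest: "AE \<omega> in M. real_cond_exp M (F i) (?e l q) \<omega> = real_cond_exp M (F i) (S q) \<omega>"
        if "2 * i \<le> q" for q
        unfolding e_eq F_def
      proof (rule sub.real_cond_exp_nested_subalg[OF subalg_G _ S_int])
        have "i * 2 ^ Suc l \<le> q * 2 ^ l" using that by simp
        then show "subalgebra (G (q * 2 ^ l)) (G (i * 2 ^ Suc l))" by (rule subalgebra_G_mono)
      qed
      have "AE \<omega> in M. real_cond_exp M (F i) (D i) \<omega> =
          real_cond_exp M (F i) (\<lambda>\<omega>. ?e l (2 * i) \<omega> + ?e l (2 * i + 1) \<omega>) \<omega> - real_cond_exp M (F i) (?e (Suc l) i) \<omega>"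
        unfolding D_def by (rule F.sub.real_cond_exp_diff) (use e_int e2_int in auto)
      moreover have "AE \<omega> in M. real_cond_exp M (F i) (\<lambda>\<omega>. ?e l (2 * i) \<omega> + ?e l (2 * i + 1) \<omega>) \<omega> =
          real_cond_exp M (F i) (?e l (2 * i)) \<omega> + real_cond_exp M (F i) (?e l (2 * i + 1)) \<omega>"
        by (rule F.sub.real_cond_exp_add) (use e_int in auto)
      moreover have "AE \<omega> in M. real_cond_exp M (F i) (?e (Suc l) i) \<omega> = ?e (Suc l) i \<omega>"
        by (rule F.sub.real_cond_exp_F_meas[OF e2_int]) (use e_meas[of "Suc l" i] in \<open>simp add: F_def\<close>)
      moreover have "AE \<omega> in M. ?e (Suc l) i \<omega> = real_cond_exp M (F i) (S (2 * i)) \<omega> + real_cond_exp M (F i) (S (2 * i + 1)) \<omega>"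
        unfolding S2 by (rule F.sub.real_cond_exp_add) (use S_int in auto)
      ultimately show ?thesis
        using nest[of "2 * i", OF order_refl] nest[of "2 * i + 1", OF le_add1] by eventually_elim simp
    qed
    \<comment> \<open>The differences are bounded by \<open>4 * B l\<close>, namely two blocks of
      level \<open>l\<close> and one of level \<open>Suc l\<close>, so the martingale needs
      \<open>s^2 = 2 * p * (4 * B l)^2\<close>.\<close>
    define s where "s = 4 * sqrt 2 * sqrt p * B l"
    have D_sub: "subgaussian (\<lambda>\<omega>. \<Sum>i<p. D i \<omega>) s"
      by (rule F.subgaussian_martingale[OF D_meas D_bd D_mart])
         (simp add: s_def power_mult_distrib)
    define s' where "s' = 5 * sqrt p * a (Suc l)"
    have E_sub: "subgaussian (\<lambda>\<omega>. \<Sum>i<p. ?e (Suc l) i \<omega>) s'"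
      unfolding s'_def by (rule less.IH) fact
    have pos: "0 < s" "0 < s'" using \<open>p > 0\<close> B_pos a_pos by (auto simp: s_def s'_def)
    have sub: "subgaussian (\<lambda>\<omega>. \<Sum>i<k. ?e l i \<omega>) ((s + s') + B l)"
      unfolding decomp by (intro subgaussian_add D_sub E_sub L_sub pos add_pos_pos B_pos)
    \<comment> \<open>Origin of the constant 5: the martingale takes
      \<open>4 * sqrt k * B l\<close>, the unpaired block one more \<open>sqrt k * B l\<close>. The
      halved length supplies the factor \<open>1 / sqrt 2\<close> in the recursion for
      \<open>a\<close>.\<close>
    have "s \<le> 4 * sqrt k * B l"
    proof -
      have "sqrt 2 * sqrt p \<le> sqrt k" using sqp by (simp add: field_simps)
      then show ?thesis using B_pos[of l] by (simp add: s_def mult.assoc mult_right_mono less_imp_le)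
    qed
    moreover have "s' \<le> 5 * sqrt k * (a (Suc l) / sqrt 2)"
      using mult_right_mono[OF sqp, of "a (Suc l)"] a_pos[of "Suc l"] by (simp add: s'_def)
    moreover have "1 * B l \<le> sqrt k * B l" using 3 B_pos[of l] by (intro mult_right_mono) auto
    moreover have "5 * sqrt k * (B l + a (Suc l) / sqrt 2) \<le> 5 * sqrt k * a l"
      using a_Suc by (intro mult_left_mono) auto
    ultimately have "(s + s') + B l \<le> 5 * sqrt k * a l"
      by (simp add: algebra_simps)
    with sub show ?thesis
      using pos B_pos[of l] by (intro subgaussian_mono[OF sub]) auto
  qed
qed

end

section \<open>Truncation and tail bounds\<close>

text \<open>Large values are replaced by 0 and not clipped, so that what the truncation removes is
  the sum of the large variables themselves.\<close>

definition trunc1 :: "real \<Rightarrow> real" where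
  "trunc1 u = (if \<bar>u\<bar> \<le> 1 then u else 0)"

lemma trunc1_measurable [measurable]: "trunc1 \<in> borel_measurable borel"
  unfolding trunc1_def by measurable

lemma abs_trunc1: "\<bar>trunc1 u\<bar> \<le> 1" "\<bar>trunc1 u\<bar> \<le> \<bar>u\<bar>"
  by (auto simp: trunc1_def)

lemma exp_taylor1: "\<bar>exp v - (1 + v)\<bar> \<le> v\<^sup>2 * exp \<bar>v\<bar>" for v :: real
proof -
  obtain t where t: "\<bar>t\<bar> \<le> \<bar>v\<bar>" "exp v = (\<Sum>m<2. v ^ m / fact m) + exp t / fact 2 * v ^ 2"
    using Maclaurin_exp_le by blast
  have "exp t \<le> exp \<bar>v\<bar>" using t(1) by (simp add: abs_le_iff)
  then have "exp t * v\<^sup>2 \<le> exp \<bar>v\<bar> * v\<^sup>2" by (rule mult_right_mono) simp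
  moreover have "exp v - (1 + v) = exp t * v\<^sup>2 / 2" using t(2) by (simp add: lessThan_Suc numeral_2_eq_2)
  moreover have "0 \<le> exp t * v\<^sup>2" by simp
  ultimately show ?thesis unfolding mult.commute[of "v\<^sup>2"] by linarith
qed

lemma exp_taylor2: "\<bar>exp v - (1 + v + v\<^sup>2 / 2)\<bar> \<le> \<bar>v\<bar> ^ 3 * exp \<bar>v\<bar>" for v :: real
proof -
  obtain t where t: "\<bar>t\<bar> \<le> \<bar>v\<bar>" "exp v = (\<Sum>m<3. v ^ m / fact m) + exp t / fact 3 * v ^ 3"
    using Maclaurin_exp_le by blast
  have "exp t \<le> exp \<bar>v\<bar>" using t(1) by (simp add: abs_le_iff)
  then have "exp t * \<bar>v\<bar> ^ 3 \<le> exp \<bar>v\<bar> * \<bar>v\<bar> ^ 3" by (rule mult_right_mono) simp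
  moreover have "exp v - (1 + v + v\<^sup>2 / 2) = exp t * v ^ 3 / 6"
    using t(2) by (simp add: eval_nat_numeral fact_numeral)
  then have "\<bar>exp v - (1 + v + v\<^sup>2 / 2)\<bar> = exp t * \<bar>v\<bar> ^ 3 / 6"
    by (simp only: abs_mult abs_divide power_abs) simp
  moreover have "0 \<le> exp t * \<bar>v\<bar> ^ 3" by simp
  ultimately show ?thesis unfolding mult.commute[of "\<bar>v\<bar> ^ 3"] by linarith
qed

lemma power_le_powr_small:
  fixes u \<rho> :: real
  assumes "\<bar>u\<bar> \<le> 1" "0 < \<rho>" "2 + \<rho> \<le> real n"
  shows "\<bar>u\<bar> ^ n \<le> \<bar>u\<bar> powr (2 + \<rho>)"
proof (cases "u = 0")
  case True
  then show ?thesis using assms by (cases n) auto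
next
  case False
  then have "\<bar>u\<bar> ^ n = \<bar>u\<bar> powr n" by (simp add: powr_realpow)
  also have "\<dots> \<le> \<bar>u\<bar> powr (2 + \<rho>)" using assms by (intro powr_mono') auto
  finally show ?thesis .
qed

lemma power_le_powr_large:
  fixes u \<rho> :: real
  assumes "1 < \<bar>u\<bar>" "0 < \<rho>" "n \<le> 2"
  shows "\<bar>u\<bar> ^ n \<le> \<bar>u\<bar> powr (2 + \<rho>)"
proof -
  have "\<bar>u\<bar> ^ n = \<bar>u\<bar> powr n" using assms by (simp add: powr_realpow)
  also have "\<dots> \<le> \<bar>u\<bar> powr (2 + \<rho>)" using assms by (intro powr_mono) auto
  finally show ?thesis .
qed

text \<open>The last summand is Taylor's remainder for \<open>\<bar>u\<bar> \<le> 1\<close>; the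
  others bound the quadratic polynomial beyond 1, where
  \<open>\<bar>u\<bar> powr (2 + \<rho>)\<close> dominates 1, \<open>\<bar>u\<bar>\<close> and
  \<open>u^2\<close>.\<close>

definition tilt_const :: "real \<Rightarrow> real" where
  "tilt_const \<theta> = 2 + \<bar>\<theta>\<bar> + \<theta>\<^sup>2 + \<bar>\<theta>\<bar> ^ 3 * exp \<bar>\<theta>\<bar>"

lemma tilt_const_nonneg: "0 \<le> tilt_const \<theta>"
  unfolding tilt_const_def by simp

text \<open>Beyond the truncation level \<open>p\<close> is left free in the unit interval. The
  value 1 gives the exponential of the truncated variable, the value 0 its restriction to the event
  that no variable is large.\<close>

lemma tilt_approx:
  fixes u \<theta> \<rho> p :: real
  assumes "0 < \<rho>" "\<rho> \<le> 1" and p: "\<bar>u\<bar> \<le> 1 \<Longrightarrow> p = exp (\<theta> * u)" "1 < \<bar>u\<bar> \<Longrightarrow> 0 \<le> p \<and> p \<le> 1"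
  shows "\<bar>p - (1 + \<theta> * u + \<theta>\<^sup>2 / 2 * u\<^sup>2)\<bar> \<le> tilt_const \<theta> * \<bar>u\<bar> powr (2 + \<rho>)"
proof (cases "\<bar>u\<bar> \<le> 1")
  case True
  have "\<bar>\<theta> * u\<bar> \<le> \<bar>\<theta>\<bar>" using True by (simp add: abs_mult mult_left_le)
  then have e: "exp \<bar>\<theta> * u\<bar> \<le> exp \<bar>\<theta>\<bar>" by simp
  have "\<bar>p - (1 + \<theta> * u + (\<theta> * u)\<^sup>2 / 2)\<bar> \<le> \<bar>\<theta> * u\<bar> ^ 3 * exp \<bar>\<theta> * u\<bar>"
    using exp_taylor2[of "\<theta> * u"] p(1)[OF True] by simp
  also have "\<dots> \<le> (\<bar>\<theta>\<bar> ^ 3 * \<bar>u\<bar> powr (2 + \<rho>)) * exp \<bar>\<theta>\<bar>"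
    using e power_le_powr_small[OF True, of \<rho> 3] assms(1,2)
    by (intro mult_mono) (auto simp: abs_mult power_mult_distrib intro: mult_left_mono)
  also have "\<dots> = (\<bar>\<theta>\<bar> ^ 3 * exp \<bar>\<theta>\<bar>) * \<bar>u\<bar> powr (2 + \<rho>)" by simp
  also have "\<dots> \<le> tilt_const \<theta> * \<bar>u\<bar> powr (2 + \<rho>)"
    unfolding tilt_const_def by (intro mult_right_mono) auto
  finally show ?thesis by (simp add: power_mult_distrib)
next
  case False
  let ?P = "\<bar>u\<bar> powr (2 + \<rho>)"
  have P: "1 \<le> ?P" "\<bar>u\<bar> \<le> ?P" "u\<^sup>2 \<le> ?P"
    using power_le_powr_large[of u \<rho> 0] power_le_powr_large[of u \<rho> 1] power_le_powr_large[of u \<rho> 2] False assms(1)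
    by auto
  have "\<bar>p - (1 + \<theta> * u + \<theta>\<^sup>2 / 2 * u\<^sup>2)\<bar> \<le> 1 * 1 + \<bar>\<theta>\<bar> * \<bar>u\<bar> + \<theta>\<^sup>2 * u\<^sup>2"
  proof -
    have "0 \<le> \<theta>\<^sup>2 * u\<^sup>2" "\<theta>\<^sup>2 / 2 * u\<^sup>2 = \<theta>\<^sup>2 * u\<^sup>2 / 2" by simp_all
    then show ?thesis using p(2) False unfolding abs_mult[symmetric] by linarith
  qed
  also have "\<dots> \<le> 2 * ?P + \<bar>\<theta>\<bar> * ?P + \<theta>\<^sup>2 * ?P"
    using P by (intro add_mono mult_mono) auto
  also have "\<dots> = (2 + \<bar>\<theta>\<bar> + \<theta>\<^sup>2) * ?P" by (simp add: algebra_simps)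
  also have "\<dots> \<le> tilt_const \<theta> * ?P"
    unfolding tilt_const_def by (intro mult_right_mono) auto
  finally show ?thesis .
qed

definition square_const :: "real \<Rightarrow> real" where
  "square_const \<kappa> = 2 + \<bar>\<kappa>\<bar> + \<kappa>\<^sup>2 * exp \<bar>\<kappa>\<bar>"

lemma square_const_nonneg: "0 \<le> square_const \<kappa>"
  unfolding square_const_def by simp

text \<open>There is no linear term, and the remainder is of order \<open>u^4\<close> below the
  level 1. Above it the exponential is 1, so the error is the term \<open>\<kappa> * u^2\<close>
  itself.\<close>

lemma square_approx:
  fixes u \<kappa> \<rho> :: real
  assumes "0 < \<rho>" "\<rho> \<le> 1"
  shows "\<bar>exp (\<kappa> * (trunc1 u)\<^sup>2) - (1 + 0 * u + \<kappa> * u\<^sup>2)\<bar> \<le> square_const \<kappa> * \<bar>u\<bar> powr (2 + \<rho>)"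
proof (cases "\<bar>u\<bar> \<le> 1")
  case True
  have "u\<^sup>2 \<le> 1" using True by (simp add: abs_square_le_1)
  then have "\<bar>\<kappa> * u\<^sup>2\<bar> \<le> \<bar>\<kappa>\<bar>" by (simp add: abs_mult mult_left_le)
  then have e: "exp \<bar>\<kappa> * u\<^sup>2\<bar> \<le> exp \<bar>\<kappa>\<bar>" by simp
  have "\<bar>exp (\<kappa> * u\<^sup>2) - (1 + \<kappa> * u\<^sup>2)\<bar> \<le> (\<kappa> * u\<^sup>2)\<^sup>2 * exp \<bar>\<kappa> * u\<^sup>2\<bar>"
    by (rule exp_taylor1)
  also have "(\<kappa> * u\<^sup>2)\<^sup>2 = \<kappa>\<^sup>2 * \<bar>u\<bar> ^ 4" by (simp add: power_mult_distrib)
  also have "\<kappa>\<^sup>2 * \<bar>u\<bar> ^ 4 * exp \<bar>\<kappa> * u\<^sup>2\<bar> \<le> (\<kappa>\<^sup>2 * \<bar>u\<bar> powr (2 + \<rho>)) * exp \<bar>\<kappa>\<bar>"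
    using e power_le_powr_small[OF True, of \<rho> 4] assms
    by (intro mult_mono) (auto intro: mult_left_mono)
  also have "\<dots> = (\<kappa>\<^sup>2 * exp \<bar>\<kappa>\<bar>) * \<bar>u\<bar> powr (2 + \<rho>)" by simp
  also have "\<dots> \<le> square_const \<kappa> * \<bar>u\<bar> powr (2 + \<rho>)"
    unfolding square_const_def by (intro mult_right_mono) auto
  finally show ?thesis using True by (simp add: trunc1_def)
next
  case False
  let ?P = "\<bar>u\<bar> powr (2 + \<rho>)"
  have P: "u\<^sup>2 \<le> ?P" using power_le_powr_large[of u \<rho> 2] False assms(1) by auto
  have "\<bar>exp (\<kappa> * (trunc1 u)\<^sup>2) - (1 + 0 * u + \<kappa> * u\<^sup>2)\<bar> = \<bar>\<kappa>\<bar> * u\<^sup>2"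
    using False by (simp add: trunc1_def abs_mult)
  also have "\<dots> \<le> square_const \<kappa> * ?P"
    unfolding square_const_def using P by (intro mult_mono) auto
  finally show ?thesis .
qed

lemma count_approx:
  fixes u \<kappa> \<rho> :: real
  assumes "0 < \<rho>"
  shows "\<bar>exp (\<kappa> * of_bool (1 < \<bar>u\<bar>)) - (1 + 0 * u + 0 * u\<^sup>2)\<bar> \<le> (1 + exp \<kappa>) * \<bar>u\<bar> powr (2 + \<rho>)"
proof (cases "\<bar>u\<bar> \<le> 1")
  case False
  have "\<bar>exp \<kappa> - 1\<bar> \<le> (1 + exp \<kappa>) * 1" using exp_gt_zero[of \<kappa>] by (simp add: abs_le_iff)
  also have "\<dots> \<le> (1 + exp \<kappa>) * \<bar>u\<bar> powr (2 + \<rho>)"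
    using power_le_powr_large[of u \<rho> 0] False assms by (intro mult_left_mono) auto
  finally show ?thesis using False by simp
qed (simp add: not_less)

lemma (in prob_space) prob_Markov_exp:
  assumes "integrable M (\<lambda>\<omega>. exp (f \<omega>))" "expectation (\<lambda>\<omega>. exp (f \<omega>)) \<le> exp b"
  shows "prob {\<omega> \<in> space M. c \<le> f \<omega>} \<le> exp (b - c)"
proof -
  have "prob {\<omega> \<in> space M. exp c \<le> exp (f \<omega>)} \<le> expectation (\<lambda>\<omega>. exp (f \<omega>)) / exp c"
    by (rule integral_Markov_inequality_measure[OF assms(1), where A = "{}"]) auto
  also have "\<dots> \<le> exp b / exp c" by (intro divide_right_mono assms(2)) auto
  finally show ?thesis by (simp add: exp_diff)
qed

section \<open>Chernoff bounds for the functionals of the array\<close>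

context block_array
begin

text \<open>This is the \<open>x^2\<close> of the overview when
  \<open>\<tau> = x^2 / k\<close>.\<close>

definition speed :: real where "speed = real k * \<tau>"

definition centered :: "'a \<Rightarrow> real" where
  "centered \<omega> = (\<Sum>j<k. trunc1 (U j \<omega>) - drift j \<omega>)"

definition trunc_var :: "'a \<Rightarrow> real" where
  "trunc_var \<omega> = (\<Sum>j<k. (trunc1 (U j \<omega>))\<^sup>2)"

definition large_count :: "'a \<Rightarrow> real" where
  "large_count \<omega> = (\<Sum>j<k. of_bool (1 < \<bar>U j \<omega>\<bar>))"

definition total_drift :: "'a \<Rightarrow> real" where
  "total_drift \<omega> = (\<Sum>j<k. drift j \<omega>)"

definition self_norm :: "'a \<Rightarrow> real" where
  "self_norm \<omega> = (\<Sum>j<k. U j \<omega>) / sqrt (\<Sum>j<k. (U j \<omega>)\<^sup>2)"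

lemma functional_measurable [measurable]:
  "centered \<in> borel_measurable M" "trunc_var \<in> borel_measurable M" "large_count \<in> borel_measurable M"
  "total_drift \<in> borel_measurable M" "self_norm \<in> borel_measurable M"
  unfolding centered_def trunc_var_def large_count_def total_drift_def self_norm_def by measurable

text \<open>The constant \<open>K\<close> of \<open>prod_tilted_bounds\<close> for the slope
  \<theta>, where the quadratic coefficient is \<open>\<theta>^2 / 2\<close>.\<close>

definition tilt_rate :: "real \<Rightarrow> real" where "tilt_rate \<theta> = \<theta>\<^sup>2 / 2 + tilt_const \<theta>"

lemma centered_mgf:
  "integrable M (\<lambda>\<omega>. exp (\<theta> * centered \<omega>))"
  "expectation (\<lambda>\<omega>. exp (\<theta> * centered \<omega>)) \<le> exp (speed * (\<theta>\<^sup>2 / 2 + tilt_rate \<theta> * r))"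
proof -
  have eq: "(\<Prod>j<k. exp (\<theta> * trunc1 (U j \<omega>)) * exp (- \<theta> * drift j \<omega>)) = exp (\<theta> * centered \<omega>)" for \<omega>
    unfolding centered_def sum_distrib_left by (simp add: exp_sum right_diff_distrib exp_diff exp_minus divide_inverse)
  have b: "0 \<le> exp (\<theta> * trunc1 u) \<and> exp (\<theta> * trunc1 u) \<le> exp (\<bar>\<theta>\<bar> * 1)" for u
    by (intro conjI exp_le_exp_abs abs_trunc1) simp
  have a: "\<bar>exp (\<theta> * trunc1 u) - (1 + \<theta> * u + \<theta>\<^sup>2 / 2 * u\<^sup>2)\<bar> \<le> tilt_const \<theta> * \<bar>u\<bar> powr (2 + \<rho>)" for u
    by (rule tilt_approx[OF \<rho>_pos \<rho>_le1]) (auto simp: trunc1_def)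
  have K: "tilt_rate \<theta> = \<bar>\<theta>\<^sup>2 / 2\<bar> + tilt_const \<theta>" by (simp add: tilt_rate_def)
  note P = prod_tilted_bounds[of "\<lambda>u. exp (\<theta> * trunc1 u)", OF _ b a tilt_const_nonneg K]
  show "integrable M (\<lambda>\<omega>. exp (\<theta> * centered \<omega>))"
    using P(1) unfolding eq by simp
  show "expectation (\<lambda>\<omega>. exp (\<theta> * centered \<omega>)) \<le> exp (speed * (\<theta>\<^sup>2 / 2 + tilt_rate \<theta> * r))"
    using P(2) unfolding eq by (simp add: speed_def)
qed

text \<open>Unnormalised density of the tilted measure on the event that no variable is
  large.\<close>

definition tilted :: "real \<Rightarrow> 'a \<Rightarrow> real" where
  "tilted \<theta> \<omega> = of_bool (\<forall>j<k. \<bar>U j \<omega>\<bar> \<le> 1) * exp (\<theta> * centered \<omega>)"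

text \<open>The indicator factorises over the blocks, so it can be made part of \<open>h\<close>.
  Excluding the large variables therefore changes the exponent by \<open>speed * O(r)\<close>
  only.\<close>

lemma tilted_mgf:
  "integrable M (tilted \<theta>)"
  "expectation (tilted \<theta>) \<le> exp (speed * (\<theta>\<^sup>2 / 2 + tilt_rate \<theta> * r))"
  "r \<le> 1 \<Longrightarrow> \<tau> * (2 * \<theta>\<^sup>2 * r + 8 * (tilt_rate \<theta>)\<^sup>2 * \<tau>) \<le> 1 / 4 \<Longrightarrow>
   exp (speed * (\<theta>\<^sup>2 / 2 - (tilt_rate \<theta> * r + 4 * \<theta>\<^sup>2 * r + 16 * (tilt_rate \<theta>)\<^sup>2 * \<tau>))) \<le> expectation (tilted \<theta>)"
proof -
  let ?h = "\<lambda>u. of_bool (\<bar>u\<bar> \<le> 1) * exp (\<theta> * trunc1 u)"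
  have eq: "(\<Prod>j<k. ?h (U j \<omega>) * exp (- \<theta> * drift j \<omega>)) = tilted \<theta> \<omega>" for \<omega>
  proof -
    have "(\<Prod>j<k. of_bool (\<bar>U j \<omega>\<bar> \<le> 1)) = (of_bool (\<forall>j<k. \<bar>U j \<omega>\<bar> \<le> 1) :: real)"
      by (auto intro!: prod.neutral)
    moreover have "(\<Prod>j<k. exp (\<theta> * trunc1 (U j \<omega>)) * exp (- \<theta> * drift j \<omega>)) = exp (\<theta> * centered \<omega>)"
      unfolding centered_def sum_distrib_left by (simp add: exp_sum right_diff_distrib exp_diff exp_minus divide_inverse)
    ultimately show ?thesis unfolding tilted_def by (simp add: mult.assoc prod.distrib)
  qed
  have b: "0 \<le> ?h u \<and> ?h u \<le> exp (\<bar>\<theta>\<bar> * 1)" for u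
    using exp_le_exp_abs[OF abs_trunc1(1), of \<theta> u] by auto
  have a: "\<bar>?h u - (1 + \<theta> * u + \<theta>\<^sup>2 / 2 * u\<^sup>2)\<bar> \<le> tilt_const \<theta> * \<bar>u\<bar> powr (2 + \<rho>)" for u
    by (rule tilt_approx[OF \<rho>_pos \<rho>_le1]) (auto simp: trunc1_def)
  have K: "tilt_rate \<theta> = \<bar>\<theta>\<^sup>2 / 2\<bar> + tilt_const \<theta>" by (simp add: tilt_rate_def)
  note P = prod_tilted_bounds[of ?h, OF _ b a tilt_const_nonneg K]
  show "integrable M (tilted \<theta>)"
    using P(1) unfolding eq by simp
  show "expectation (tilted \<theta>) \<le> exp (speed * (\<theta>\<^sup>2 / 2 + tilt_rate \<theta> * r))"
    using P(2) unfolding eq by (simp add: speed_def)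
  show "exp (speed * (\<theta>\<^sup>2 / 2 - (tilt_rate \<theta> * r + 4 * \<theta>\<^sup>2 * r + 16 * (tilt_rate \<theta>)\<^sup>2 * \<tau>))) \<le> expectation (tilted \<theta>)"
    if "r \<le> 1" "\<tau> * (2 * \<theta>\<^sup>2 * r + 8 * (tilt_rate \<theta>)\<^sup>2 * \<tau>) \<le> 1 / 4"
    using P(3) that unfolding eq by (simp add: speed_def)
qed

lemma trunc_var_mgf:
  "integrable M (\<lambda>\<omega>. exp (\<kappa> * trunc_var \<omega>))"
  "expectation (\<lambda>\<omega>. exp (\<kappa> * trunc_var \<omega>)) \<le> exp (speed * (\<kappa> + (\<bar>\<kappa>\<bar> + square_const \<kappa>) * r))"
proof -
  \<comment> \<open>The linear coefficient is 0 here, so the drift factor is 1.\<close>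
  have eq: "(\<Prod>j<k. exp (\<kappa> * (trunc1 (U j \<omega>))\<^sup>2) * exp (- 0 * drift j \<omega>)) = exp (\<kappa> * trunc_var \<omega>)" for \<omega>
    unfolding trunc_var_def sum_distrib_left by (simp add: exp_sum)
  have b: "0 \<le> exp (\<kappa> * (trunc1 u)\<^sup>2) \<and> exp (\<kappa> * (trunc1 u)\<^sup>2) \<le> exp (\<bar>\<kappa>\<bar> * 1)" for u
    using abs_trunc1(1)[of u] by (intro conjI exp_le_exp_abs) (auto simp: abs_square_le_1)
  note P = prod_tilted_bounds[of "\<lambda>u. exp (\<kappa> * (trunc1 u)\<^sup>2)",
      OF _ b square_approx[OF \<rho>_pos \<rho>_le1] square_const_nonneg refl]
  show "integrable M (\<lambda>\<omega>. exp (\<kappa> * trunc_var \<omega>))"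
    using P(1) unfolding eq by simp
  show "expectation (\<lambda>\<omega>. exp (\<kappa> * trunc_var \<omega>)) \<le> exp (speed * (\<kappa> + (\<bar>\<kappa>\<bar> + square_const \<kappa>) * r))"
    using P(2) unfolding eq by (simp add: speed_def)
qed

lemma large_count_mgf:
  "integrable M (\<lambda>\<omega>. exp (\<kappa> * large_count \<omega>))"
  "expectation (\<lambda>\<omega>. exp (\<kappa> * large_count \<omega>)) \<le> exp (speed * ((1 + exp \<kappa>) * r))"
proof -
  have eq: "(\<Prod>j<k. exp (\<kappa> * of_bool (1 < \<bar>U j \<omega>\<bar>)) * exp (- 0 * drift j \<omega>)) = exp (\<kappa> * large_count \<omega>)" for \<omega>
    unfolding large_count_def sum_distrib_left by (subst exp_sum) simp_all
  have b: "0 \<le> exp (\<kappa> * of_bool (1 < \<bar>u\<bar>)) \<and> exp (\<kappa> * of_bool (1 < \<bar>u\<bar>)) \<le> exp (\<bar>\<kappa>\<bar> * 1)" for u :: real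
    by (intro conjI exp_le_exp_abs) auto
  have "0 \<le> 1 + exp \<kappa>" by (simp add: add_nonneg_nonneg)
  note P = prod_tilted_bounds[of "\<lambda>u. exp (\<kappa> * of_bool (1 < \<bar>u\<bar>))",
      OF _ b count_approx[OF \<rho>_pos] this refl]
  show "integrable M (\<lambda>\<omega>. exp (\<kappa> * large_count \<omega>))"
    using P(1) unfolding eq by simp
  show "expectation (\<lambda>\<omega>. exp (\<kappa> * large_count \<omega>)) \<le> exp (speed * ((1 + exp \<kappa>) * r))"
    using P(2) unfolding eq by (simp add: speed_def)
qed

text \<open>Chernoff's bound at the slopes \<open>y\<close> and \<open>- y\<close>, which are
  optimal for the Gaussian exponent; both have the same \<open>tilt_rate\<close>.\<close>

lemma centered_tail:
  assumes "0 \<le> y"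
  shows "prob {\<omega> \<in> space M. y * speed \<le> \<bar>centered \<omega>\<bar>} \<le> 2 * exp (speed * (- y\<^sup>2 / 2 + tilt_rate y * r))"
proof -
  have one: "prob {\<omega> \<in> space M. y * (y * speed) \<le> (\<epsilon> * y) * centered \<omega>} \<le> exp (speed * (- y\<^sup>2 / 2 + tilt_rate y * r))"
    if "\<epsilon> = 1 \<or> \<epsilon> = -1" for \<epsilon> :: real
  proof -
    have "tilt_rate (\<epsilon> * y) = tilt_rate y" "(\<epsilon> * y)\<^sup>2 = y\<^sup>2"
      using that by (auto simp: tilt_rate_def tilt_const_def)
    then have "prob {\<omega> \<in> space M. y * (y * speed) \<le> (\<epsilon> * y) * centered \<omega>} \<le>
        exp (speed * (y\<^sup>2 / 2 + tilt_rate y * r) - y * (y * speed))"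
      using centered_mgf[of "\<epsilon> * y"] by (intro prob_Markov_exp) auto
    then show ?thesis by (simp add: algebra_simps power2_eq_square)
  qed
  have "prob {\<omega> \<in> space M. y * speed \<le> \<bar>centered \<omega>\<bar>} \<le>
      prob ({\<omega> \<in> space M. y * (y * speed) \<le> (1 * y) * centered \<omega>} \<union> {\<omega> \<in> space M. y * (y * speed) \<le> (- 1 * y) * centered \<omega>})"
  proof (intro finite_measure_mono subsetI)
    fix \<omega> assume "\<omega> \<in> {\<omega> \<in> space M. y * speed \<le> \<bar>centered \<omega>\<bar>}"
    then have "\<omega> \<in> space M" "y * (y * speed) \<le> y * \<bar>centered \<omega>\<bar>"
      using assms by (auto intro: mult_left_mono)
    then show "\<omega> \<in> {\<omega> \<in> space M. y * (y * speed) \<le> (1 * y) * centered \<omega>} \<union> {\<omega> \<in> space M. y * (y * speed) \<le> (- 1 * y) * centered \<omega>}"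
      by (auto simp: abs_if split: if_splits)
  qed auto
  also have "\<dots> \<le> prob {\<omega> \<in> space M. y * (y * speed) \<le> (1 * y) * centered \<omega>} + prob {\<omega> \<in> space M. y * (y * speed) \<le> (- 1 * y) * centered \<omega>}"
    by (intro measure_Un_le) auto
  also have "\<dots> \<le> 2 * exp (speed * (- y\<^sup>2 / 2 + tilt_rate y * r))"
    using one[of 1] one[of "-1"] by simp
  finally show ?thesis .
qed

text \<open>\<kappa> is arbitrary and its cost is multiplied by \<open>r\<close>. For fixed \<eta>
  the exponent can thus be made as negative as desired once \<open>r\<close> is small, which makes
  these events negligible on the scale \<open>speed\<close>.\<close>

lemma trunc_var_tails:
  assumes "0 < \<kappa>"
  shows "prob {\<omega> \<in> space M. trunc_var \<omega> \<le> (1 - \<eta>) * speed} \<le> exp (speed * (- \<kappa> * \<eta> + (\<kappa> + square_const \<kappa>) * r))"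
    and "prob {\<omega> \<in> space M. (1 + \<eta>) * speed \<le> trunc_var \<omega>} \<le> exp (speed * (- \<kappa> * \<eta> + (\<kappa> + square_const \<kappa>) * r))"
proof -
  have "square_const (- \<kappa>) = square_const \<kappa>" by (simp add: square_const_def)
  then have "prob {\<omega> \<in> space M. - \<kappa> * ((1 - \<eta>) * speed) \<le> - \<kappa> * trunc_var \<omega>} \<le>
      exp (speed * (- \<kappa> + (\<kappa> + square_const \<kappa>) * r) - (- \<kappa> * ((1 - \<eta>) * speed)))"
    using trunc_var_mgf[of "- \<kappa>"] assms by (intro prob_Markov_exp) auto
  moreover have "speed * (- \<kappa> + (\<kappa> + square_const \<kappa>) * r) - (- \<kappa> * ((1 - \<eta>) * speed)) =
      speed * (- \<kappa> * \<eta> + (\<kappa> + square_const \<kappa>) * r)" by (simp add: algebra_simps)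
  moreover have "- \<kappa> * ((1 - \<eta>) * speed) \<le> - \<kappa> * x \<longleftrightarrow> x \<le> (1 - \<eta>) * speed" for x
    using assms by (simp add: mult_le_cancel_left)
  ultimately show "prob {\<omega> \<in> space M. trunc_var \<omega> \<le> (1 - \<eta>) * speed} \<le> exp (speed * (- \<kappa> * \<eta> + (\<kappa> + square_const \<kappa>) * r))"
    by simp
  have "prob {\<omega> \<in> space M. \<kappa> * ((1 + \<eta>) * speed) \<le> \<kappa> * trunc_var \<omega>} \<le>
      exp (speed * (\<kappa> + (\<kappa> + square_const \<kappa>) * r) - \<kappa> * ((1 + \<eta>) * speed))"
    using trunc_var_mgf[of \<kappa>] assms by (intro prob_Markov_exp) auto
  moreover have "speed * (\<kappa> + (\<kappa> + square_const \<kappa>) * r) - \<kappa> * ((1 + \<eta>) * speed) =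
      speed * (- \<kappa> * \<eta> + (\<kappa> + square_const \<kappa>) * r)" by (simp add: algebra_simps)
  ultimately show "prob {\<omega> \<in> space M. (1 + \<eta>) * speed \<le> trunc_var \<omega>} \<le> exp (speed * (- \<kappa> * \<eta> + (\<kappa> + square_const \<kappa>) * r))"
    using assms by simp
qed

lemma large_count_tail:
  assumes "0 < \<kappa>"
  shows "prob {\<omega> \<in> space M. \<eta> * speed \<le> large_count \<omega>} \<le> exp (speed * (- \<kappa> * \<eta> + (1 + exp \<kappa>) * r))"
proof -
  have "prob {\<omega> \<in> space M. \<kappa> * (\<eta> * speed) \<le> \<kappa> * large_count \<omega>} \<le>
      exp (speed * ((1 + exp \<kappa>) * r) - \<kappa> * (\<eta> * speed))"
    using large_count_mgf[of \<kappa>] by (intro prob_Markov_exp) auto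
  moreover have "speed * ((1 + exp \<kappa>) * r) - \<kappa> * (\<eta> * speed) =
      speed * (- \<kappa> * \<eta> + (1 + exp \<kappa>) * r)" by (simp add: algebra_simps)
  ultimately show ?thesis using assms by simp
qed

section \<open>Tilting and transfer to the self-normalised sum\<close>

text \<open>Inside the window the density \<open>tilted y\<close> is at most
  \<open>exp (speed * (y^2 + \<bar>y\<bar> * \<eta>))\<close>. To the right and to the left of it,
  it is dominated by multiples of \<open>tilted (y + \<eta>)\<close> and
  \<open>tilted (y - \<eta>)\<close>, whose integrals have exponent
  \<open>y^2 / 2 - \<eta>^2 / 2\<close> up to errors. This is less than the exponent
  \<open>y^2 / 2\<close> of the whole mass by the fixed gap \<open>\<eta>^2 / 2\<close>.\<close>

lemma centered_local_lower:
  assumes "0 < \<eta>" "r \<le> 1" "\<tau> * (2 * y\<^sup>2 * r + 8 * (tilt_rate y)\<^sup>2 * \<tau>) \<le> 1 / 4"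
  shows "exp (speed * (y\<^sup>2 / 2 - (tilt_rate y * r + 4 * y\<^sup>2 * r + 16 * (tilt_rate y)\<^sup>2 * \<tau>)))
      - exp (speed * (y\<^sup>2 / 2 - \<eta>\<^sup>2 / 2 + tilt_rate (y + \<eta>) * r))
      - exp (speed * (y\<^sup>2 / 2 - \<eta>\<^sup>2 / 2 + tilt_rate (y - \<eta>) * r))
    \<le> exp (speed * (y\<^sup>2 + \<bar>y\<bar> * \<eta>)) *
      prob {\<omega> \<in> space M. (\<forall>j<k. \<bar>U j \<omega>\<bar> \<le> 1) \<and> \<bar>centered \<omega> - y * speed\<bar> < \<eta> * speed}"
proof -
  define E where "E = {\<omega> \<in> space M. (\<forall>j<k. \<bar>U j \<omega>\<bar> \<le> 1) \<and> \<bar>centered \<omega> - y * speed\<bar> < \<eta> * speed}"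
  have [measurable]: "E \<in> sets M" unfolding E_def by measurable
  let ?c = "exp (speed * (y\<^sup>2 + \<bar>y\<bar> * \<eta>))"
  let ?p = "exp (- \<eta> * ((y + \<eta>) * speed))" and ?q = "exp (\<eta> * ((y - \<eta>) * speed))"
  have pw: "tilted y \<omega> \<le> ?c * indicator E \<omega> + ?p * tilted (y + \<eta>) \<omega> + ?q * tilted (y - \<eta>) \<omega>"
    if "\<omega> \<in> space M" for \<omega>
  proof (cases "\<forall>j<k. \<bar>U j \<omega>\<bar> \<le> 1")
    case True
    let ?S = "centered \<omega>"
    have t: "tilted \<theta> \<omega> = exp (\<theta> * ?S)" for \<theta> unfolding tilted_def using True by simp
    consider "\<bar>?S - y * speed\<bar> < \<eta> * speed" | "(y + \<eta>) * speed \<le> ?S" | "?S \<le> (y - \<eta>) * speed"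
      by (auto simp: abs_less_iff algebra_simps) linarith
    then show ?thesis
    proof cases
      case 1
      then have "\<omega> \<in> E" using that True by (simp add: E_def)
      have "y * (?S - y * speed) \<le> \<bar>y\<bar> * (\<eta> * speed)" using 1 by (intro mult_le_abs_mult) auto
      then have "exp (y * ?S) \<le> ?c" by (simp add: algebra_simps power2_eq_square)
      then show ?thesis using \<open>\<omega> \<in> E\<close> unfolding t by (simp add: add_increasing2)
    next
      case 2
      have "\<eta> * ((y + \<eta>) * speed) \<le> \<eta> * ?S" using 2 assms(1) by (intro mult_left_mono) auto
      then have "exp (y * ?S) \<le> ?p * exp ((y + \<eta>) * ?S)" by (simp add: algebra_simps flip: exp_add)
      then show ?thesis unfolding t by (simp add: add_increasing add_increasing2)
    next
      case 3
      have "\<eta> * ?S \<le> \<eta> * ((y - \<eta>) * speed)" using 3 assms(1) by (intro mult_left_mono) auto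
      then have "exp (y * ?S) \<le> ?q * exp ((y - \<eta>) * ?S)" by (simp add: algebra_simps flip: exp_add)
      then show ?thesis unfolding t by (simp add: add_increasing)
    qed
  next
    case False
    then have "tilted \<theta> \<omega> = 0" for \<theta> by (auto simp: tilted_def)
    then show ?thesis by simp
  qed
  have iE: "integrable M (indicator E :: 'a \<Rightarrow> real)"
    by (rule integrable_const_bound[where B = 1]) auto
  have "expectation (tilted y) \<le>
      expectation (\<lambda>\<omega>. ?c * indicator E \<omega> + ?p * tilted (y + \<eta>) \<omega> + ?q * tilted (y - \<eta>) \<omega>)"
    by (intro integral_mono pw Bochner_Integration.integrable_add integrable_mult_right tilted_mgf(1) iE)
  also have "\<dots> = ?c * prob E + ?p * expectation (tilted (y + \<eta>)) + ?q * expectation (tilted (y - \<eta>))"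
    using tilted_mgf(1) iE by simp
  also have "\<dots> \<le> ?c * prob E + ?p * exp (speed * ((y + \<eta>)\<^sup>2 / 2 + tilt_rate (y + \<eta>) * r))
      + ?q * exp (speed * ((y - \<eta>)\<^sup>2 / 2 + tilt_rate (y - \<eta>) * r))"
    by (intro add_mono mult_left_mono tilted_mgf) auto
  also have "?p * exp (speed * ((y + \<eta>)\<^sup>2 / 2 + tilt_rate (y + \<eta>) * r)) =
      exp (speed * (y\<^sup>2 / 2 - \<eta>\<^sup>2 / 2 + tilt_rate (y + \<eta>) * r))"
    unfolding exp_add[symmetric] by (rule arg_cong[where f = exp]) (simp add: field_simps power2_eq_square)
  also have "?q * exp (speed * ((y - \<eta>)\<^sup>2 / 2 + tilt_rate (y - \<eta>) * r)) =
      exp (speed * (y\<^sup>2 / 2 - \<eta>\<^sup>2 / 2 + tilt_rate (y - \<eta>) * r))"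
    unfolding exp_add[symmetric] by (rule arg_cong[where f = exp]) (simp add: field_simps power2_eq_square)
  finally show ?thesis using tilted_mgf(3)[OF assms(2,3)] unfolding E_def by linarith
qed

text \<open>The pathwise half of the upper bound. The threshold loses \<open>sqrt \<eta>\<close> to
  the large variables, the factor \<open>sqrt (1 - \<eta>)\<close> to the denominator, and \<eta> to
  the drift.\<close>

lemma self_norm_large_imp:
  assumes "y * sqrt speed \<le> \<bar>self_norm \<omega>\<bar>" "0 < \<eta>" "\<eta> < 1" "sqrt \<eta> \<le> y" "0 < speed"
    and N: "large_count \<omega> < \<eta> * speed" and Q: "(1 - \<eta>) * speed < trunc_var \<omega>"
    and D: "\<bar>total_drift \<omega>\<bar> < \<eta> * speed"
  shows "((y - sqrt \<eta>) * sqrt (1 - \<eta>) - \<eta>) * speed \<le> \<bar>centered \<omega>\<bar>"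
proof -
  define V where "V = sqrt (\<Sum>j<k. (U j \<omega>)\<^sup>2)"
  have V2: "V\<^sup>2 = (\<Sum>j<k. (U j \<omega>)\<^sup>2)" unfolding V_def by (simp add: sum_nonneg)
  have "V \<ge> 0" unfolding V_def by (simp add: sum_nonneg)
  have "trunc_var \<omega> \<le> V\<^sup>2"
    unfolding V2 trunc_var_def using abs_trunc1(2) by (intro sum_mono) (simp add: abs_le_square_iff)
  then have "sqrt ((1 - \<eta>) * speed) \<le> V"
    using Q \<open>V \<ge> 0\<close> by (intro real_le_lsqrt) auto
  then have V: "sqrt (1 - \<eta>) * sqrt speed \<le> V" by (simp add: real_sqrt_mult)
  moreover have "0 < sqrt (1 - \<eta>) * sqrt speed" using assms by simp
  ultimately have "V > 0" by linarith
  have "self_norm \<omega> = (\<Sum>j<k. U j \<omega>) / V" unfolding self_norm_def V_def ..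
  then have S: "y * sqrt speed * V \<le> \<bar>\<Sum>j<k. U j \<omega>\<bar>"
    using mult_right_mono[OF assms(1) \<open>V \<ge> 0\<close>] \<open>V > 0\<close> by (simp add: abs_divide)
  have "(\<Sum>j<k. U j \<omega> - trunc1 (U j \<omega>)) = (\<Sum>j<k. of_bool (1 < \<bar>U j \<omega>\<bar>) * U j \<omega>)"
    by (intro sum.cong) (auto simp: trunc1_def)
  also have "(\<dots>)\<^sup>2 \<le> (\<Sum>j<k. (of_bool (1 < \<bar>U j \<omega>\<bar>))\<^sup>2) * (\<Sum>j<k. (U j \<omega>)\<^sup>2)"
    by (rule Cauchy_Schwarz_ineq_sum)
  also have "\<dots> = large_count \<omega> * V\<^sup>2"
    unfolding V2 large_count_def by (intro arg_cong2[where f = "(*)"] sum.cong) auto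
  also have "\<dots> \<le> \<eta> * speed * V\<^sup>2" using N by (intro mult_right_mono) auto
  also have "\<dots> = (sqrt \<eta> * sqrt speed * V)\<^sup>2" using assms by (simp add: power_mult_distrib)
  finally have "\<bar>\<Sum>j<k. U j \<omega> - trunc1 (U j \<omega>)\<bar> \<le> \<bar>sqrt \<eta> * sqrt speed * V\<bar>"
    by (simp only: abs_le_square_iff)
  then have R: "\<bar>(\<Sum>j<k. U j \<omega>) - (\<Sum>j<k. trunc1 (U j \<omega>))\<bar> \<le> sqrt \<eta> * sqrt speed * V"
    using \<open>V > 0\<close> assms by (simp add: sum_subtractf abs_mult)
  have "(y - sqrt \<eta>) * sqrt speed * (sqrt (1 - \<eta>) * sqrt speed) \<le> (y - sqrt \<eta>) * sqrt speed * V"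
    using V assms by (intro mult_left_mono) auto
  also have "\<dots> \<le> \<bar>\<Sum>j<k. trunc1 (U j \<omega>)\<bar>" using S R by (simp add: algebra_simps)
  finally have "(y - sqrt \<eta>) * sqrt (1 - \<eta>) * speed \<le> \<bar>\<Sum>j<k. trunc1 (U j \<omega>)\<bar>"
    using assms by (simp add: algebra_simps)
  moreover have "(\<Sum>j<k. trunc1 (U j \<omega>)) = centered \<omega> + total_drift \<omega>"
    unfolding centered_def total_drift_def by (simp add: sum_subtractf)
  ultimately show ?thesis using D by (simp add: algebra_simps)
qed

lemma self_norm_upper:
  assumes drift: "subgaussian total_drift (g * sqrt speed)" and "0 < g" "0 < speed"
    and \<eta>: "0 < \<eta>" "\<eta> < 1" "sqrt \<eta> \<le> y" and "0 < \<kappa>"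
    and y': "y' = (y - sqrt \<eta>) * sqrt (1 - \<eta>) - \<eta>" "0 \<le> y'"
  shows "prob {\<omega> \<in> space M. y * sqrt speed \<le> \<bar>self_norm \<omega>\<bar>} \<le>
      2 * exp (speed * (- y'\<^sup>2 / 2 + tilt_rate y' * r))
      + exp (speed * (- \<kappa> * \<eta> + (\<kappa> + square_const \<kappa>) * r))
      + exp (speed * (- \<kappa> * \<eta> + (1 + exp \<kappa>) * r))
      + 2 * exp (1 / 2 - speed * (\<eta>\<^sup>2 / (2 * g\<^sup>2)))"
proof -
  let ?A = "{\<omega> \<in> space M. y' * speed \<le> \<bar>centered \<omega>\<bar>}"
  let ?B = "{\<omega> \<in> space M. trunc_var \<omega> \<le> (1 - \<eta>) * speed}"
  let ?C = "{\<omega> \<in> space M. \<eta> * speed \<le> large_count \<omega>}"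
  let ?D = "{\<omega> \<in> space M. \<eta> * speed \<le> \<bar>total_drift \<omega>\<bar>}"
  have "{\<omega> \<in> space M. y * sqrt speed \<le> \<bar>self_norm \<omega>\<bar>} \<subseteq> ((?A \<union> ?B) \<union> ?C) \<union> ?D"
    using self_norm_large_imp[OF _ \<eta> \<open>0 < speed\<close>] unfolding y'(1) by (force simp: not_le)
  then have "prob {\<omega> \<in> space M. y * sqrt speed \<le> \<bar>self_norm \<omega>\<bar>} \<le> prob (((?A \<union> ?B) \<union> ?C) \<union> ?D)"
    by (intro finite_measure_mono) auto
  also have "\<dots> \<le> prob ?A + prob ?B + prob ?C + prob ?D"
    by (intro measure_Un_le[THEN order_trans] add_mono) auto
  also have "\<dots> \<le> 2 * exp (speed * (- y'\<^sup>2 / 2 + tilt_rate y' * r))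
      + exp (speed * (- \<kappa> * \<eta> + (\<kappa> + square_const \<kappa>) * r))
      + exp (speed * (- \<kappa> * \<eta> + (1 + exp \<kappa>) * r))
      + 2 * exp (1 / 2 - (\<eta> * speed)\<^sup>2 / (2 * (g * sqrt speed)\<^sup>2))"
    using assms by (intro add_mono centered_tail trunc_var_tails large_count_tail subgaussian_tail) auto
  also have "(\<eta> * speed)\<^sup>2 / (2 * (g * sqrt speed)\<^sup>2) = speed * (\<eta>\<^sup>2 / (2 * g\<^sup>2))"
    using assms by (simp add: power_mult_distrib power2_eq_square[of speed])
  finally show ?thesis .
qed

text \<open>When no variable is large, the truncated sum and the truncated squares are the true
  ones, and the ratio is a function of three quantities close to \<open>y\<close>, 1 and 0 after
  division by \<open>speed\<close>. The hypothesis \<open>close\<close> is its continuity at that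
  point.\<close>

lemma self_norm_lower:
  assumes drift: "subgaussian total_drift (g * sqrt speed)" and "0 < g" "0 < speed"
    and \<eta>: "0 < \<eta>" "\<eta> < 1" and "0 < \<kappa>"
    and close: "\<And>s q d. \<bar>s - y\<bar> < \<eta> \<Longrightarrow> \<bar>q - 1\<bar> < \<eta> \<Longrightarrow> \<bar>d\<bar> < \<eta> \<Longrightarrow> \<bar>(s + d) / sqrt q - y\<bar> < e"
    and small: "r \<le> 1" "\<tau> * (2 * y\<^sup>2 * r + 8 * (tilt_rate y)\<^sup>2 * \<tau>) \<le> 1 / 4"
  shows "exp (- (speed * (y\<^sup>2 + \<bar>y\<bar> * \<eta>))) *
      (exp (speed * (y\<^sup>2 / 2 - (tilt_rate y * r + 4 * y\<^sup>2 * r + 16 * (tilt_rate y)\<^sup>2 * \<tau>)))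
      - exp (speed * (y\<^sup>2 / 2 - \<eta>\<^sup>2 / 2 + tilt_rate (y + \<eta>) * r))
      - exp (speed * (y\<^sup>2 / 2 - \<eta>\<^sup>2 / 2 + tilt_rate (y - \<eta>) * r)))
    - 2 * exp (speed * (- \<kappa> * \<eta> + (\<kappa> + square_const \<kappa>) * r))
    - 2 * exp (1 / 2 - speed * (\<eta>\<^sup>2 / (2 * g\<^sup>2)))
    \<le> prob {\<omega> \<in> space M. \<bar>self_norm \<omega> - y * sqrt speed\<bar> < e * sqrt speed}"
proof -
  let ?A = "{\<omega> \<in> space M. (\<forall>j<k. \<bar>U j \<omega>\<bar> \<le> 1) \<and> \<bar>centered \<omega> - y * speed\<bar> < \<eta> * speed}"
  let ?B = "{\<omega> \<in> space M. trunc_var \<omega> \<le> (1 - \<eta>) * speed}"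
  let ?C = "{\<omega> \<in> space M. (1 + \<eta>) * speed \<le> trunc_var \<omega>}"
  let ?D = "{\<omega> \<in> space M. \<eta> * speed \<le> \<bar>total_drift \<omega>\<bar>}"
  let ?E = "{\<omega> \<in> space M. \<bar>self_norm \<omega> - y * sqrt speed\<bar> < e * sqrt speed}"
  have "?A \<subseteq> ((?E \<union> ?B) \<union> ?C) \<union> ?D"
  proof
    fix \<omega> assume "\<omega> \<in> ?A"
    then have \<omega>: "\<omega> \<in> space M" "\<forall>j<k. \<bar>U j \<omega>\<bar> \<le> 1" "\<bar>centered \<omega> - y * speed\<bar> < \<eta> * speed" by auto
    show "\<omega> \<in> ((?E \<union> ?B) \<union> ?C) \<union> ?D"
    proof (rule ccontr)
      assume "\<omega> \<notin> ((?E \<union> ?B) \<union> ?C) \<union> ?D"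
      then have n: "\<not> \<bar>self_norm \<omega> - y * sqrt speed\<bar> < e * sqrt speed" "(1 - \<eta>) * speed < trunc_var \<omega>"
        "trunc_var \<omega> < (1 + \<eta>) * speed" "\<bar>total_drift \<omega>\<bar> < \<eta> * speed"
        using \<omega> by auto
      let ?s = "centered \<omega> / speed" and ?q = "trunc_var \<omega> / speed" and ?d = "total_drift \<omega> / speed"
      have "\<bar>(?s + ?d) / sqrt ?q - y\<bar> < e"
      proof (rule close)
        have "?s - y = (centered \<omega> - y * speed) / speed" using \<open>0 < speed\<close> by (simp add: diff_divide_distrib)
        then show "\<bar>?s - y\<bar> < \<eta>" using \<omega>(3) \<open>0 < speed\<close> by (simp add: abs_divide pos_divide_less_eq)
        show "\<bar>?d\<bar> < \<eta>" using n(4) \<open>0 < speed\<close> by (simp add: abs_divide pos_divide_less_eq)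
        have "?q - 1 = (trunc_var \<omega> - speed) / speed" using \<open>0 < speed\<close> by (simp add: diff_divide_distrib)
        moreover have "\<bar>trunc_var \<omega> - speed\<bar> < \<eta> * speed" using n(2,3) by (simp add: abs_less_iff algebra_simps)
        ultimately show "\<bar>?q - 1\<bar> < \<eta>" using \<open>0 < speed\<close> by (simp add: abs_divide pos_divide_less_eq)
      qed
      moreover have "self_norm \<omega> = (?s + ?d) / sqrt ?q * sqrt speed"
      proof -
        have "(\<Sum>j<k. U j \<omega>) = (\<Sum>j<k. trunc1 (U j \<omega>))" "(\<Sum>j<k. (U j \<omega>)\<^sup>2) = trunc_var \<omega>"
          unfolding trunc_var_def using \<omega>(2) by (auto simp: trunc1_def intro!: sum.cong)
        then have "self_norm \<omega> = (centered \<omega> + total_drift \<omega>) / sqrt (trunc_var \<omega>)"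
          unfolding self_norm_def centered_def total_drift_def by (simp add: sum_subtractf)
        also have "\<dots> = (?s + ?d) / sqrt ?q * sqrt speed"
          using \<open>0 < speed\<close> real_div_sqrt[of speed]
          by (simp add: real_sqrt_divide divide_simps add_divide_distrib[symmetric])
        finally show ?thesis .
      qed
      then have "self_norm \<omega> - y * sqrt speed = ((?s + ?d) / sqrt ?q - y) * sqrt speed"
        by (simp add: algebra_simps)
      ultimately show False using n(1) \<open>0 < speed\<close> by (simp add: abs_mult)
    qed
  qed
  then have "prob ?A \<le> prob (((?E \<union> ?B) \<union> ?C) \<union> ?D)"
    by (intro finite_measure_mono) auto
  also have "\<dots> \<le> prob ?E + prob ?B + prob ?C + prob ?D"
    by (intro measure_Un_le[THEN order_trans] add_mono) auto
  also have "\<dots> \<le> prob ?E + exp (speed * (- \<kappa> * \<eta> + (\<kappa> + square_const \<kappa>) * r))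
      + exp (speed * (- \<kappa> * \<eta> + (\<kappa> + square_const \<kappa>) * r))
      + 2 * exp (1 / 2 - (\<eta> * speed)\<^sup>2 / (2 * (g * sqrt speed)\<^sup>2))"
    using assms by (intro add_mono order_refl trunc_var_tails subgaussian_tail) auto
  also have "(\<eta> * speed)\<^sup>2 / (2 * (g * sqrt speed)\<^sup>2) = speed * (\<eta>\<^sup>2 / (2 * g\<^sup>2))"
    using assms by (simp add: power_mult_distrib power2_eq_square[of speed])
  finally have 1: "prob ?A \<le> prob ?E + 2 * exp (speed * (- \<kappa> * \<eta> + (\<kappa> + square_const \<kappa>) * r))
      + 2 * exp (1 / 2 - speed * (\<eta>\<^sup>2 / (2 * g\<^sup>2)))" by simp
  have "exp (- (speed * (y\<^sup>2 + \<bar>y\<bar> * \<eta>))) * (exp (speed * (y\<^sup>2 / 2 - (tilt_rate y * r + 4 * y\<^sup>2 * r + 16 * (tilt_rate y)\<^sup>2 * \<tau>)))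
      - exp (speed * (y\<^sup>2 / 2 - \<eta>\<^sup>2 / 2 + tilt_rate (y + \<eta>) * r))
      - exp (speed * (y\<^sup>2 / 2 - \<eta>\<^sup>2 / 2 + tilt_rate (y - \<eta>) * r)))
     \<le> exp (- (speed * (y\<^sup>2 + \<bar>y\<bar> * \<eta>))) * (exp (speed * (y\<^sup>2 + \<bar>y\<bar> * \<eta>)) * prob ?A)"
    by (intro mult_left_mono centered_local_lower[OF \<eta>(1) small]) auto
  also have "\<dots> = prob ?A" by (simp add: exp_minus)
  finally show ?thesis using 1 by linarith
qed

end

section \<open>Moderate deviations of an array\<close>

lemma continuity_ratio:
  fixes y e :: real
  assumes "0 < e"
  obtains \<eta> where "0 < \<eta>" "\<And>s q d. \<bar>s - y\<bar> < \<eta> \<Longrightarrow> \<bar>q - 1\<bar> < \<eta> \<Longrightarrow> \<bar>d\<bar> < \<eta> \<Longrightarrow> \<bar>(s + d) / sqrt q - y\<bar> < e"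
proof -
  let ?f = "\<lambda>p :: real \<times> real \<times> real. (fst p + snd (snd p)) / sqrt (fst (snd p))"
  have "isCont ?f (y, 1, 0)" by (intro continuous_intros) auto
  then obtain \<delta> where \<delta>: "\<delta> > 0" "\<And>p. dist p (y, 1, 0) < \<delta> \<Longrightarrow> dist (?f p) (?f (y, 1, 0)) < e"
    using assms unfolding continuous_at_eps_delta by blast
  have "\<bar>(s + d) / sqrt q - y\<bar> < e" if "\<bar>s - y\<bar> < \<delta> / 3" "\<bar>q - 1\<bar> < \<delta> / 3" "\<bar>d\<bar> < \<delta> / 3" for s q d
  proof -
    have "dist (q, d) (1, 0) \<le> \<bar>q - 1\<bar> + \<bar>d\<bar>"
      using sqrt_sum_squares_le_sum_abs[of "dist q 1" "dist d 0"] by (simp add: dist_Pair_Pair dist_real_def)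
    moreover have "dist (s, q, d) (y, 1, 0) \<le> \<bar>s - y\<bar> + dist (q, d) (1, 0)"
      using sqrt_sum_squares_le_sum_abs[of "dist s y" "dist (q, d) (1, 0)"]
      unfolding dist_Pair_Pair[of s "(q, d)"] by (simp add: dist_real_def)
    ultimately have "dist (s, q, d) (y, 1, 0) < \<delta>" using that by linarith
    from \<delta>(2)[OF this] show ?thesis by (simp add: dist_real_def)
  qed
  then show ?thesis by (intro that[of "\<delta> / 3"]) (use \<delta>(1) in auto)
qed

lemma small_eta_upper:
  fixes y \<epsilon> :: real
  assumes "0 < y" "0 < \<epsilon>"
  obtains \<eta> where "0 < \<eta>" "\<eta> < 1" "sqrt \<eta> \<le> y" "0 \<le> (y - sqrt \<eta>) * sqrt (1 - \<eta>) - \<eta>"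
    "y\<^sup>2 / 2 - \<epsilon> \<le> ((y - sqrt \<eta>) * sqrt (1 - \<eta>) - \<eta>)\<^sup>2 / 2"
proof -
  let ?F = "at_right (0 :: real)"
  let ?f = "\<lambda>\<eta>. (y - sqrt \<eta>) * sqrt (1 - \<eta>) - \<eta>"
  have "(?f \<longlongrightarrow> (y - sqrt 0) * sqrt (1 - 0) - 0) ?F"
    by (intro tendsto_intros)
  then have f: "(?f \<longlongrightarrow> y) ?F" by simp
  have "((\<lambda>\<eta>. (?f \<eta>)\<^sup>2 / 2) \<longlongrightarrow> y\<^sup>2 / 2) ?F" by (intro tendsto_intros f) simp
  then have "\<forall>\<^sub>F \<eta> in ?F. y\<^sup>2 / 2 - \<epsilon> < (?f \<eta>)\<^sup>2 / 2"
    using assms by (intro order_tendstoD) auto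
  moreover have "\<forall>\<^sub>F \<eta> in ?F. 0 < ?f \<eta>" using f assms by (intro order_tendstoD) auto
  moreover have "((\<lambda>\<eta>. sqrt \<eta>) \<longlongrightarrow> sqrt 0) ?F" by (intro tendsto_intros)
  then have "\<forall>\<^sub>F \<eta> in ?F. sqrt \<eta> < y" using assms by (intro order_tendstoD) auto
  moreover have "\<forall>\<^sub>F \<eta> in ?F. \<eta> \<in> {0<..<1}" by (rule eventually_at_right_real) simp
  ultimately have "\<forall>\<^sub>F \<eta> in ?F. 0 < \<eta> \<and> \<eta> < 1 \<and> sqrt \<eta> \<le> y \<and> 0 \<le> ?f \<eta> \<and> y\<^sup>2 / 2 - \<epsilon> \<le> (?f \<eta>)\<^sup>2 / 2"
    by eventually_elim auto
  then have "\<exists>\<eta>. 0 < \<eta> \<and> \<eta> < 1 \<and> sqrt \<eta> \<le> y \<and> 0 \<le> ?f \<eta> \<and> y\<^sup>2 / 2 - \<epsilon> \<le> (?f \<eta>)\<^sup>2 / 2"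
    by (rule eventually_happens'[rotated]) simp
  then show ?thesis using that by blast
qed

lemma exp_half_le_2: "exp (1 / 2 :: real) \<le> 2"
  using exp_bound_half[of "1 / 2 :: real"] by simp

text \<open>8 is the sum of the coefficients 2, 1, 1 and 2 * 2, the last factor 2 being a bound for
  \<open>exp (1 / 2)\<close>.\<close>

lemma sum_of_exps_upper:
  fixes v L \<epsilon> :: real
  assumes "8 \<le> exp (v * \<epsilon>)" "0 \<le> v"
    and "x1 \<le> - L" "x2 \<le> - L" "x3 \<le> - L" "L \<le> z"
  shows "2 * exp (v * x1) + exp (v * x2) + exp (v * x3) + 2 * exp (1 / 2 - v * z) \<le> exp (v * (\<epsilon> - L))"
proof -
  have mono: "exp (v * x) \<le> exp (v * (- L))" if "x \<le> - L" for x
    using mult_left_mono[OF that assms(2)] by simp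
  have "exp (1 / 2 - v * z) \<le> 2 * exp (v * (- L))"
  proof -
    have "exp (1 / 2 - v * z) = exp (1 / 2) * exp (v * (- z))" by (simp flip: exp_add)
    also have "\<dots> \<le> 2 * exp (v * (- L))"
      using mono[of "- z"] assms by (intro mult_mono exp_half_le_2) auto
    finally show ?thesis .
  qed
  then have "2 * exp (v * x1) + exp (v * x2) + exp (v * x3) + 2 * exp (1 / 2 - v * z) \<le> 8 * exp (v * (- L))"
    using mono[OF assms(3)] mono[OF assms(4)] mono[OF assms(5)] by linarith
  also have "\<dots> \<le> exp (v * \<epsilon>) * exp (v * (- L))" by (intro mult_right_mono assms(1)) simp
  also have "\<dots> = exp (v * (\<epsilon> - L))" by (simp add: algebra_simps flip: exp_add)
  finally show ?thesis .
qed

text \<open>With the constant 4, each comparison term is at most a quarter of the leading one, so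
  half of it remains. The subtracted tails amount to at most 2 + 2 * 2 = 6 copies of the final bound
  and one copy has to be left over; together with the half this makes 14 = 2 * 7.\<close>

lemma sum_of_exps_lower:
  fixes v b \<epsilon> \<eta> :: real
  assumes v: "0 \<le> v" "4 \<le> exp (v * (\<eta>\<^sup>2 / 4))" "14 \<le> exp (v * (\<epsilon> / 2))"
    and "c \<le> 2 * b + \<epsilon> / 4" "err \<le> \<epsilon> / 4" "err \<le> \<eta>\<^sup>2 / 8" "x1 \<le> \<eta>\<^sup>2 / 8" "x2 \<le> \<eta>\<^sup>2 / 8"
    and "x3 \<le> - (b + \<epsilon>)" "b + \<epsilon> \<le> z"
  shows "exp (- (v * (b + \<epsilon>))) \<le>
     exp (- (v * c)) * (exp (v * (b - err)) - exp (v * (b - \<eta>\<^sup>2 / 2 + x1)) - exp (v * (b - \<eta>\<^sup>2 / 2 + x2)))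
     - 2 * exp (v * x3) - 2 * exp (1 / 2 - v * z)"
proof -
  have small: "exp (v * (b - \<eta>\<^sup>2 / 2 + x)) \<le> exp (v * (b - err)) / 4" if "x \<le> \<eta>\<^sup>2 / 8" for x
  proof -
    have "v * (b - \<eta>\<^sup>2 / 2 + x) \<le> v * (b - err - \<eta>\<^sup>2 / 4)"
      using assms that by (intro mult_left_mono) auto
    then have "exp (v * (b - \<eta>\<^sup>2 / 2 + x)) \<le> exp (v * (b - err)) / exp (v * (\<eta>\<^sup>2 / 4))"
      by (simp add: algebra_simps flip: exp_diff)
    also have "\<dots> \<le> exp (v * (b - err)) / 4" using v by (intro divide_left_mono) auto
    finally show ?thesis .
  qed
  have "exp (- (v * (b + \<epsilon> / 2))) / 2 \<le> exp (- (v * c)) * (exp (v * (b - err)) / 2)"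
  proof -
    have "v * (err + c - b) \<le> v * (b + \<epsilon> / 2)" using assms by (intro mult_left_mono) auto
    then show ?thesis by (simp add: algebra_simps flip: exp_add)
  qed
  also have "\<dots> \<le> exp (- (v * c)) * (exp (v * (b - err)) - exp (v * (b - \<eta>\<^sup>2 / 2 + x1)) - exp (v * (b - \<eta>\<^sup>2 / 2 + x2)))"
  proof (rule mult_left_mono)
    show "exp (v * (b - err)) / 2 \<le> exp (v * (b - err)) - exp (v * (b - \<eta>\<^sup>2 / 2 + x1)) - exp (v * (b - \<eta>\<^sup>2 / 2 + x2))"
      using small[OF assms(7)] small[OF assms(8)] by linarith
  qed simp
  finally have main: "exp (- (v * (b + \<epsilon> / 2))) / 2 \<le>
    exp (- (v * c)) * (exp (v * (b - err)) - exp (v * (b - \<eta>\<^sup>2 / 2 + x1)) - exp (v * (b - \<eta>\<^sup>2 / 2 + x2)))" .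
  have "7 * exp (- (v * (b + \<epsilon>))) \<le> exp (v * (\<epsilon> / 2)) / 2 * exp (- (v * (b + \<epsilon>)))"
    using v(3) by (intro mult_right_mono) auto
  also have "\<dots> = exp (v * (\<epsilon> / 2) + - (v * (b + \<epsilon>))) / 2" unfolding exp_add by simp
  also have "v * (\<epsilon> / 2) + - (v * (b + \<epsilon>)) = - (v * (b + \<epsilon> / 2))" by (simp add: algebra_simps)
  finally have "7 * exp (- (v * (b + \<epsilon>))) \<le> exp (- (v * (b + \<epsilon> / 2))) / 2" .
  moreover have "exp (v * x3) \<le> exp (- (v * (b + \<epsilon>)))"
    using mult_left_mono[OF assms(9) v(1)] by (simp only: exp_le_cancel_iff mult_minus_right)
  moreover have "exp (1 / 2 - v * z) \<le> 2 * exp (- (v * (b + \<epsilon>)))"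
  proof -
    have "exp (1 / 2 - v * z) = exp (1 / 2) * exp (- (v * z))" by (simp flip: exp_add)
    also have "\<dots> \<le> 2 * exp (- (v * (b + \<epsilon>)))"
      using mult_left_mono[OF assms(10) v(1)] by (intro mult_mono exp_half_le_2) auto
    finally show ?thesis .
  qed
  ultimately show ?thesis using main by linarith
qed

section \<open>Asymptotics along a sequence of arrays\<close>

text \<open>The array conditions are eventual because they presuppose finite norms.
  \<open>g n\<close> is the sub-Gaussian parameter of the total drift relative to the square root of
  the speed; its convergence to 0 makes the drift negligible.\<close>

locale block_array_sequence = prob_space M for M :: "'a measure" +
  fixes G :: "nat \<Rightarrow> nat \<Rightarrow> 'a measure" and U :: "nat \<Rightarrow> nat \<Rightarrow> 'a \<Rightarrow> real" and k :: "nat \<Rightarrow> nat"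
    and \<tau> r g :: "nat \<Rightarrow> real" and \<rho> :: real
  assumes array: "\<forall>\<^sub>F n in sequentially. block_array M (G n) (U n) (\<tau> n) (r n) \<rho>"
    and total_drift: "\<forall>\<^sub>F n in sequentially. subgaussian
        (block_array.total_drift M (G n) (U n) (k n)) (g n * sqrt (real (k n) * \<tau> n))"
    and g_pos: "\<forall>\<^sub>F n in sequentially. 0 < g n"
    and \<tau>_0: "\<tau> \<longlonglongrightarrow> 0" and r_0: "r \<longlonglongrightarrow> 0" and g_0: "g \<longlonglongrightarrow> 0"
    and speed_top: "filterlim (\<lambda>n. real (k n) * \<tau> n) at_top sequentially"
begin

abbreviation v :: "nat \<Rightarrow> real" where "v n \<equiv> real (k n) * \<tau> n"

abbreviation W :: "nat \<Rightarrow> 'a \<Rightarrow> real" where "W n \<equiv> block_array.self_norm (U n) (k n)"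

lemma eventually_r: "0 < \<epsilon> \<Longrightarrow> \<forall>\<^sub>F n in sequentially. C * r n < \<epsilon>" for C \<epsilon> :: real
proof -
  assume "0 < \<epsilon>"
  have "(\<lambda>n. C * r n) \<longlonglongrightarrow> C * 0" by (intro tendsto_intros r_0)
  then show ?thesis using \<open>0 < \<epsilon>\<close> by (auto intro: order_tendstoD)
qed

lemma eventually_exp_v: "0 < \<epsilon> \<Longrightarrow> \<forall>\<^sub>F n in sequentially. c \<le> exp (v n * \<epsilon>)" for c \<epsilon> :: real
proof -
  assume "0 < \<epsilon>"
  have "filterlim (\<lambda>n. exp (v n * \<epsilon>)) at_top sequentially"
    by (rule filterlim_compose[OF exp_at_top])
       (rule filterlim_at_top_mult_tendsto_pos[OF tendsto_const \<open>0 < \<epsilon>\<close> speed_top])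
  then show ?thesis by (simp add: filterlim_at_top)
qed

lemma eventually_v_pos: "\<forall>\<^sub>F n in sequentially. 0 < v n"
  using speed_top by (auto simp: filterlim_at_top_dense)

lemma eventually_g: "0 < \<eta> \<Longrightarrow> \<forall>\<^sub>F n in sequentially. L \<le> \<eta>\<^sup>2 / (2 * (g n)\<^sup>2)" for L \<eta> :: real
proof -
  assume "0 < \<eta>"
  have "(\<lambda>n. 2 * (\<bar>L\<bar> + 1) * (g n)\<^sup>2) \<longlonglongrightarrow> 2 * (\<bar>L\<bar> + 1) * 0\<^sup>2" by (intro tendsto_intros g_0)
  then have "\<forall>\<^sub>F n in sequentially. 2 * (\<bar>L\<bar> + 1) * (g n)\<^sup>2 < \<eta>\<^sup>2"
    by (rule order_tendstoD(2)) (use \<open>0 < \<eta>\<close> in simp)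
  then show ?thesis using g_pos
  proof eventually_elim
    case (elim n)
    then have "(\<bar>L\<bar> + 1) \<le> \<eta>\<^sup>2 / (2 * (g n)\<^sup>2)" by (simp add: field_simps)
    then show ?case by linarith
  qed
qed

lemma upper_tail:
  assumes "0 < y" "0 < \<epsilon>"
  shows "\<forall>\<^sub>F n in sequentially. prob {\<omega> \<in> space M. y * sqrt (v n) \<le> \<bar>W n \<omega>\<bar>} \<le> exp (v n * (- (y\<^sup>2 / 2) + \<epsilon>))"
proof -
  obtain \<eta> where \<eta>: "0 < \<eta>" "\<eta> < 1" "sqrt \<eta> \<le> y" "0 \<le> (y - sqrt \<eta>) * sqrt (1 - \<eta>) - \<eta>"
    "y\<^sup>2 / 2 - \<epsilon> / 4 \<le> ((y - sqrt \<eta>) * sqrt (1 - \<eta>) - \<eta>)\<^sup>2 / 2"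
    using small_eta_upper[of y "\<epsilon> / 4"] assms by auto
  define y' where "y' = (y - sqrt \<eta>) * sqrt (1 - \<eta>) - \<eta>"
  \<comment> \<open>Chosen so that the secondary events have the Gaussian exponent
    \<open>y^2 / 2\<close> as well.\<close>
  define \<kappa> where "\<kappa> = y\<^sup>2 / 2 / \<eta>"
  have \<kappa>: "0 < \<kappa>" "\<kappa> * \<eta> = y\<^sup>2 / 2" using assms \<eta> by (auto simp: \<kappa>_def)
  have e4: "0 < \<epsilon> / 4" "0 < \<epsilon> / 2" using assms by auto
  show ?thesis
    using array total_drift g_pos eventually_v_pos eventually_r[OF e4(1), of "block_array.tilt_rate y'"]
      eventually_r[OF e4(2), of "\<kappa> + square_const \<kappa>"] eventually_r[OF e4(2), of "1 + exp \<kappa>"]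
      eventually_exp_v[OF e4(2), of 8] eventually_g[OF \<eta>(1), of "y\<^sup>2 / 2 - \<epsilon> / 2"]
  proof eventually_elim
    case (elim n)
    interpret block_array M "G n" "U n" "k n" "\<tau> n" "r n" \<rho> by fact
    have sp: "speed = v n" by (simp add: speed_def)
    have "prob {\<omega> \<in> space M. y * sqrt (v n) \<le> \<bar>W n \<omega>\<bar>} \<le>
      2 * exp (v n * (- y'\<^sup>2 / 2 + tilt_rate y' * r n))
      + exp (v n * (- \<kappa> * \<eta> + (\<kappa> + square_const \<kappa>) * r n))
      + exp (v n * (- \<kappa> * \<eta> + (1 + exp \<kappa>) * r n))
      + 2 * exp (1 / 2 - v n * (\<eta>\<^sup>2 / (2 * (g n)\<^sup>2)))"
      using self_norm_upper[of "g n" \<eta> y \<kappa> y'] elim \<eta> \<kappa>(1) unfolding sp y'_def by blast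
    also have "\<dots> \<le> exp (v n * (\<epsilon> / 2 - (y\<^sup>2 / 2 - \<epsilon> / 2)))"
      using elim \<eta>(5) \<kappa>(2) by (intro sum_of_exps_upper) (auto simp: y'_def)
    finally show ?case by simp
  qed
qed

lemma local_lower:
  assumes "0 < e" "0 < \<epsilon>"
  shows "\<forall>\<^sub>F n in sequentially.
    exp (- (v n * (y\<^sup>2 / 2 + \<epsilon>))) \<le> prob {\<omega> \<in> space M. \<bar>W n \<omega> - y * sqrt (v n)\<bar> < e * sqrt (v n)}"
proof -
  obtain \<eta>0 where \<eta>0: "0 < \<eta>0"
    "\<And>s q d. \<bar>s - y\<bar> < \<eta>0 \<Longrightarrow> \<bar>q - 1\<bar> < \<eta>0 \<Longrightarrow> \<bar>d\<bar> < \<eta>0 \<Longrightarrow> \<bar>(s + d) / sqrt q - y\<bar> < e"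
    using continuity_ratio[OF assms(1)] by metis
  \<comment> \<open>The three bounds serve the continuity of the ratio, the condition
    \<open>\<eta> < 1\<close>, and the error \<open>\<bar>y\<bar> * \<eta>\<close> of the
    tilting.\<close>
  define \<eta> where "\<eta> = min \<eta>0 (min (1 / 2) (\<epsilon> / 4 / (\<bar>y\<bar> + 1)))"
  have \<eta>: "0 < \<eta>" "\<eta> < 1" "\<eta> \<le> \<eta>0" "\<eta> \<le> \<epsilon> / 4 / (\<bar>y\<bar> + 1)" using \<eta>0(1) assms by (auto simp: \<eta>_def)
  have y\<eta>: "\<bar>y\<bar> * \<eta> \<le> \<epsilon> / 4"
  proof -
    have "0 < \<bar>y\<bar> + 1" by simp
    then have "\<eta> * (\<bar>y\<bar> + 1) \<le> \<epsilon> / 4" using \<eta>(4) by (simp only: pos_le_divide_eq)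
    then show ?thesis using \<eta>(1) by (simp add: algebra_simps)
  qed
  \<comment> \<open>One \<epsilon> makes the secondary events smaller than the claimed bound, the
    other pays for the term with \<open>r\<close>.\<close>
  define \<kappa> where "\<kappa> = (y\<^sup>2 / 2 + 2 * \<epsilon>) / \<eta>"
  have \<kappa>: "0 < \<kappa>" "\<kappa> * \<eta> = y\<^sup>2 / 2 + 2 * \<epsilon>" using assms \<eta> by (auto simp: \<kappa>_def add_nonneg_pos)
  let ?R = "block_array.tilt_rate"
  let ?err = "\<lambda>n. ?R y * r n + 4 * y\<^sup>2 * r n + 16 * (?R y)\<^sup>2 * \<tau> n"
  define m where "m = min (\<epsilon> / 4) (\<eta>\<^sup>2 / 8)"
  have "0 < m" using assms \<eta> by (simp add: m_def)
  have "?err \<longlonglongrightarrow> ?R y * 0 + 4 * y\<^sup>2 * 0 + 16 * (?R y)\<^sup>2 * 0" by (intro tendsto_intros r_0 \<tau>_0)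
  then have err: "\<forall>\<^sub>F n in sequentially. ?err n < m" using \<open>0 < m\<close> by (intro order_tendstoD) auto
  have "(\<lambda>n. \<tau> n * (2 * y\<^sup>2 * r n + 8 * (?R y)\<^sup>2 * \<tau> n)) \<longlonglongrightarrow> 0 * (2 * y\<^sup>2 * 0 + 8 * (?R y)\<^sup>2 * 0)"
    by (intro tendsto_intros r_0 \<tau>_0)
  then have small: "\<forall>\<^sub>F n in sequentially. \<tau> n * (2 * y\<^sup>2 * r n + 8 * (?R y)\<^sup>2 * \<tau> n) < 1 / 4"
    by (intro order_tendstoD) auto
  have p: "0 < \<eta>\<^sup>2 / 8" "0 < \<eta>\<^sup>2 / 4" "0 < \<epsilon> / 2" using \<eta> assms by auto
  show ?thesis
    using array total_drift g_pos eventually_v_pos err small eventually_r[OF zero_less_one, of 1]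
      eventually_r[OF p(1), of "?R (y + \<eta>)"] eventually_r[OF p(1), of "?R (y - \<eta>)"]
      eventually_r[OF assms(2), of "\<kappa> + square_const \<kappa>"]
      eventually_exp_v[OF p(2), of 4] eventually_exp_v[OF p(3), of 14]
      eventually_g[OF \<eta>(1), of "y\<^sup>2 / 2 + \<epsilon>"]
  proof eventually_elim
    case (elim n)
    interpret block_array M "G n" "U n" "k n" "\<tau> n" "r n" \<rho> by fact
    have sp: "speed = v n" by (simp add: speed_def)
    have close: "\<bar>(s + d) / sqrt q - y\<bar> < e" if "\<bar>s - y\<bar> < \<eta>" "\<bar>q - 1\<bar> < \<eta>" "\<bar>d\<bar> < \<eta>" for s q d
      using \<eta>0(2)[of s q d] that \<eta>(3) by simp
    have "exp (- (v n * (y\<^sup>2 / 2 + \<epsilon>))) \<le>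
      exp (- (v n * (y\<^sup>2 + \<bar>y\<bar> * \<eta>))) *
      (exp (v n * (y\<^sup>2 / 2 - (tilt_rate y * r n + 4 * y\<^sup>2 * r n + 16 * (tilt_rate y)\<^sup>2 * \<tau> n)))
      - exp (v n * (y\<^sup>2 / 2 - \<eta>\<^sup>2 / 2 + tilt_rate (y + \<eta>) * r n))
      - exp (v n * (y\<^sup>2 / 2 - \<eta>\<^sup>2 / 2 + tilt_rate (y - \<eta>) * r n)))
      - 2 * exp (v n * (- \<kappa> * \<eta> + (\<kappa> + square_const \<kappa>) * r n))
      - 2 * exp (1 / 2 - v n * (\<eta>\<^sup>2 / (2 * (g n)\<^sup>2)))"
      using elim y\<eta> \<kappa>(2) by (intro sum_of_exps_lower) (auto simp: m_def)
    also have "\<dots> \<le> prob {\<omega> \<in> space M. \<bar>W n \<omega> - y * sqrt (v n)\<bar> < e * sqrt (v n)}"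
      using self_norm_lower[of "g n" \<eta> \<kappa> y e, unfolded sp] elim \<eta>(1,2) \<kappa>(1) close by simp
    finally show ?case .
  qed
qed

end

section \<open>From tails and local probabilities to Borel sets\<close>

lemma eln_le: "0 \<le> p \<Longrightarrow> p \<le> exp b \<Longrightarrow> eln p \<le> ereal b"
  using ln_le_cancel_iff[of p "exp b"] by (auto simp: eln_def)

lemma eln_ge: "exp b \<le> p \<Longrightarrow> ereal b \<le> eln p"
  using order_less_le_trans[OF exp_gt_zero[of b]] by (auto simp: eln_def ln_ge_iff)

text \<open>The rate function is even and increases with the absolute value, so for the upper bound
  \<open>B\<close> may be replaced by the complement of an open interval around 0, whose radius is
  the distance from 0 to the closure of \<open>B\<close>. Two-sided tails thus suffice, without a
  covering argument. For the lower bound every interior point has a ball inside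
  \<open>B\<close>.\<close>

lemma (in prob_space) moderate_deviation_principle:
  fixes Z :: "nat \<Rightarrow> 'a \<Rightarrow> real" and a :: "nat \<Rightarrow> real" and B :: "real set"
  assumes Z [measurable]: "\<And>n. Z n \<in> borel_measurable M"
    and a: "\<forall>\<^sub>F n in sequentially. 0 < a n"
    and U: "\<And>y \<epsilon>. 0 < y \<Longrightarrow> 0 < \<epsilon> \<Longrightarrow> \<forall>\<^sub>F n in sequentially.
       prob {\<omega> \<in> space M. y \<le> \<bar>Z n \<omega>\<bar>} \<le> exp ((- (y\<^sup>2 / 2) + \<epsilon>) / (a n)\<^sup>2)"
    and L: "\<And>y e \<epsilon>. 0 < e \<Longrightarrow> 0 < \<epsilon> \<Longrightarrow> \<forall>\<^sub>F n in sequentially.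
       exp (- (y\<^sup>2 / 2 + \<epsilon>) / (a n)\<^sup>2) \<le> prob {\<omega> \<in> space M. \<bar>Z n \<omega> - y\<bar> < e}"
    and B [measurable]: "B \<in> sets borel"
  shows "- (INF x\<in>interior B. ereal (x\<^sup>2 / 2)) \<le>
      liminf (\<lambda>n. ereal ((a n)\<^sup>2) * eln (prob {\<omega> \<in> space M. Z n \<omega> \<in> B}))" (is "_ \<le> liminf ?f")
    and "limsup (\<lambda>n. ereal ((a n)\<^sup>2) * eln (prob {\<omega> \<in> space M. Z n \<omega> \<in> B})) \<le>
      - (INF x\<in>closure B. ereal (x\<^sup>2 / 2))"
proof -
  have "- liminf ?f \<le> (INF x\<in>interior B. ereal (x\<^sup>2 / 2))"
  proof (rule INF_greatest)
    fix x assume "x \<in> interior B"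
    then obtain e where e: "0 < e" "ball x e \<subseteq> B" by (meson mem_interior)
    have "ereal (- (x\<^sup>2 / 2)) \<le> liminf ?f"
    proof (rule ereal_le_epsilon2)
      fix \<epsilon> :: real assume "0 < \<epsilon>"
      have "ereal (- (x\<^sup>2 / 2) - \<epsilon>) \<le> liminf ?f"
        using L[OF e(1) \<open>0 < \<epsilon>\<close>, of x] a
      proof (intro Liminf_bounded, eventually_elim)
        case (elim n)
        have "prob {\<omega> \<in> space M. \<bar>Z n \<omega> - x\<bar> < e} \<le> prob {\<omega> \<in> space M. Z n \<omega> \<in> B}"
          using e(2) by (intro finite_measure_mono) (auto simp: subset_iff dist_real_def abs_minus_commute)
        with elim have "ereal (- (x\<^sup>2 / 2 + \<epsilon>) / (a n)\<^sup>2) \<le> eln (prob {\<omega> \<in> space M. Z n \<omega> \<in> B})"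
          by (intro eln_ge) auto
        then have "ereal ((a n)\<^sup>2) * ereal (- (x\<^sup>2 / 2 + \<epsilon>) / (a n)\<^sup>2) \<le> ?f n"
          by (intro ereal_mult_left_mono) auto
        then show ?case using elim by simp
      qed
      then show "ereal (- (x\<^sup>2 / 2)) \<le> liminf ?f + ereal \<epsilon>"
        using \<open>0 < \<epsilon>\<close> by (cases "liminf ?f") auto
    qed
    then show "- liminf ?f \<le> ereal (x\<^sup>2 / 2)" by (simp add: ereal_uminus_le_reorder)
  qed
  then show "- (INF x\<in>interior B. ereal (x\<^sup>2 / 2)) \<le> liminf ?f" by (simp add: ereal_uminus_le_reorder)
  show "limsup ?f \<le> - (INF x\<in>closure B. ereal (x\<^sup>2 / 2))"
  \<comment> \<open>For empty \<open>B\<close> there is no nearest point; both sides are minus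
    infinity.\<close>
  proof (cases "B = {}")
    case True
    have "limsup ?f \<le> - \<infinity>"
      by (rule Limsup_bounded) (use a in \<open>eventually_elim, simp add: True eln_def\<close>)
    then show ?thesis by simp
  next
    case False
    define y where "y = infdist 0 (closure B)"
    obtain x where x: "x \<in> closure B" "y = \<bar>x\<bar>"
      using infdist_attains_inf[of "closure B" 0] False by (auto simp: y_def dist_real_def)
    have le: "y \<le> \<bar>b\<bar>" if "b \<in> B" for b
      using infdist_le[of b "closure B" 0] that closure_subset[of B] by (auto simp: y_def dist_real_def)
    have "limsup ?f \<le> ereal (- (y\<^sup>2 / 2))"
    proof (rule ereal_le_epsilon2)
      fix \<epsilon> :: real assume "0 < \<epsilon>"
      have ev: "\<forall>\<^sub>F n in sequentially. prob {\<omega> \<in> space M. Z n \<omega> \<in> B} \<le> exp ((- (y\<^sup>2 / 2) + \<epsilon>) / (a n)\<^sup>2)"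
      proof (cases "0 < y")
        case True
        show ?thesis using U[OF True \<open>0 < \<epsilon>\<close>]
        proof eventually_elim
          case (elim n)
          have "prob {\<omega> \<in> space M. Z n \<omega> \<in> B} \<le> prob {\<omega> \<in> space M. y \<le> \<bar>Z n \<omega>\<bar>}"
            using le by (intro finite_measure_mono) auto
          with elim show ?case by linarith
        qed
      next
        \<comment> \<open>If 0 lies in the closure of \<open>B\<close>, the bound is positive in the
          exponent and follows from probabilities being at most 1.\<close>
        case False
        then have "y = 0" using x by simp
        have "prob {\<omega> \<in> space M. Z n \<omega> \<in> B} \<le> exp ((- (y\<^sup>2 / 2) + \<epsilon>) / (a n)\<^sup>2)" for n
          using \<open>y = 0\<close> \<open>0 < \<epsilon>\<close> by (intro order_trans[OF prob_le_1]) auto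
        then show ?thesis by simp
      qed
      have "limsup ?f \<le> ereal (- (y\<^sup>2 / 2) + \<epsilon>)"
        using ev a
      proof (intro Limsup_bounded, eventually_elim)
        case (elim n)
        then have "eln (prob {\<omega> \<in> space M. Z n \<omega> \<in> B}) \<le> ereal ((- (y\<^sup>2 / 2) + \<epsilon>) / (a n)\<^sup>2)"
          by (intro eln_le) auto
        then have "?f n \<le> ereal ((a n)\<^sup>2) * ereal ((- (y\<^sup>2 / 2) + \<epsilon>) / (a n)\<^sup>2)"
          by (intro ereal_mult_left_mono) auto
        then show ?case using elim by simp
      qed
      then show "limsup ?f \<le> ereal (- (y\<^sup>2 / 2)) + ereal \<epsilon>" by simp
    qed
    moreover have "(INF x\<in>closure B. ereal (x\<^sup>2 / 2)) \<le> ereal (y\<^sup>2 / 2)"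
      using x by (intro INF_lower2[of x]) auto
    then have "ereal (- (y\<^sup>2 / 2)) \<le> - (INF x\<in>closure B. ereal (x\<^sup>2 / 2))"
      by (simp add: ereal_uminus_le_reorder flip: uminus_ereal.simps(1))
    ultimately show ?thesis by (rule order_trans)
  qed
qed

section \<open>Stationary sequences\<close>

text \<open>By subadditivity the value at \<open>2 ^ l\<close> is controlled by the average over all
  smaller indices, so the dyadic values cannot be much larger than typical ones. Summation by parts
  then returns from averages to the original series.\<close>

lemma dyadic_sum_bound:
  fixes b :: "nat \<Rightarrow> real"
  assumes nonneg: "\<And>j. 0 \<le> b j"
    and subadd: "\<And>i j. 1 \<le> i \<Longrightarrow> 1 \<le> j \<Longrightarrow> b (i + j) \<le> b i + b j"
    and summable: "summable (\<lambda>i. b (Suc i) / real (Suc i) powr (3 / 2))" (is "summable ?f")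
  shows "summable (\<lambda>l. (1 / sqrt 2) ^ l * b (2 ^ l))"
    and "(\<Sum>l. (1 / sqrt 2) ^ l * b (2 ^ l)) \<le> 9 * (\<Sum>i. b (Suc i) / real (Suc i) powr (3 / 2))"
proof -
  \<comment> \<open>\<open>q = 2 powr (- 3 / 2)\<close> is the ratio of the weights
    \<open>j powr (- 3 / 2)\<close> at consecutive powers of 2, and also the product of the weight
    \<open>1 / sqrt 2\<close> and the averaging factor \<open>1 / 2\<close>.\<close>
  define q :: real where "q = 1 / (2 * sqrt 2)"
  have q: "0 < q" "q \<le> 1 / 2" by (auto simp: q_def field_simps)
  have q_powr: "q = 2 powr (- (3 / 2))"
  proof -
    have "(2 :: real) powr (3 / 2) = 2 powr (1 + 1 / 2)" by simp
    also have "\<dots> = 2 * sqrt 2" unfolding powr_add by (simp add: powr_half_sqrt)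
    finally show ?thesis by (simp add: q_def powr_minus inverse_eq_divide)
  qed
  define s where "s l = (\<Sum>i\<in>{1..<2 ^ l}. b i)" for l
  define \<Gamma> where "\<Gamma> = (\<Sum>i. ?f i)"
  have f_nonneg: "0 \<le> ?f i" for i using nonneg by simp
  \<comment> \<open>Average of \<open>b (2 ^ l) \<le> b i + b (2 ^ l - i)\<close> over all
    \<open>i\<close> strictly between 0 and \<open>2 ^ l\<close>; the reflection
    \<open>i \<mapsto> 2 ^ l - i\<close> makes both sums equal.\<close>
  have avg: "b (2 ^ l) \<le> 4 * (1 / 2) ^ l * s l" if "1 \<le> l" for l
  proof -
    have "(\<Sum>i\<in>{1..<(2::nat) ^ l}. b (2 ^ l)) \<le> (\<Sum>i\<in>{1..<2 ^ l}. b i + b (2 ^ l - i))"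
    proof (rule sum_mono)
      fix i :: nat assume "i \<in> {1..<2 ^ l}"
      then show "b (2 ^ l) \<le> b i + b (2 ^ l - i)" using subadd[of i "2 ^ l - i"] by (simp add: Suc_le_eq)
    qed
    also have "\<dots> = s l + (\<Sum>i\<in>{1..<2 ^ l}. b (2 ^ l - i))" by (simp add: sum.distrib s_def)
    also have "(\<Sum>i\<in>{1..<2 ^ l}. b (2 ^ l - i)) = s l"
      unfolding s_def by (rule sum.reindex_bij_witness[where i = "\<lambda>i. 2 ^ l - i" and j = "\<lambda>i. 2 ^ l - i"]) auto
    finally have "(2 ^ l - 1) * b (2 ^ l) \<le> 2 * s l" by (simp add: of_nat_diff)
    moreover have "(2 ^ l / 2) * b (2 ^ l) \<le> (2 ^ l - 1) * b (2 ^ l)"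
    proof (rule mult_right_mono[OF _ nonneg])
      have "(2 :: real) ^ 1 \<le> 2 ^ l" using that by (intro power_increasing) auto
      then show "(2 :: real) ^ l / 2 \<le> 2 ^ l - 1" by simp
    qed
    ultimately show ?thesis by (simp add: field_simps power_divide)
  qed
  have block: "q ^ Suc l * (s (Suc l) - s l) \<le> (\<Sum>i\<in>{2 ^ l..<2 ^ Suc l}. ?f (i - 1))" for l
  proof -
    have "s (Suc l) - s l = (\<Sum>i\<in>{2 ^ l..<2 ^ Suc l}. b i)"
      unfolding s_def by (subst sum.atLeastLessThan_concat[of 1 "2 ^ l" "2 ^ Suc l", symmetric]) auto
    then have "q ^ Suc l * (s (Suc l) - s l) = (\<Sum>i\<in>{2 ^ l..<2 ^ Suc l}. q ^ Suc l * b i)"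
      by (simp only: sum_distrib_left)
    also have "\<dots> \<le> (\<Sum>i\<in>{2 ^ l..<2 ^ Suc l}. ?f (i - 1))"
    proof (rule sum_mono)
      fix i :: nat assume i: "i \<in> {2 ^ l..<2 ^ Suc l}"
      have "(1 :: nat) \<le> 2 ^ l" by simp
      with i have i1: "1 \<le> i" by (meson atLeastLessThan_iff le_trans)
      have "real i \<le> real (2 ^ Suc l)" using i by (intro of_nat_mono) auto
      then have "real i \<le> 2 ^ Suc l" by simp
      then have "(2 ^ Suc l) powr (- (3 / 2)) \<le> real i powr (- (3 / 2))"
        using i1 by (intro powr_mono2') auto
      moreover have "(2 ^ Suc l) powr (- (3 / 2)) = q ^ Suc l"
      proof -
        have "(2 ^ Suc l) powr (- (3 / 2)) = (2 powr real (Suc l)) powr (- (3 / 2) :: real)"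
          by (simp only: powr_realpow zero_less_numeral)
        also have "\<dots> = (2 powr (- (3 / 2))) powr real (Suc l)" by (rule powr_powr_swap)
        also have "\<dots> = q ^ Suc l" unfolding q_powr by (rule powr_realpow) simp
        finally show ?thesis .
      qed
      ultimately have "q ^ Suc l * b i \<le> real i powr (- (3 / 2)) * b i"
        by (intro mult_right_mono nonneg) auto
      then show "q ^ Suc l * b i \<le> ?f (i - 1)"
        using i1 unfolding powr_minus_divide by simp
    qed
    finally show ?thesis .
  qed
  have blocks: "(\<Sum>l<n. \<Sum>i\<in>{2 ^ l..<2 ^ Suc l}. ?f (i - 1)) \<le> \<Gamma>" for n
  proof -
    have "(\<Sum>l<n. \<Sum>i\<in>{2 ^ l..<2 ^ Suc l}. ?f (i - 1)) = (\<Sum>i\<in>{1..<2 ^ n}. ?f (i - 1))"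
    proof (induction n)
      case (Suc n)
      then show ?case by (simp add: sum.atLeastLessThan_concat)
    qed simp
    also have "\<dots> = (\<Sum>i\<in>{..<2 ^ n - 1}. ?f i)"
      by (rule sum.reindex_bij_witness[where i = Suc and j = "\<lambda>i. i - 1"]) auto
    also have "\<dots> \<le> \<Gamma>" unfolding \<Gamma>_def by (rule sum_le_suminf[OF summable]) (use f_nonneg in auto)
    finally show ?thesis .
  qed
  \<comment> \<open>Abel summation; the boundary term at 0 vanishes since \<open>s 0\<close> is an
    empty sum.\<close>
  have abel: "(1 - q) * (\<Sum>l<n. q ^ l * s l) + q ^ n * s n = (\<Sum>l<n. q ^ Suc l * (s (Suc l) - s l))" for n
  proof (induction n)
    case 0
    then show ?case by (simp add: s_def)
  next
    case (Suc n)
    have "(1 - q) * (\<Sum>l<Suc n. q ^ l * s l) + q ^ Suc n * s (Suc n) =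
        ((1 - q) * (\<Sum>l<n. q ^ l * s l) + q ^ n * s n) + q ^ Suc n * (s (Suc n) - s n)"
      by (simp add: algebra_simps)
    then show ?case unfolding Suc by simp
  qed
  have s_nonneg: "0 \<le> s l" for l unfolding s_def by (intro sum_nonneg nonneg)
  have sum_s: "(\<Sum>l<n. q ^ l * s l) \<le> 2 * \<Gamma>" for n
  proof -
    have "(1 / 2) * (\<Sum>l<n. q ^ l * s l) \<le> (1 - q) * (\<Sum>l<n. q ^ l * s l)"
      using q s_nonneg by (intro mult_right_mono sum_nonneg) auto
    also have "\<dots> \<le> (\<Sum>l<n. q ^ Suc l * (s (Suc l) - s l))"
      using abel[of n] q(1) s_nonneg[of n] by (smt (verit) mult_nonneg_nonneg zero_le_power)
    also have "\<dots> \<le> \<Gamma>" using sum_mono[OF block] blocks by (rule order_trans)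
    finally show ?thesis by simp
  qed
  \<comment> \<open>9 = 4 * 2 + 1: the averages contribute four times the bound
    \<open>2 * \<Gamma>\<close>, and the term \<open>l = 0\<close>, to which averaging does not
    apply, contributes \<Gamma>.\<close>
  have partial: "(\<Sum>l<n. (1 / sqrt 2) ^ l * b (2 ^ l)) \<le> 9 * \<Gamma>" for n
  proof -
    have summand: "(1 / sqrt 2) ^ l * b (2 ^ l) \<le> 4 * (q ^ l * s l) + (if l = 0 then \<Gamma> else 0)" for l
    proof (cases "l = 0")
      case True
      have "b 1 \<le> \<Gamma>"
        unfolding \<Gamma>_def using sum_le_suminf[OF summable, of "{0}"] f_nonneg by simp
      then show ?thesis using True by (simp add: s_def)
    next
      case False
      have "(1 / sqrt 2) ^ l * b (2 ^ l) \<le> (1 / sqrt 2) ^ l * (4 * (1 / 2) ^ l * s l)"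
        using False by (intro mult_left_mono avg) auto
      also have "\<dots> = 4 * ((1 / sqrt 2 * (1 / 2)) ^ l * s l)" unfolding power_mult_distrib by (simp only: ac_simps)
      also have "1 / sqrt 2 * (1 / 2) = q" by (simp add: q_def)
      finally show ?thesis using False by simp
    qed
    have "(\<Sum>l<n. if l = 0 then \<Gamma> else 0) \<le> \<Gamma>"
      using suminf_nonneg[OF summable f_nonneg] by (auto simp: sum.delta \<Gamma>_def)
    moreover have "(\<Sum>l<n. (1 / sqrt 2) ^ l * b (2 ^ l)) \<le> (\<Sum>l<n. 4 * (q ^ l * s l) + (if l = 0 then \<Gamma> else 0))"
      by (intro sum_mono summand)
    ultimately show ?thesis
      using sum_s[of n] by (simp add: sum.distrib flip: sum_distrib_left)
  qed
  show sm: "summable (\<lambda>l. (1 / sqrt 2) ^ l * b (2 ^ l))"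
    by (rule summableI_nonneg_bounded[OF _ partial]) (use nonneg in auto)
  show "(\<Sum>l. (1 / sqrt 2) ^ l * b (2 ^ l)) \<le> 9 * (\<Sum>i. ?f i)"
    using suminf_le_const[OF sm partial] by (simp add: \<Gamma>_def)
qed

section \<open>Stationarity and conditional expectations under the shift\<close>

locale adapted_stationary = prob_space M for M :: "'a measure" +
  fixes T :: "'a \<Rightarrow> 'a" and F0 :: "'a measure" and X0 :: "'a \<Rightarrow> real" and X :: "int \<Rightarrow> 'a \<Rightarrow> real"
  assumes aut: "mp_automorphism M T"
    and F0: "subalgebra M F0"
    and F0_mono: "sets F0 \<subseteq> sets (shift_algebra M T F0 1)"
    and X0_meas: "X0 \<in> borel_measurable F0"
    and X0_int: "integrable M X0"
    and X_def: "X = shift_seq M T X0"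
begin

lemma T_meas: "T \<in> measurable M M" and T_distr: "distr M M T = M"
  using aut by (auto simp: mp_automorphism_def)

lemma iterate_meas [measurable]: "T ^^ i \<in> measurable M M"
proof (induction i)
  case (Suc i)
  show ?case using measurable_compose[OF Suc T_meas] by (simp add: comp_def)
qed simp

lemma iterate_distr: "distr M M (T ^^ i) = M"
proof (induction i)
  case 0
  show ?case by (simp add: distr_id[unfolded id_def] id_def)
next
  case (Suc i)
  have "distr M M (T ^^ Suc i) = distr (distr M M (T ^^ i)) M T"
    by (subst distr_distr[OF T_meas iterate_meas]) (simp add: comp_def)
  then show ?case by (simp only: Suc T_distr)
qed

lemma iterate_space: "\<omega> \<in> space M \<Longrightarrow> (T ^^ i) \<omega> \<in> space M"
  by (rule measurable_space[OF iterate_meas])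

lemma AE_iterate: "AE \<omega> in M. P \<omega> \<Longrightarrow> AE \<omega> in M. P ((T ^^ i) \<omega>)"
  by (rule AE_distrD[OF iterate_meas]) (simp only: iterate_distr)

lemma integrable_iterate: "integrable M f \<Longrightarrow> integrable M (\<lambda>\<omega>. f ((T ^^ i) \<omega>))" for f :: "'a \<Rightarrow> real"
  by (rule integrable_distr[OF iterate_meas]) (simp add: iterate_distr)

text \<open>Only nonnegative times occur among the blocks, and there the two-sided iterate is an
  ordinary power of \<open>T\<close>.\<close>

definition F :: "nat \<Rightarrow> 'a measure" where "F i = shift_algebra M T F0 (int i)"

lemma F_eq: "F i = vimage_algebra (space M) (T ^^ i) F0"
  by (simp add: F_def shift_algebra_def int_iterate_def)

lemma space_F0: "space F0 = space M" and sets_F0: "sets F0 \<subseteq> sets M"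
  using F0 by (auto simp: subalgebra_def)

lemma sets_F: "sets (F i) = (\<lambda>A. (T ^^ i) -` A \<inter> space M) ` sets F0"
  unfolding F_eq by (subst sets_vimage_algebra2) (auto simp: space_F0 iterate_space)

lemma subalgebra_F: "subalgebra M (F i)"
proof -
  have "sets (F i) \<subseteq> sets M"
    unfolding sets_F using sets_F0 measurable_sets[OF iterate_meas] by blast
  then show ?thesis by (simp add: subalgebra_def F_eq)
qed

lemma sets_F_Suc: "sets (F i) \<subseteq> sets (F (Suc i))"
proof
  fix A assume "A \<in> sets (F i)"
  then obtain A0 where A0: "A0 \<in> sets F0" "A = (T ^^ i) -` A0 \<inter> space M" unfolding sets_F by auto
  have "sets F0 \<subseteq> sets (F 1)" using F0_mono by (simp add: F_def)
  then obtain A1 where A1: "A1 \<in> sets F0" "A0 = (T ^^ 1) -` A1 \<inter> space M"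
    using A0(1) unfolding sets_F by blast
  then have "A = (T ^^ Suc i) -` A1 \<inter> space M" unfolding A0(2) using iterate_space by auto
  then show "A \<in> sets (F (Suc i))" unfolding sets_F using A1(1) by blast
qed

sublocale F: filtered_prob_space M F
proof unfold_locales
  show "subalgebra M (F j)" for j by (rule subalgebra_F)
  show "sets (F i) \<subseteq> sets (F j)" if "i \<le> j" for i j
    using that by (induction rule: dec_induct) (use sets_F_Suc in blast)+
qed

sublocale F0: sigma_finite_subalgebra M F0
  by (rule finite_measure_subalgebra_is_sigma_finite) (unfold_locales, rule F0)

lemma measurable_iterate_F: "T ^^ i \<in> measurable (F i) F0"
  unfolding F_eq by (rule measurable_vimage_algebra1) (auto simp: space_F0 iterate_space)

text \<open>Every set of \<open>F i\<close> is a preimage under \<open>T ^^ i\<close> of a set of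
  \<open>F0\<close>, and \<open>T ^^ i\<close> preserves the measure, so the defining integrals
  agree after a change of variables. In this way norms given \<open>F0\<close> control every block
  given its own past.\<close>

lemma real_cond_exp_iterate:
  assumes f: "integrable M f"
  shows "AE \<omega> in M. real_cond_exp M (F i) (\<lambda>\<omega>. f ((T ^^ i) \<omega>)) \<omega> = real_cond_exp M F0 f ((T ^^ i) \<omega>)"
proof (rule F.sub.real_cond_exp_charact)
  let ?E = "real_cond_exp M F0 f"
  have E: "integrable M ?E" by (rule F0.real_cond_exp_int(1)[OF f])
  show "integrable M (\<lambda>\<omega>. f ((T ^^ i) \<omega>))" "integrable M (\<lambda>\<omega>. ?E ((T ^^ i) \<omega>))"
    using f E by (auto intro: integrable_iterate)
  show "(\<lambda>\<omega>. ?E ((T ^^ i) \<omega>)) \<in> borel_measurable (F i)"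
    by (rule measurable_compose[OF measurable_iterate_F]) simp
  fix A assume "A \<in> sets (F i)"
  then obtain A0 where A0: "A0 \<in> sets F0" "A = (T ^^ i) -` A0 \<inter> space M" unfolding sets_F by auto
  then have [measurable]: "A0 \<in> sets M" using sets_F0 by auto
  have pull: "(\<integral>\<omega>\<in>A. g ((T ^^ i) \<omega>) \<partial>M) = (\<integral>\<omega>\<in>A0. g \<omega> \<partial>M)"
    if [measurable]: "g \<in> borel_measurable M" for g :: "'a \<Rightarrow> real"
  proof -
    have "(\<integral>\<omega>\<in>A0. g \<omega> \<partial>M) = (\<integral>\<omega>. indicator A0 \<omega> *\<^sub>R g \<omega> \<partial>distr M M (T ^^ i))"
      by (simp add: iterate_distr set_lebesgue_integral_def)
    also have "\<dots> = (\<integral>\<omega>. indicator A0 ((T ^^ i) \<omega>) *\<^sub>R g ((T ^^ i) \<omega>) \<partial>M)"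
      by (rule integral_distr) measurable
    also have "\<dots> = (\<integral>\<omega>\<in>A. g ((T ^^ i) \<omega>) \<partial>M)"
      unfolding set_lebesgue_integral_def
      by (rule Bochner_Integration.integral_cong) (auto simp: A0(2) indicator_def)
    finally show ?thesis by simp
  qed
  have "(\<integral>\<omega>\<in>A0. f \<omega> \<partial>M) = (\<integral>\<omega>\<in>A0. ?E \<omega> \<partial>M)"
    by (rule F0.real_cond_exp_intA[OF f A0(1)])
  then show "(\<integral>\<omega>\<in>A. f ((T ^^ i) \<omega>) \<partial>M) = (\<integral>\<omega>\<in>A. ?E ((T ^^ i) \<omega>) \<partial>M)"
    using f E by (simp add: pull borel_measurable_integrable)
qed

lemma AE_real_cond_exp_iterate:
  assumes f: "integrable M f" and P: "AE \<omega> in M. P (real_cond_exp M F0 f \<omega>)"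
  shows "AE \<omega> in M. P (real_cond_exp M (F i) (\<lambda>\<omega>. f ((T ^^ i) \<omega>)) \<omega>)"
  using real_cond_exp_iterate[OF f, of i] AE_iterate[OF P, of i] by eventually_elim simp

lemma X_eq: "X (int j) \<omega> = X0 ((T ^^ j) \<omega>)"
  by (simp add: X_def shift_seq_def int_iterate_def)

lemma X_meas: "X (int j) \<in> borel_measurable (F j)"
  unfolding X_def F_def by (rule shift_seq_adapted[OF aut F0 X0_meas])

lemma psum_eq: "psum X l \<omega> = (\<Sum>j<l. X (int (Suc j)) \<omega>)"
  unfolding psum_def by (rule sum.reindex_bij_witness[where i = Suc and j = "\<lambda>j. j - 1"]) auto

lemma X_iterate: "X (int j) ((T ^^ i) \<omega>) = X (int (j + i)) \<omega>"
  unfolding X_eq by (simp add: funpow_add)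

lemma psum_add: "psum X (a + b) \<omega> = psum X a \<omega> + psum X b ((T ^^ a) \<omega>)"
  unfolding psum_eq X_iterate by (induction b) (simp_all add: ac_simps)

lemma psum_int: "integrable M (psum X l)"
proof -
  have "integrable M (\<lambda>\<omega>. \<Sum>j<l. X0 ((T ^^ Suc j) \<omega>))"
    by (intro Bochner_Integration.integrable_sum integrable_iterate X0_int)
  then show ?thesis by (simp only: psum_eq[abs_def] X_eq)
qed

lemma psum_meas: "psum X l \<in> borel_measurable (F l)"
proof -
  have "(\<lambda>\<omega>. \<Sum>j<l. X (int (Suc j)) \<omega>) \<in> borel_measurable (F l)"
    by (intro borel_measurable_sum F.measurable_G_mono[OF X_meas]) auto
  then show ?thesis by (simp add: psum_eq[abs_def])
qed

lemma block_sum_eq: "block_sum X m (Suc j) \<omega> = psum X m ((T ^^ (m * j)) \<omega>)"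
proof -
  have "block_sum X m (Suc j) \<omega> = (\<Sum>i<m. X (int (Suc i + m * j)) \<omega>)"
    unfolding block_sum_def block_def
    by (rule sum.reindex_bij_witness[where i = "\<lambda>i. Suc i + m * j" and j = "\<lambda>i. i - m * j - 1"]) auto
  then show ?thesis unfolding psum_eq X_iterate .
qed

lemma sum_block_sum:
  "(\<Sum>j\<in>{i..<i + N}. block_sum X m (Suc j) \<omega>) = psum X (m * N) ((T ^^ (m * i)) \<omega>)"
proof (induction N)
  case 0
  then show ?case by (simp add: psum_eq)
next
  case (Suc N)
  have "psum X (m * Suc N) ((T ^^ (m * i)) \<omega>) =
      psum X (m * N) ((T ^^ (m * i)) \<omega>) + psum X m ((T ^^ (m * N)) ((T ^^ (m * i)) \<omega>))"
    using psum_add[of "m * N" m] by (simp add: algebra_simps)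
  also have "(T ^^ (m * N)) ((T ^^ (m * i)) \<omega>) = (T ^^ (m * (i + N))) \<omega>"
    by (simp add: distrib_left add.commute[of "m * i"] funpow_add)
  finally show ?case using Suc by (simp add: block_sum_eq)
qed

lemma block_sum_meas: "block_sum X m (Suc j) \<in> borel_measurable (F (m * Suc j))"
proof -
  have "(\<lambda>\<omega>. \<Sum>i\<in>block m (Suc j). X (int i) \<omega>) \<in> borel_measurable (F (m * Suc j))"
    by (intro borel_measurable_sum F.measurable_G_mono[OF X_meas]) (auto simp: block_def)
  then show ?thesis by (simp add: block_sum_def[abs_def])
qed

definition drift_norm :: "nat \<Rightarrow> ennreal" where
  "drift_norm l = Linf_norm M (\<lambda>\<omega>. ereal (real_cond_exp M F0 (psum X l) \<omega>))"

lemma AE_drift_norm: "AE \<omega> in M. ennreal \<bar>real_cond_exp M F0 (psum X l) \<omega>\<bar> \<le> drift_norm l"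
proof -
  have "AE \<omega> in M. e2ennreal \<bar>ereal (real_cond_exp M F0 (psum X l) \<omega>)\<bar> \<le> drift_norm l"
    unfolding drift_norm_def Linf_norm_def by (rule esssup_AE)
  then show ?thesis by (simp add: e2ennreal_ereal)
qed

lemma drift_norm_le:
  assumes "AE \<omega> in M. \<bar>real_cond_exp M F0 (psum X l) \<omega>\<bar> \<le> c"
  shows "drift_norm l \<le> ennreal c"
  unfolding drift_norm_def Linf_norm_def
proof (rule esssup_I)
  show "AE \<omega> in M. e2ennreal \<bar>ereal (real_cond_exp M F0 (psum X l) \<omega>)\<bar> \<le> ennreal c"
    using assms by eventually_elim (auto simp: e2ennreal_ereal intro: ennreal_leI)
qed measurable

lemma AE_drift_norm_real:
  assumes "drift_norm l < \<infinity>"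
  shows "AE \<omega> in M. \<bar>real_cond_exp M F0 (psum X l) \<omega>\<bar> \<le> enn2real (drift_norm l)"
  using AE_drift_norm[of l]
proof eventually_elim
  case (elim \<omega>)
  then have "enn2real (ennreal \<bar>real_cond_exp M F0 (psum X l) \<omega>\<bar>) \<le> enn2real (drift_norm l)"
    using assms by (intro enn2real_mono) auto
  then show ?case by simp
qed

text \<open>The sum over \<open>a + b\<close> splits into the sum over \<open>a\<close> and a
  shifted sum over \<open>b\<close>. The latter is conditioned on \<open>F a\<close>, where
  stationarity bounds it by \<open>drift_norm b\<close>, and then on \<open>F0\<close>. This is the
  subadditivity that \<open>dyadic_sum_bound\<close> requires.\<close>

lemma drift_norm_subadd: "drift_norm (a + b) \<le> drift_norm a + drift_norm b"
proof (cases "drift_norm a < \<infinity> \<and> drift_norm b < \<infinity>")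
  case True
  let ?E = "real_cond_exp M F0"
  let ?g = "\<lambda>\<omega>. psum X b ((T ^^ a) \<omega>)"
  have g_int: "integrable M ?g" by (intro integrable_iterate psum_int)
  have sub: "subalgebra (F a) F0"
  proof -
    have "sets F0 = sets (F 0)"
      using sets.sets_into_space[of _ F0] by (auto simp: sets_F space_F0 image_iff Int_absorb2)
    then show ?thesis using F.mono_G[of 0 a] by (simp add: subalgebra_def space_F0 F.space_G)
  qed
  have "AE \<omega> in M. \<bar>real_cond_exp M (F a) ?g \<omega>\<bar> \<le> enn2real (drift_norm b)"
    by (rule AE_real_cond_exp_iterate[OF psum_int]) (use AE_drift_norm_real True in auto)
  then have "AE \<omega> in M. - enn2real (drift_norm b) \<le> real_cond_exp M (F a) ?g \<omega>"
    "AE \<omega> in M. real_cond_exp M (F a) ?g \<omega> \<le> enn2real (drift_norm b)"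
    by (auto elim!: eventually_mono)
  note F0.real_cond_exp_ge_c[OF F.sub.real_cond_exp_int(1)[OF g_int] this(1)]
    F0.real_cond_exp_le_c[OF F.sub.real_cond_exp_int(1)[OF g_int] this(2)]
  moreover have "AE \<omega> in M. ?E (real_cond_exp M (F a) ?g) \<omega> = ?E ?g \<omega>"
    by (rule F0.real_cond_exp_nested_subalg[OF subalgebra_F sub g_int])
  moreover have "AE \<omega> in M. ?E (\<lambda>\<omega>. psum X a \<omega> + ?g \<omega>) \<omega> = ?E (psum X a) \<omega> + ?E ?g \<omega>"
    by (rule F0.real_cond_exp_add[OF psum_int g_int])
  moreover have "AE \<omega> in M. \<bar>?E (psum X a) \<omega>\<bar> \<le> enn2real (drift_norm a)"
    using True by (intro AE_drift_norm_real) auto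
  ultimately have "AE \<omega> in M. \<bar>?E (\<lambda>\<omega>. psum X a \<omega> + ?g \<omega>) \<omega>\<bar> \<le> enn2real (drift_norm a) + enn2real (drift_norm b)"
    by eventually_elim linarith
  then have "drift_norm (a + b) \<le> ennreal (enn2real (drift_norm a) + enn2real (drift_norm b))"
    by (intro drift_norm_le) (simp add: psum_add[abs_def])
  then show ?thesis using True by (simp add: ennreal_plus less_top)
qed (auto simp: less_top[symmetric])

end

section \<open>Normalisation of the blocks\<close>

text \<open>The right-hand side is \<open>2 * x * eps_m\<close> to the power \<rho>, written for an
  arbitrary real \<open>P\<close> in place of the norm of the conditional moment.\<close>

lemma scaled_moment_bound:
  fixes P x \<sigma> \<rho> n m k s \<tau> :: real
  assumes "0 \<le> P" "0 < x" "0 < \<sigma>" "0 < \<rho>" "0 < m" "0 < k" "0 < n" "n \<le> 2 * (m * k)"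
    and s: "s = x / (\<sigma> * sqrt (m * k))" and \<tau>: "\<tau> = x\<^sup>2 / k"
  shows "s powr (2 + \<rho>) * P / \<tau> \<le>
    (2 * x * (1 / (n powr (1 / 2) * m powr (1 / \<rho>) * \<sigma> powr (2 / \<rho> + 1)) * P powr (1 / \<rho>))) powr \<rho>"
proof -
  have mk: "0 < m * k" using assms by simp
  have "s > 0" using assms by simp
  have s2: "s powr 2 = \<tau> / (\<sigma>\<^sup>2 * m)"
    using assms mk by (simp add: powr_numeral power_divide power_mult_distrib)
  have "s powr \<rho> = x powr \<rho> / (\<sigma> powr \<rho> * (m * k) powr (\<rho> / 2))"
    using assms mk by (simp add: s powr_divide powr_mult powr_powr flip: powr_half_sqrt)
  \<comment> \<open>Passing from \<open>m * k\<close> to \<open>n / 2\<close> costs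
    \<open>2 powr (\<rho> / 2)\<close>, which the factor 2 of the claim covers.\<close>
  also have "\<dots> \<le> x powr \<rho> / (\<sigma> powr \<rho> * (n / 2) powr (\<rho> / 2))"
    using assms by (intro divide_left_mono mult_left_mono powr_mono2 mult_pos_pos) auto
  also have "(n / 2) powr (\<rho> / 2) = n powr (\<rho> / 2) / 2 powr (\<rho> / 2)"
    using assms by (simp add: powr_divide)
  also have "x powr \<rho> / (\<sigma> powr \<rho> * (n powr (\<rho> / 2) / 2 powr (\<rho> / 2))) =
      2 powr (\<rho> / 2) * (x powr \<rho> / (\<sigma> powr \<rho> * n powr (\<rho> / 2)))"
    by simp
  also have "\<dots> \<le> 2 powr \<rho> * (x powr \<rho> / (\<sigma> powr \<rho> * n powr (\<rho> / 2)))"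
    using assms by (intro mult_right_mono powr_mono) auto
  finally have s\<rho>: "s powr \<rho> \<le> 2 powr \<rho> * (x powr \<rho> / (\<sigma> powr \<rho> * n powr (\<rho> / 2)))" .
  have "\<tau> > 0" using assms by simp
  have "s powr (2 + \<rho>) * P / \<tau> = s powr \<rho> * (P / (\<sigma>\<^sup>2 * m))"
    using \<open>\<tau> > 0\<close> by (simp add: powr_add s2)
  also have "\<dots> \<le> (2 powr \<rho> * (x powr \<rho> / (\<sigma> powr \<rho> * n powr (\<rho> / 2)))) * (P / (\<sigma>\<^sup>2 * m))"
    using assms by (intro mult_right_mono s\<rho>) auto
  also have "\<dots> = (2 * x * (1 / (n powr (1 / 2) * m powr (1 / \<rho>) * \<sigma> powr (2 / \<rho> + 1)) * P powr (1 / \<rho>))) powr \<rho>"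
  proof -
    have "(\<sigma> powr (2 / \<rho> + 1)) powr \<rho> = \<sigma> powr 2 * \<sigma> powr \<rho>"
    proof -
      have "(2 / \<rho> + 1) * \<rho> = 2 + \<rho>" using assms by (simp add: distrib_right)
      then have "(\<sigma> powr (2 / \<rho> + 1)) powr \<rho> = \<sigma> powr (2 + \<rho>)" by (simp only: powr_powr)
      then show ?thesis by (simp only: powr_add[of \<sigma> 2])
    qed
    then show ?thesis
      using assms by (simp add: powr_mult powr_divide powr_powr powr_numeral)
  qed
  finally show ?thesis .
qed

context adapted_stationary
begin

text \<open>Bridge from the extended nonnegative conditional expectation to the real one:
  boundedness gives a finite integral, after which both agree almost surely.\<close>

lemma nn_cond_exp_bounded:
  assumes [measurable]: "f \<in> borel_measurable M" and nonneg: "\<And>\<omega>. 0 \<le> f \<omega>"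
    and bd: "AE \<omega> in M. nn_cond_exp M F0 (\<lambda>\<omega>. ennreal (f \<omega>)) \<omega> \<le> ennreal c"
  shows "integrable M f"
    and "AE \<omega> in M. ennreal (real_cond_exp M F0 f \<omega>) = nn_cond_exp M F0 (\<lambda>\<omega>. ennreal (f \<omega>)) \<omega> \<and>
           0 \<le> real_cond_exp M F0 f \<omega>"
proof -
  let ?E = "nn_cond_exp M F0 (\<lambda>\<omega>. ennreal (f \<omega>))"
  have "(\<integral>\<^sup>+\<omega>. ennreal (f \<omega>) \<partial>M) = (\<integral>\<^sup>+\<omega>. ?E \<omega> \<partial>M)"
    using F0.nn_cond_exp_intg[of "\<lambda>_. 1" "\<lambda>\<omega>. ennreal (f \<omega>)"] by simp
  also have "\<dots> \<le> (\<integral>\<^sup>+\<omega>. ennreal c \<partial>M)" by (rule nn_integral_mono_AE[OF bd])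
  also have "\<dots> < \<infinity>" by (simp add: emeasure_space_1)
  finally show "integrable M f"
    using nonneg by (intro integrableI_bounded) auto
  have zero: "AE \<omega> in M. (0 :: ennreal) = nn_cond_exp M F0 (\<lambda>\<omega>. 0) \<omega>"
    by (rule F0.nn_cond_exp_F_meas) auto
  have neg: "(\<lambda>\<omega>. ennreal (- f \<omega>)) = (\<lambda>\<omega>. 0)" using nonneg by (simp add: ennreal_neg)
  show "AE \<omega> in M. ennreal (real_cond_exp M F0 f \<omega>) = ?E \<omega> \<and> 0 \<le> real_cond_exp M F0 f \<omega>"
    using zero bd
  proof eventually_elim
    case (elim \<omega>)
    have "?E \<omega> < top" using elim(2) ennreal_less_top by (rule order_le_less_trans)
    then show ?case by (simp add: real_cond_exp_def neg flip: elim(1))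
  qed
qed

lemma psum_meas_M [measurable]: "psum X l \<in> borel_measurable M"
  using psum_meas by (rule F.measurable_G)

definition moment_norm :: "real \<Rightarrow> nat \<Rightarrow> ennreal" where
  "moment_norm \<rho> m = Linf_norm M (\<lambda>\<omega>. enn2ereal
     (nn_cond_exp M F0 (\<lambda>\<omega>. ennreal (\<bar>psum X m \<omega>\<bar> powr (2 + \<rho>))) \<omega>))"

lemma moment_norm_bound:
  assumes "moment_norm \<rho> m < \<infinity>"
  shows "integrable M (\<lambda>\<omega>. \<bar>psum X m \<omega>\<bar> powr (2 + \<rho>))"
    and "AE \<omega> in M. real_cond_exp M F0 (\<lambda>\<omega>. \<bar>psum X m \<omega>\<bar> powr (2 + \<rho>)) \<omega> \<le> enn2real (moment_norm \<rho> m)"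
proof -
  let ?f = "\<lambda>\<omega>. \<bar>psum X m \<omega>\<bar> powr (2 + \<rho>)"
  let ?c = "enn2real (moment_norm \<rho> m)"
  have "AE \<omega> in M. e2ennreal \<bar>enn2ereal (nn_cond_exp M F0 (\<lambda>\<omega>. ennreal (?f \<omega>)) \<omega>)\<bar> \<le> moment_norm \<rho> m"
    unfolding moment_norm_def Linf_norm_def by (rule esssup_AE)
  then have bd: "AE \<omega> in M. nn_cond_exp M F0 (\<lambda>\<omega>. ennreal (?f \<omega>)) \<omega> \<le> ennreal ?c"
    using assms by simp
  have [measurable]: "?f \<in> borel_measurable M" by measurable
  note B = nn_cond_exp_bounded[OF _ _ bd]
  show "integrable M ?f" by (rule B) auto
  have "AE \<omega> in M. ennreal (real_cond_exp M F0 ?f \<omega>) = nn_cond_exp M F0 (\<lambda>\<omega>. ennreal (?f \<omega>)) \<omega> \<and>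
           0 \<le> real_cond_exp M F0 ?f \<omega>"
    by (rule B) auto
  then show "AE \<omega> in M. real_cond_exp M F0 ?f \<omega> \<le> ?c"
    using bd
  proof eventually_elim
    case (elim \<omega>)
    then have "ennreal (real_cond_exp M F0 ?f \<omega>) \<le> ennreal ?c" by simp
    then show ?case by (simp add: ennreal_le_iff)
  qed
qed

lemma delta_sq_bounds:
  assumes "0 < m" "0 < \<sigma>" and fin: "delta_sq_m M F0 X \<sigma> m < \<infinity>"
  shows "drift_norm m < \<infinity>"
    and "(enn2real (drift_norm m))\<^sup>2 / (real m * \<sigma>\<^sup>2) \<le> enn2real (delta_sq_m M F0 X \<sigma> m)"
    and "integrable M (\<lambda>\<omega>. (psum X m \<omega>)\<^sup>2)"
    and "AE \<omega> in M. \<bar>real_cond_exp M F0 (\<lambda>\<omega>. (psum X m \<omega>)\<^sup>2) \<omega> / (real m * \<sigma>\<^sup>2) - 1\<bar> \<le>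
           enn2real (delta_sq_m M F0 X \<sigma> m)"
proof -
  define c where "c = 1 / (real m * \<sigma>\<^sup>2)"
  have "0 < c" using assms by (simp add: c_def)
  define d where "d = delta_sq_m M F0 X \<sigma> m"
  let ?N = "nn_cond_exp M F0 (\<lambda>\<omega>. ennreal ((psum X m \<omega>)\<^sup>2))"
  let ?R = "real_cond_exp M F0 (\<lambda>\<omega>. (psum X m \<omega>)\<^sup>2)"
  define L where "L = Linf_norm M (\<lambda>\<omega>. ereal c * enn2ereal (?N \<omega>) - 1)"
  have d_eq: "d = ennreal c * (drift_norm m)\<^sup>2 + L"
    unfolding d_def delta_sq_m_def drift_norm_def L_def c_def ..
  have d_fin: "d < \<infinity>" using fin by (simp add: d_def)
  then have cd: "ennreal c * (drift_norm m)\<^sup>2 < \<infinity>" and L_fin: "L < \<infinity>" unfolding d_eq by auto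
  then have "(drift_norm m)\<^sup>2 < \<infinity>"
    using \<open>0 < c\<close> by (auto simp: ennreal_mult_less_top ennreal_eq_0_iff)
  then show dn: "drift_norm m < \<infinity>"
    by (auto simp: power2_eq_square ennreal_mult_less_top)
  have "ennreal (c * (enn2real (drift_norm m))\<^sup>2) = ennreal c * (drift_norm m)\<^sup>2"
    using dn \<open>0 < c\<close> by (simp add: ennreal_mult ennreal_power[symmetric])
  also have "\<dots> \<le> d" unfolding d_eq by simp
  finally have "enn2real (ennreal (c * (enn2real (drift_norm m))\<^sup>2)) \<le> enn2real d"
    using d_fin by (intro enn2real_mono) auto
  then show "(enn2real (drift_norm m))\<^sup>2 / (real m * \<sigma>\<^sup>2) \<le> enn2real (delta_sq_m M F0 X \<sigma> m)"
    using \<open>0 < c\<close> by (simp add: c_def d_def)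
  have L_le: "enn2real L \<le> enn2real d"
    using d_fin unfolding d_eq by (intro enn2real_mono) auto
  have "AE \<omega> in M. e2ennreal \<bar>ereal c * enn2ereal (?N \<omega>) - 1\<bar> \<le> L"
    unfolding L_def Linf_norm_def by (rule esssup_AE)
  then have N: "AE \<omega> in M. ?N \<omega> < \<infinity> \<and> \<bar>c * enn2real (?N \<omega>) - 1\<bar> \<le> enn2real L"
  proof eventually_elim
    case (elim \<omega>)
    show ?case
    proof (cases "?N \<omega>")
      case (real z)
      have "\<bar>ereal c * enn2ereal (?N \<omega>) - 1\<bar> = ereal \<bar>c * z - 1\<bar>"
        using real by (simp add: one_ereal_def)
      then have "ennreal \<bar>c * z - 1\<bar> \<le> L" using elim by (simp add: e2ennreal_ereal)
      then have "enn2real (ennreal \<bar>c * z - 1\<bar>) \<le> enn2real L" using L_fin by (intro enn2real_mono) auto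
      then show ?thesis using real by simp
    next
      \<comment> \<open>An infinite conditional second moment on a set of positive measure would
        make the norm infinite.\<close>
      case top
      then have "\<bar>ereal c * enn2ereal (?N \<omega>) - 1\<bar> = \<infinity>" using \<open>0 < c\<close> by simp
      then show ?thesis using elim L_fin by (simp add: top_unique)
    qed
  qed
  then have bd: "AE \<omega> in M. ?N \<omega> \<le> ennreal ((1 + enn2real L) / c)"
  proof eventually_elim
    case (elim \<omega>)
    then have "enn2real (?N \<omega>) \<le> (1 + enn2real L) / c"
      using \<open>0 < c\<close> by (simp add: pos_le_divide_eq mult.commute abs_le_iff)
    then have "ennreal (enn2real (?N \<omega>)) \<le> ennreal ((1 + enn2real L) / c)" by (rule ennreal_leI)
    then show ?case using elim by simp
  qed
  have [measurable]: "(\<lambda>\<omega>. (psum X m \<omega>)\<^sup>2) \<in> borel_measurable M" by measurable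
  note B = nn_cond_exp_bounded[OF _ _ bd]
  show "integrable M (\<lambda>\<omega>. (psum X m \<omega>)\<^sup>2)" by (rule B) auto
  have "AE \<omega> in M. ennreal (?R \<omega>) = ?N \<omega> \<and> 0 \<le> ?R \<omega>" by (rule B) auto
  then show "AE \<omega> in M. \<bar>?R \<omega> / (real m * \<sigma>\<^sup>2) - 1\<bar> \<le> enn2real (delta_sq_m M F0 X \<sigma> m)"
    using N
  proof eventually_elim
    case (elim \<omega>)
    then have "enn2real (?N \<omega>) = ?R \<omega>" by (metis enn2real_ennreal)
    with elim L_le show ?case by (simp add: c_def d_def)
  qed
qed

text \<open>The factor \<open>s\<close> is such that \<open>s^2 * m * \<sigma>^2 = \<tau>\<close>.
  In \<open>r\<close>, the first summand bounds the drift and the variance error and the second the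
  higher moment; as both are nonnegative, the sum serves for all three.\<close>

lemma block_array_scaled:
  assumes m: "0 < m" and k: "0 < k" and x: "0 < x" and \<sigma>: "0 < \<sigma>" and \<rho>: "0 < \<rho>" "\<rho> \<le> 1"
    and s: "s = x / (\<sigma> * sqrt (real m * real k))" and \<tau>: "\<tau> = x\<^sup>2 / real k"
    and dfin: "delta_sq_m M F0 X \<sigma> m < \<infinity>" and pfin: "moment_norm \<rho> m < \<infinity>"
    and r: "r = enn2real (delta_sq_m M F0 X \<sigma> m) + s powr (2 + \<rho>) * enn2real (moment_norm \<rho> m) / \<tau>"
  shows "block_array M (\<lambda>j. F (m * j)) (\<lambda>j \<omega>. s * block_sum X m (Suc j) \<omega>) \<tau> r \<rho>"
proof -
  have \<tau>_pos: "0 < \<tau>" and s_pos: "0 < s" using assms by auto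
  have s2: "s\<^sup>2 = \<tau> / (real m * \<sigma>\<^sup>2)"
    using assms by (simp add: power_divide power_mult_distrib)
  define D where "D = enn2real (delta_sq_m M F0 X \<sigma> m)"
  have D0: "0 \<le> D" by (simp add: D_def)
  have p0: "0 \<le> s powr (2 + \<rho>) * enn2real (moment_norm \<rho> m) / \<tau>" using \<tau>_pos by simp
  have rD: "D \<le> r" using p0 by (simp add: r D_def)
  let ?S = "psum X m"
  let ?E = "real_cond_exp M F0"
  have U: "(\<lambda>\<omega>. s * block_sum X m (Suc j) \<omega>) = (\<lambda>\<omega>. s * ?S ((T ^^ (m * j)) \<omega>))" for j
    by (simp add: block_sum_eq)
  have i1: "integrable M (\<lambda>\<omega>. s * ?S \<omega>)" using psum_int by simp
  have i2: "integrable M (\<lambda>\<omega>. (s * ?S \<omega>)\<^sup>2)"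
    using delta_sq_bounds(3)[OF m \<sigma> dfin] by (simp add: power_mult_distrib)
  have pe: "\<bar>s * z\<bar> powr (2 + \<rho>) = s powr (2 + \<rho>) * \<bar>z\<bar> powr (2 + \<rho>)" for z
    using s_pos by (simp add: abs_mult powr_mult)
  have i3: "integrable M (\<lambda>\<omega>. \<bar>s * ?S \<omega>\<bar> powr (2 + \<rho>))"
    unfolding pe using moment_norm_bound(1)[OF pfin] by simp
  have c1: "AE \<omega> in M. (?E (\<lambda>\<omega>. s * ?S \<omega>) \<omega>)\<^sup>2 \<le> \<tau> * r"
    using F0.real_cond_exp_cmult[OF psum_int[of m], of s] AE_drift_norm_real[OF delta_sq_bounds(1)[OF m \<sigma> dfin]]
  proof eventually_elim
    case (elim \<omega>)
    have "(?E ?S \<omega>)\<^sup>2 \<le> (enn2real (drift_norm m))\<^sup>2"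
      using elim(2) by (meson abs_ge_zero order_trans power2_le_iff_abs_le)
    then have "(?E (\<lambda>\<omega>. s * ?S \<omega>) \<omega>)\<^sup>2 \<le> s\<^sup>2 * (enn2real (drift_norm m))\<^sup>2"
      using elim(1) by (simp add: power_mult_distrib mult_left_mono)
    also have "\<dots> = \<tau> * ((enn2real (drift_norm m))\<^sup>2 / (real m * \<sigma>\<^sup>2))" by (simp add: s2)
    also have "\<dots> \<le> \<tau> * r"
      using delta_sq_bounds(2)[OF m \<sigma> dfin] rD \<tau>_pos unfolding D_def by (intro mult_left_mono) auto
    finally show ?case .
  qed
  have c2: "AE \<omega> in M. \<bar>?E (\<lambda>\<omega>. (s * ?S \<omega>)\<^sup>2) \<omega> - \<tau>\<bar> \<le> \<tau> * r"
    using F0.real_cond_exp_cmult[OF delta_sq_bounds(3)[OF m \<sigma> dfin], of "s\<^sup>2"] delta_sq_bounds(4)[OF m \<sigma> dfin]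
  proof eventually_elim
    case (elim \<omega>)
    let ?z = "?E (\<lambda>\<omega>. (?S \<omega>)\<^sup>2) \<omega>"
    have "?E (\<lambda>\<omega>. (s * ?S \<omega>)\<^sup>2) \<omega> - \<tau> = \<tau> * (?z / (real m * \<sigma>\<^sup>2) - 1)"
      using elim(1) by (simp add: power_mult_distrib s2 algebra_simps)
    then have "\<bar>?E (\<lambda>\<omega>. (s * ?S \<omega>)\<^sup>2) \<omega> - \<tau>\<bar> = \<tau> * \<bar>?z / (real m * \<sigma>\<^sup>2) - 1\<bar>"
      using \<tau>_pos by (simp add: abs_mult)
    also have "\<dots> \<le> \<tau> * r" using elim(2) rD \<tau>_pos unfolding D_def by (intro mult_left_mono) auto
    finally show ?case .
  qed
  have c3: "AE \<omega> in M. ?E (\<lambda>\<omega>. \<bar>s * ?S \<omega>\<bar> powr (2 + \<rho>)) \<omega> \<le> \<tau> * r"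
    unfolding pe
    using F0.real_cond_exp_cmult[OF moment_norm_bound(1)[OF pfin], of "s powr (2 + \<rho>)"] moment_norm_bound(2)[OF pfin]
  proof eventually_elim
    case (elim \<omega>)
    have "s powr (2 + \<rho>) * ?E (\<lambda>\<omega>. \<bar>?S \<omega>\<bar> powr (2 + \<rho>)) \<omega> \<le> s powr (2 + \<rho>) * enn2real (moment_norm \<rho> m)"
      using elim(2) by (intro mult_left_mono) auto
    also have "\<dots> = \<tau> * (s powr (2 + \<rho>) * enn2real (moment_norm \<rho> m) / \<tau>)" using \<tau>_pos by simp
    also have "\<dots> \<le> \<tau> * r" using D0 \<tau>_pos by (intro mult_left_mono) (auto simp: r D_def)
    finally show ?case using elim(1) by simp
  qed
  show ?thesis
  proof unfold_locales
    show "subalgebra M (F (m * j))" for j by (rule subalgebra_F)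
    show "sets (F (m * i)) \<subseteq> sets (F (m * j))" if "i \<le> j" for i j
      using that by (intro F.mono_G) simp
    show "(\<lambda>\<omega>. s * block_sum X m (Suc j) \<omega>) \<in> borel_measurable (F (m * Suc j))" for j
      using block_sum_meas by measurable
    show "integrable M (\<lambda>\<omega>. s * block_sum X m (Suc j) \<omega>)" for j
      unfolding U by (rule integrable_iterate[OF i1])
    show "integrable M (\<lambda>\<omega>. (s * block_sum X m (Suc j) \<omega>)\<^sup>2)" for j
      unfolding block_sum_eq by (rule integrable_iterate[OF i2])
    show "integrable M (\<lambda>\<omega>. \<bar>s * block_sum X m (Suc j) \<omega>\<bar> powr (2 + \<rho>))" for j
      unfolding block_sum_eq by (rule integrable_iterate[OF i3])
    show "AE \<omega> in M. (real_cond_exp M (F (m * j)) (\<lambda>\<omega>. s * block_sum X m (Suc j) \<omega>) \<omega>)\<^sup>2 \<le> \<tau> * r" for j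
      unfolding U by (rule AE_real_cond_exp_iterate[OF i1 c1])
    show "AE \<omega> in M. \<bar>real_cond_exp M (F (m * j)) (\<lambda>\<omega>. (s * block_sum X m (Suc j) \<omega>)\<^sup>2) \<omega> - \<tau>\<bar> \<le> \<tau> * r" for j
      unfolding block_sum_eq by (rule AE_real_cond_exp_iterate[OF i2 c2])
    show "AE \<omega> in M. real_cond_exp M (F (m * j)) (\<lambda>\<omega>. \<bar>s * block_sum X m (Suc j) \<omega>\<bar> powr (2 + \<rho>)) \<omega> \<le> \<tau> * r" for j
      unfolding block_sum_eq by (rule AE_real_cond_exp_iterate[OF i3 c3])
    show "0 \<le> r" using rD D0 by linarith
  qed (fact \<tau>_pos \<rho>)+
qed

lemma gamma_real:
  assumes "0 < m" "0 < \<sigma>" and fin: "gamma_m M F0 X \<sigma> m < \<infinity>"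
  defines "f \<equiv> \<lambda>i. enn2real (drift_norm (m * Suc i)) / real (Suc i) powr (3 / 2)"
  shows "drift_norm (m * Suc i) < \<infinity>" and "summable f"
    and "(\<Sum>i. f i) = real m powr (1 / 2) * \<sigma> * enn2real (gamma_m M F0 X \<sigma> m)"
proof -
  let ?g = "\<lambda>i. ennreal (1 / real (Suc i) powr (3 / 2)) * drift_norm (m * Suc i)"
  let ?c = "1 / (real m powr (1 / 2) * \<sigma>)"
  have "0 < ?c" using assms by simp
  have g: "gamma_m M F0 X \<sigma> m = ennreal ?c * (\<Sum>i. ?g i)"
    unfolding gamma_m_def drift_norm_def ..
  then have sfin: "(\<Sum>i. ?g i) < \<infinity>"
    using fin \<open>0 < ?c\<close> by (auto simp: ennreal_mult_less_top ennreal_eq_0_iff)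
  have dn: "drift_norm (m * Suc i) < \<infinity>" for i
  proof -
    have "?g i \<le> (\<Sum>i. ?g i)"
      using sum_le_suminf[of ?g "{i}"] by simp
    then have "?g i < \<infinity>" using sfin by (rule order_le_less_trans)
    then show ?thesis by (auto simp: ennreal_mult_less_top ennreal_eq_0_iff)
  qed
  then show "drift_norm (m * Suc i) < \<infinity>" .
  have gf: "?g i = ennreal (f i)" for i
  proof -
    have "ennreal (f i) = ennreal (1 / real (Suc i) powr (3 / 2) * enn2real (drift_norm (m * Suc i)))"
      by (simp add: f_def)
    also have "\<dots> = ?g i" using dn[of i] by (subst ennreal_mult) auto
    finally show ?thesis by simp
  qed
  have f0: "0 \<le> f i" for i by (simp add: f_def)
  show sm: "summable f"
    using f0 sfin unfolding gf by (intro summable_suminf_not_top) auto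
  have "(\<Sum>i. ?g i) = ennreal (suminf f)" unfolding gf by (rule suminf_ennreal2[OF f0 sm])
  then have "gamma_m M F0 X \<sigma> m = ennreal (?c * suminf f)"
    unfolding g using \<open>0 < ?c\<close> suminf_nonneg[OF sm f0] by (simp only: ennreal_mult less_imp_le)
  then have "enn2real (gamma_m M F0 X \<sigma> m) = ?c * suminf f"
    using \<open>0 < ?c\<close> suminf_nonneg[OF sm f0] by simp
  then show "(\<Sum>i. f i) = real m powr (1 / 2) * \<sigma> * enn2real (gamma_m M F0 X \<sigma> m)"
    using assms(1,2) by simp
qed

section \<open>The total drift of the blocks\<close>

text \<open>The dyadic decomposition is applied to the scaled block sums; a dyadic group of blocks
  is again a shifted partial sum, so its drift is bounded by \<open>drift_norm\<close>. The
  constants are 45 = 5 * 9 and 20 = 5 * 4: 5 from the decomposition, 9 from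
  \<open>dyadic_sum_bound\<close>, 4 from a geometric series.\<close>

lemma total_drift_subgaussian:
  assumes m: "0 < m" and k: "0 < k" and x: "0 < x" and \<sigma>: "0 < \<sigma>" and \<eta>: "0 < \<eta>"
    and s: "s = x / (\<sigma> * sqrt (real m * real k))"
    and fin: "gamma_m M F0 X \<sigma> m < \<infinity>"
  shows "subgaussian (\<lambda>\<omega>. \<Sum>j<k. real_cond_exp M (F (m * j)) (\<lambda>\<omega>. s * block_sum X m (Suc j) \<omega>) \<omega>)
    ((45 * enn2real (gamma_m M F0 X \<sigma> m) + 20 * \<eta>) * x)"
proof -
  define b where "b N = enn2real (drift_norm (m * N))" for N
  note \<gamma> = gamma_real[OF m \<sigma> fin]
  have dn: "drift_norm (m * N) < \<infinity>" if "1 \<le> N" for N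
    using \<gamma>(1)[of "N - 1"] that by simp
  have b0: "0 \<le> b N" for N by (simp add: b_def)
  have b_sub: "b (i + j) \<le> b i + b j" if "1 \<le> i" "1 \<le> j" for i j
  proof -
    have "enn2real (drift_norm (m * i + m * j)) \<le> enn2real (drift_norm (m * i) + drift_norm (m * j))"
      using dn[OF that(1)] dn[OF that(2)] by (intro enn2real_mono drift_norm_subadd) auto
    also have "\<dots> = b i + b j" using dn[OF that(1)] dn[OF that(2)] by (simp add: b_def enn2real_plus)
    finally show ?thesis by (simp add: b_def distrib_left)
  qed
  have b_sm: "summable (\<lambda>i. b (Suc i) / real (Suc i) powr (3 / 2))" using \<gamma>(2) by (simp add: b_def)
  note dyadic = dyadic_sum_bound[of b, OF b0 b_sub b_sm]
  \<comment> \<open>The drift norms may vanish while the decomposition asks for strictly positive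
    bounds; \<open>c\<close> is the positive surplus, on the scale that turns into \<eta> in the
    end.\<close>
  define c where "c = \<sigma> * sqrt (real m) * \<eta>"
  have c: "0 < c" using m \<sigma> \<eta> by (simp add: c_def)
  define h where "h i = (1 / sqrt 2) ^ i * b (2 ^ i) + (1 / sqrt 2) ^ i * c" for i
  have lt1: "norm (1 / sqrt 2 :: real) < 1" by simp
  have geo: "summable (\<lambda>i. (1 / sqrt 2) ^ i * c)"
    by (intro summable_mult2 summable_geometric lt1)
  have h_sm: "summable h" unfolding h_def by (intro summable_add dyadic(1) geo)
  have h_pos: "0 < h i" for i unfolding h_def using b0 c by (intro add_nonneg_pos) auto
  have s0: "0 < s" using assms by simp
  define B where "B l = s * (b (2 ^ l) + c)" for l
  \<comment> \<open>This is the series of \<open>B (i + l) / sqrt 2 ^ i\<close> over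
    \<open>i\<close>, which solves the recursion for \<open>a\<close> with equality.\<close>
  define a where "a l = s * sqrt 2 ^ l * (\<Sum>i. h (i + l))" for l
  have B_pos: "0 < B l" for l unfolding B_def using s0 b0 c by (intro mult_pos_pos add_nonneg_pos) auto
  have B_Suc: "B (Suc l) \<le> 2 * B l" for l
  proof -
    have "b (2 ^ Suc l) \<le> 2 * b (2 ^ l)" using b_sub[of "2 ^ l" "2 ^ l"] by (simp flip: mult_2)
    then have "s * (b (2 ^ Suc l) + c) \<le> s * (2 * (b (2 ^ l) + c))" using c s0 by (intro mult_left_mono) auto
    then show ?thesis by (simp only: B_def mult.left_commute)
  qed
  have h_sm_shift: "summable (\<lambda>i. h (i + l))" for l using h_sm by (simp add: summable_iff_shift)
  have a_pos: "0 < a l" for l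
    unfolding a_def using s0 h_pos by (intro mult_pos_pos suminf_pos h_sm_shift) auto
  have a_Suc: "B l + a (Suc l) / sqrt 2 \<le> a l" for l
  proof -
    have "(\<Sum>i. h (i + l)) = (\<Sum>i. h (Suc i + l)) + h l"
      using suminf_split_head[OF h_sm_shift[of l]] by simp
    moreover have "sqrt 2 ^ l * h l = b (2 ^ l) + c"
      unfolding h_def by (simp add: power_one_over flip: add_divide_distrib)
    ultimately have "a l = s * sqrt 2 ^ l * (\<Sum>i. h (i + Suc l)) + B l"
      unfolding a_def B_def by (simp add: distrib_left mult.assoc)
    then show ?thesis by (simp add: a_def)
  qed
  let ?U = "\<lambda>j \<omega>. s * block_sum X m (Suc j) \<omega>"
  interpret A: filtered_prob_space M "\<lambda>j. F (m * j)"
    by unfold_locales (auto simp only: intro!: subalgebra_F F.mono_G mult_left_mono)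
  have U_int: "integrable M (?U j)" for j
    unfolding block_sum_eq by (intro integrable_mult_right integrable_iterate psum_int)
  have bd: "AE \<omega> in M. \<bar>A.block_drift ?U l i \<omega>\<bar> \<le> B l" for l i
  proof -
    have "(\<Sum>j\<in>{i * 2 ^ l..<Suc i * 2 ^ l}. ?U j \<omega>) = s * psum X (m * 2 ^ l) ((T ^^ (m * (i * 2 ^ l))) \<omega>)" for \<omega>
      using sum_block_sum[where i = "i * 2 ^ l" and N = "2 ^ l" and m = m and \<omega> = \<omega>] by (simp add: sum_distrib_left[symmetric] add.commute)
    then have eq: "A.block_drift ?U l i = real_cond_exp M (F (m * (i * 2 ^ l)))
        (\<lambda>\<omega>. s * psum X (m * 2 ^ l) ((T ^^ (m * (i * 2 ^ l))) \<omega>))"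
      by (simp add: A.block_drift_def)
    have "AE \<omega> in M. \<bar>real_cond_exp M F0 (\<lambda>\<omega>. s * psum X (m * 2 ^ l) \<omega>) \<omega>\<bar> \<le> B l"
      using F0.real_cond_exp_cmult[OF psum_int[of "m * 2 ^ l"], of s] AE_drift_norm_real[OF dn[of "2 ^ l", OF one_le_power[OF one_le_numeral]]]
    proof eventually_elim
      case (elim \<omega>)
      then have "\<bar>real_cond_exp M F0 (\<lambda>\<omega>. s * psum X (m * 2 ^ l) \<omega>) \<omega>\<bar> \<le> s * b (2 ^ l)"
        using s0 by (simp add: abs_mult b_def)
      also have "\<dots> \<le> B l" unfolding B_def using s0 c by (intro mult_left_mono) auto
      finally show ?case .
    qed
    then show ?thesis
      unfolding eq by (rule AE_real_cond_exp_iterate[OF integrable_mult_right[OF psum_int]])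
  qed
  have sub: "subgaussian (\<lambda>\<omega>. \<Sum>i<k. A.block_drift ?U 0 i \<omega>) (5 * sqrt (real k) * a 0)"
    by (rule A.subgaussian_block_drift[where B = B and a = a, OF U_int bd B_pos B_Suc a_pos a_Suc])
  have "5 * sqrt (real k) * a 0 \<le> (45 * enn2real (gamma_m M F0 X \<sigma> m) + 20 * \<eta>) * x"
  proof -
    have "(\<Sum>i. (1 / sqrt 2) ^ i * c) = 1 / (1 - 1 / sqrt 2) * c"
      using suminf_geometric[OF lt1] suminf_mult2[OF summable_geometric[OF lt1], of c] by simp
    also have "\<dots> \<le> 4 * c"
    proof (rule mult_right_mono)
      have "(4 / 3 :: real) \<le> sqrt 2" by (rule real_le_rsqrt) (simp add: power2_eq_square)
      then have "1 / sqrt 2 \<le> (3 / 4 :: real)" by (simp add: field_simps)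
      then show "1 / (1 - 1 / sqrt 2) \<le> (4 :: real)" by (simp add: field_simps)
    qed (use c in simp)
    finally have "(\<Sum>i. (1 / sqrt 2) ^ i * c) \<le> 4 * c" .
    moreover have "(\<Sum>i. h i) = (\<Sum>i. (1 / sqrt 2) ^ i * b (2 ^ i)) + (\<Sum>i. (1 / sqrt 2) ^ i * c)"
      unfolding h_def by (intro suminf_add[symmetric] dyadic(1) geo)
    moreover have "(\<Sum>i. b (Suc i) / real (Suc i) powr (3 / 2)) = sqrt m * \<sigma> * enn2real (gamma_m M F0 X \<sigma> m)"
      using \<gamma>(3) m by (simp add: b_def powr_half_sqrt)
    ultimately have "(\<Sum>i. h i) \<le> sqrt m * \<sigma> * (9 * enn2real (gamma_m M F0 X \<sigma> m) + 4 * \<eta>)"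
      using dyadic(2) by (simp add: c_def algebra_simps)
    then have "5 * (sqrt k * s) * (\<Sum>i. h i) \<le>
        5 * (sqrt k * s) * (sqrt m * \<sigma> * (9 * enn2real (gamma_m M F0 X \<sigma> m) + 4 * \<eta>))"
      using s0 by (intro mult_left_mono) auto
    also have "sqrt k * s = x / (\<sigma> * sqrt m)" using k by (simp add: s real_sqrt_mult)
    finally show ?thesis using m \<sigma> k by (simp add: a_def s real_sqrt_mult algebra_simps)
  qed
  then have "subgaussian (\<lambda>\<omega>. \<Sum>i<k. A.block_drift ?U 0 i \<omega>) ((45 * enn2real (gamma_m M F0 X \<sigma> m) + 20 * \<eta>) * x)"
    using a_pos[of 0] by (intro subgaussian_mono[OF sub]) auto
  then show ?thesis by (simp add: A.block_drift_def)
qed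

end

section \<open>The moderate deviation principle\<close>

lemma enn_powr_eq_ennreal: "x < \<infinity> \<Longrightarrow> enn_powr x p = ennreal (enn2real x powr p)"
  by (auto simp: enn_powr_def)

lemma enn_powr_less_top: "enn_powr x p < \<infinity> \<Longrightarrow> x < \<infinity>"
  by (cases x) (auto simp: enn_powr_def split: if_splits)

text \<open>Both factors are released from the minimum, and \<open>a\<close> turns out to be
  positive. The bound involving \<open>e\<close> is not strict and free of inverses, so that it also
  makes sense for \<open>e = 0\<close>.\<close>

lemma mult_min_gt:
  fixes a K z :: real and e :: ennreal
  assumes "ereal K < ereal a * enn2ereal (min (inverse e) (ennreal z))" "0 \<le> K" "0 \<le> z" "e < \<infinity>"
  shows "0 < a" "K < a * z" "K * enn2real e \<le> a"
proof -
  let ?m = "min (inverse e) (ennreal z)"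
  show a: "0 < a"
  proof (rule ccontr)
    assume "\<not> 0 < a"
    then have "ereal a * enn2ereal ?m \<le> 0"
      by (intro ereal_mult_le_0_iff[THEN iffD2]) auto
    also have "0 \<le> ereal K" using assms(2) by simp
    finally show False using assms(1) by simp
  qed
  have mono: "ereal K < ereal a * enn2ereal y" if "?m \<le> y" for y
    using assms(1) by (rule order_less_le_trans) (use that a in \<open>auto intro!: ereal_mult_left_mono simp: less_eq_ennreal.rep_eq\<close>)
  show "K < a * z" using mono[of "ennreal z"] assms(3) by (simp add: enn2ereal_ennreal)
  show "K * enn2real e \<le> a"
  proof (cases "enn2real e = 0")
    case False
    define x where "x = enn2real e"
    have x: "0 < x" "e = ennreal x" using False assms(4) by (auto simp: x_def less_le)
    have "ereal K < ereal a * enn2ereal (ennreal (inverse x))"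
      using mono[of "inverse e"] x by (simp add: inverse_ennreal)
    then have "K < a * inverse x" using x(1) by (simp add: enn2ereal_ennreal)
    then show ?thesis using x(1) unfolding x_def[symmetric] by (simp add: field_simps)
  qed (use a in simp)
qed

lemma tendsto_enn2real_0:
  fixes f :: "nat \<Rightarrow> ennreal"
  assumes "f \<longlonglongrightarrow> 0"
  shows "(\<lambda>n. enn2real (f n)) \<longlonglongrightarrow> 0" and "\<forall>\<^sub>F n in sequentially. f n < \<infinity>"
proof -
  show "(\<lambda>n. enn2real (f n)) \<longlonglongrightarrow> 0"
    using tendsto_enn2real[of f 0 sequentially] assms by simp
  show "\<forall>\<^sub>F n in sequentially. f n < \<infinity>"
    using order_tendstoD(2)[OF assms, of \<infinity>] by simp
qed

text \<open>Scale invariance. For a vanishing denominator both sides are 0.\<close>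

lemma block_W_eq_self_norm:
  assumes "block_array M G (\<lambda>j \<omega>. s * block_sum X m (Suc j) \<omega>) \<tau> r \<rho>" and "0 < s"
  shows "block_W X n m = block_array.self_norm (\<lambda>j \<omega>. s * block_sum X m (Suc j) \<omega>) (n div m)"
proof
  fix \<omega>
  have re: "(\<Sum>j\<in>{1..n div m}. f j) = (\<Sum>j<n div m. f (Suc j))" for f :: "nat \<Rightarrow> real"
    by (rule sum.reindex_bij_witness[where i = Suc and j = "\<lambda>j. j - 1"]) auto
  have "(\<Sum>j<n div m. (s * block_sum X m (Suc j) \<omega>)\<^sup>2) = s\<^sup>2 * (\<Sum>j<n div m. (block_sum X m (Suc j) \<omega>)\<^sup>2)"
    by (simp add: power_mult_distrib sum_distrib_left)
  then show "block_W X n m \<omega> = block_array.self_norm (\<lambda>j \<omega>. s * block_sum X m (Suc j) \<omega>) (n div m) \<omega>"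
    unfolding block_W_def block_V_def re block_array.self_norm_def[OF assms(1)]
    using assms(2) by (simp add: real_sqrt_mult flip: sum_distrib_left)
qed

lemma (in adapted_stationary) block_W_measurable [measurable]: "block_W X n m \<in> borel_measurable M"
proof -
  have [measurable]: "X (int i) \<in> borel_measurable M" for i
    using X_meas by (rule F.measurable_G)
  show ?thesis
    unfolding block_W_def[abs_def] block_V_def block_sum_def by measurable
qed

theorem corollary2p1:
  fixes M F0 :: "'a measure" and T :: "'a \<Rightarrow> 'a" and X0 :: "'a \<Rightarrow> real"
    and X :: "int \<Rightarrow> 'a \<Rightarrow> real"
    and m :: "nat \<Rightarrow> nat" and a :: "nat \<Rightarrow> real" and \<sigma> \<rho> :: real and B :: "real set"
  assumes "prob_space M"
    and "mp_automorphism M T"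
    and "subalgebra M F0"
    and "sets F0 \<subseteq> sets (shift_algebra M T F0 1)"
    and "X0 \<in> borel_measurable F0"
    and "integrable M X0"
    and "integral\<^sup>L M X0 = 0"
    and "X = shift_seq M T X0"
    and "\<And>n. n \<ge> 1 \<Longrightarrow> 1 \<le> m n \<and> m n \<le> n"
    and "\<sigma> > 0"
    and "0 < \<rho>" and "\<rho> \<le> 1"
    and "(\<lambda>n. Max {eps_m M F0 X \<rho> \<sigma> n (m n), gamma_m M F0 X \<sigma> (m n),
                   delta_m M F0 X \<sigma> (m n), ennreal (real (m n) / real n)}) \<longlonglongrightarrow> 0"
    and "a \<longlonglongrightarrow> 0"
    and "(\<lambda>n. ereal (a n) * enn2ereal (min (inverse (eps_m M F0 X \<rho> \<sigma> n (m n)))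
                                            (ennreal (sqrt (real n / real (m n)))))) \<longlonglongrightarrow> \<infinity>"
    and "B \<in> sets borel"
  shows "- (INF x\<in>interior B. ereal (x\<^sup>2 / 2))
           \<le> liminf (\<lambda>n. ereal ((a n)\<^sup>2) *
                eln (measure M {\<omega> \<in> space M. a n * block_W X n (m n) \<omega> \<in> B}))
       \<and> liminf (\<lambda>n. ereal ((a n)\<^sup>2) *
                eln (measure M {\<omega> \<in> space M. a n * block_W X n (m n) \<omega> \<in> B}))
           \<le> limsup (\<lambda>n. ereal ((a n)\<^sup>2) *
                eln (measure M {\<omega> \<in> space M. a n * block_W X n (m n) \<omega> \<in> B}))
       \<and> limsup (\<lambda>n. ereal ((a n)\<^sup>2) *
                eln (measure M {\<omega> \<in> space M. a n * block_W X n (m n) \<omega> \<in> B}))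
           \<le> - (INF x\<in>closure B. ereal (x\<^sup>2 / 2))"
proof -
  interpret adapted_stationary M T F0 X0 X
    using assms(1-6,8) by (simp add: adapted_stationary_def adapted_stationary_axioms_def)
  let ?eps = "\<lambda>n. eps_m M F0 X \<rho> \<sigma> n (m n)"
  let ?gam = "\<lambda>n. gamma_m M F0 X \<sigma> (m n)"
  let ?dsq = "\<lambda>n. delta_sq_m M F0 X \<sigma> (m n)"
  note \<sigma> = \<open>\<sigma> > 0\<close> and \<rho> = \<open>0 < \<rho>\<close> \<open>\<rho> \<le> 1\<close>
  have squeeze: "f \<longlonglongrightarrow> 0" if "\<And>n. f n \<le> Max {?eps n, ?gam n, delta_m M F0 X \<sigma> (m n), ennreal (real (m n) / real n)}"
    for f :: "nat \<Rightarrow> ennreal"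
    using that by (intro tendsto_sandwich[OF _ _ tendsto_const assms(13)]) auto
  have eps: "?eps \<longlonglongrightarrow> 0" by (rule squeeze, rule Max_ge) auto
  have gam: "?gam \<longlonglongrightarrow> 0" by (rule squeeze, rule Max_ge) auto
  have del: "(\<lambda>n. delta_m M F0 X \<sigma> (m n)) \<longlonglongrightarrow> 0" by (rule squeeze, rule Max_ge) auto
  have ev1: "\<forall>\<^sub>F n in sequentially. 1 \<le> n" by (rule eventually_ge_at_top)

  have dsq_fin: "\<forall>\<^sub>F n in sequentially. ?dsq n < \<infinity>"
    using tendsto_enn2real_0(2)[OF del] unfolding delta_m_def
    by eventually_elim (rule enn_powr_less_top)
  have dsq_0: "(\<lambda>n. enn2real (?dsq n)) \<longlonglongrightarrow> 0"
  proof -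
    have "(\<lambda>n. (enn2real (delta_m M F0 X \<sigma> (m n)))\<^sup>2) \<longlonglongrightarrow> 0\<^sup>2"
      by (intro tendsto_power tendsto_enn2real_0(1)[OF del])
    moreover have "\<forall>\<^sub>F n in sequentially. (enn2real (delta_m M F0 X \<sigma> (m n)))\<^sup>2 = enn2real (?dsq n)"
      using dsq_fin by eventually_elim (simp add: delta_m_def enn_powr_eq_ennreal powr_half_sqrt)
    ultimately have "(\<lambda>n. enn2real (?dsq n)) \<longlonglongrightarrow> 0\<^sup>2" by (rule Lim_transform_eventually)
    then show ?thesis by simp
  qed

  \<comment> \<open>The growth condition at an arbitrary level \<open>K\<close>; in particular
    \<open>a n\<close> is eventually positive.\<close>
  have gt: "\<forall>\<^sub>F n in sequentially. 0 < a n \<and> K < a n * sqrt (real n / real (m n)) \<and> K * enn2real (?eps n) \<le> a n"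
    if "0 \<le> K" for K
  proof -
    have "\<forall>\<^sub>F n in sequentially. ereal K < ereal (a n) * enn2ereal (min (inverse (?eps n)) (ennreal (sqrt (real n / real (m n)))))"
      using assms(15) unfolding tendsto_PInfty by blast
    then show ?thesis using tendsto_enn2real_0(2)[OF eps]
      by eventually_elim (use mult_min_gt that in auto)
  qed
  have a_pos: "\<forall>\<^sub>F n in sequentially. 0 < a n" using gt[of 0] by (auto elim: eventually_mono)

  define k where "k n = n div m n" for n
  define x where "x n = 1 / a n" for n
  define s where "s n = x n / (\<sigma> * sqrt (real (m n) * real (k n)))" for n
  define \<tau> where "\<tau> n = (x n)\<^sup>2 / real (k n)" for n
  define r where "r n = enn2real (?dsq n) + s n powr (2 + \<rho>) * enn2real (moment_norm \<rho> (m n)) / \<tau> n" for n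
  \<comment> \<open>\<open>1 / Suc n\<close> is a positive null sequence in the role of \<eta> in
    \<open>total_drift_subgaussian\<close>.\<close>
  define g where "g n = 45 * enn2real (?gam n) + 20 * (1 / real (Suc n))" for n
  define U where "U n j \<omega> = s n * block_sum X (m n) (Suc j) \<omega>" for n j \<omega>
  have mk: "0 < m n \<and> 0 < k n \<and> real n \<le> 2 * (real (m n) * real (k n))" if "1 \<le> n" for n
  proof -
    have m: "1 \<le> m n" "m n \<le> n" using assms(9)[OF that] by auto
    then have k1: "1 \<le> k n" by (simp add: k_def div_greater_zero_iff Suc_le_eq)
    have "n = m n * k n + n mod m n" by (simp add: k_def)
    \<comment> \<open>The incomplete block is shorter than \<open>m n\<close>, hence than the union
      of the complete ones, of which there is at least one.\<close>
    moreover have "n mod m n \<le> m n * k n"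
      using mod_less_divisor[of "m n" n] m mult_le_mono2[OF k1, of "m n"] by linarith
    ultimately have "n \<le> 2 * (m n * k n)" by linarith
    then have "real n \<le> real (2 * (m n * k n))" by (rule of_nat_mono)
    then show ?thesis using m k1 by simp
  qed
  have v: "real (k n) * \<tau> n = (x n)\<^sup>2" if "1 \<le> n" for n
    using mk[OF that] by (simp add: \<tau>_def)

  have P_fin: "\<forall>\<^sub>F n in sequentially. moment_norm \<rho> (m n) < \<infinity>"
    using tendsto_enn2real_0(2)[OF eps] ev1
  proof eventually_elim
    case (elim n)
    define c where "c = 1 / (real n powr (1/2) * real (m n) powr (1/\<rho>) * \<sigma> powr (2/\<rho> + 1))"
    have "0 < c" using mk[OF elim(2)] elim(2) \<sigma> by (simp add: c_def)
    have "ennreal c * enn_powr (moment_norm \<rho> (m n)) (1 / \<rho>) < \<infinity>"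
      using elim(1) unfolding eps_m_def moment_norm_def c_def .
    then have "enn_powr (moment_norm \<rho> (m n)) (1 / \<rho>) < \<infinity>"
      using \<open>0 < c\<close> by (auto simp: ennreal_mult_less_top ennreal_eq_0_iff)
    then show ?case by (rule enn_powr_less_top)
  qed

  have ratio_0: "(\<lambda>n. (2 * x n * enn2real (?eps n)) powr \<rho>) \<longlonglongrightarrow> 0"
  proof -
    have "(\<lambda>n. 2 * x n * enn2real (?eps n)) \<longlonglongrightarrow> 0"
    proof (rule tendstoI)
      fix e :: real assume "0 < e"
      show "\<forall>\<^sub>F n in sequentially. dist (2 * x n * enn2real (?eps n)) 0 < e"
        \<comment> \<open>4 in place of 2, since \<open>gt\<close> gives a weak inequality and a
          strict one is wanted.\<close>
        using gt[of "4 / e", OF divide_nonneg_pos[OF zero_le_numeral \<open>0 < e\<close>]]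
      proof eventually_elim
        case (elim n)
        then have "4 * enn2real (?eps n) \<le> e * a n" using \<open>0 < e\<close> by (simp add: field_simps)
        moreover have "0 < e * a n" using elim \<open>0 < e\<close> by simp
        ultimately have "2 * enn2real (?eps n) < e * a n" by linarith
        then show ?case using elim by (simp add: x_def pos_divide_less_eq)
      qed
    qed
    moreover have "\<forall>\<^sub>F n in sequentially. 0 \<le> 2 * x n * enn2real (?eps n)"
      using a_pos by eventually_elim (simp add: x_def)
    ultimately show ?thesis using \<rho>(1) by (intro tendsto_zero_powrI[OF _ tendsto_const])
  qed
  have r_le: "\<forall>\<^sub>F n in sequentially. enn2real (?dsq n) \<le> r n \<and> r n \<le> enn2real (?dsq n) + (2 * x n * enn2real (?eps n)) powr \<rho>"
    using P_fin a_pos ev1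
  proof eventually_elim
    case (elim n)
    define P where "P = enn2real (moment_norm \<rho> (m n))"
    define c where "c = 1 / (real n powr (1/2) * real (m n) powr (1/\<rho>) * \<sigma> powr (2/\<rho> + 1))"
    have "0 \<le> c" by (simp add: c_def)
    have "?eps n = ennreal c * ennreal (P powr (1 / \<rho>))"
      using enn_powr_eq_ennreal[OF elim(1), of "1 / \<rho>"]
      unfolding eps_m_def c_def P_def moment_norm_def by simp
    then have "enn2real (?eps n) = c * P powr (1 / \<rho>)"
      using \<open>0 \<le> c\<close> by (simp add: enn2real_mult)
    moreover have "s n powr (2 + \<rho>) * P / \<tau> n \<le> (2 * x n * (c * P powr (1 / \<rho>))) powr \<rho>"
      unfolding c_def
      by (rule scaled_moment_bound[OF _ _ \<sigma> \<rho>(1) _ _ _ _ s_def \<tau>_def])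
         (use elim mk[of n] in \<open>auto simp: P_def x_def\<close>)
    moreover have "0 \<le> s n powr (2 + \<rho>) * P / \<tau> n" using elim(2) by (simp add: \<tau>_def P_def)
    ultimately show ?case unfolding r_def P_def by simp
  qed
  have r_0: "r \<longlonglongrightarrow> 0"
  proof (rule tendsto_sandwich[OF _ _ dsq_0])
    show "(\<lambda>n. enn2real (?dsq n) + (2 * x n * enn2real (?eps n)) powr \<rho>) \<longlonglongrightarrow> 0"
      using tendsto_add[OF dsq_0 ratio_0] by simp
  qed (use r_le in \<open>auto elim: eventually_mono\<close>)

  have \<tau>_0: "\<tau> \<longlonglongrightarrow> 0"
  proof (rule tendstoI)
    fix e :: real assume "0 < e"
    show "\<forall>\<^sub>F n in sequentially. dist (\<tau> n) 0 < e"
      \<comment> \<open>Here \<open>\<tau> n = 1 / ((a n)^2 * k n)\<close> and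
        \<open>n / m n \<le> 2 * k n\<close>, which explains the 2 under the root.\<close>
      using gt[of "sqrt (2 / e)", OF real_sqrt_ge_zero[OF divide_nonneg_pos[OF zero_le_numeral \<open>0 < e\<close>]]] ev1
    proof eventually_elim
      case (elim n)
      have "(sqrt (2 / e))\<^sup>2 < (a n * sqrt (real n / real (m n)))\<^sup>2"
        using elim \<open>0 < e\<close> by (intro power_strict_mono) auto
      then have "2 / e < (a n)\<^sup>2 * (real n / real (m n))"
        using \<open>0 < e\<close> by (simp add: power_mult_distrib)
      also have "\<dots> \<le> (a n)\<^sup>2 * (2 * real (k n))"
        using mk[of n] elim by (intro mult_left_mono) (auto simp: field_simps)
      finally have "2 < 2 * (e * ((a n)\<^sup>2 * real (k n)))"
        using \<open>0 < e\<close> by (simp add: pos_divide_less_eq ac_simps)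
      moreover have "0 < (a n)\<^sup>2 * real (k n)" using elim mk[of n] by simp
      ultimately have "1 / ((a n)\<^sup>2 * real (k n)) < e" by (simp add: pos_divide_less_eq)
      then show ?case by (simp add: \<tau>_def x_def power_divide)
    qed
  qed
  have g_0: "g \<longlonglongrightarrow> 0"
  proof -
    have "(\<lambda>n. 1 / real (Suc n)) \<longlonglongrightarrow> 0" using LIMSEQ_inverse_real_of_nat by (simp add: inverse_eq_divide)
    then have "g \<longlonglongrightarrow> 45 * 0 + 20 * 0"
      unfolding g_def by (intro tendsto_intros tendsto_enn2real_0(1)[OF gam])
    then show ?thesis by simp
  qed
  have v_top: "filterlim (\<lambda>n. real (k n) * \<tau> n) at_top sequentially"
  proof -
    have "filterlim (\<lambda>n. inverse (a n)) at_top sequentially"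
      using assms(14) a_pos by (intro filterlim_inverse_at_top) auto
    then have "filterlim (\<lambda>n. (inverse (a n))\<^sup>2) at_top sequentially"
      by (intro filterlim_pow_at_top) auto
    moreover have ev: "\<forall>\<^sub>F n in sequentially. (inverse (a n))\<^sup>2 = real (k n) * \<tau> n"
      using ev1 by eventually_elim (simp add: v x_def inverse_eq_divide)
    ultimately show ?thesis unfolding filterlim_cong[OF refl refl ev] by simp
  qed

  have array: "\<forall>\<^sub>F n in sequentially. block_array M (\<lambda>j. F (m n * j)) (U n) (\<tau> n) (r n) \<rho>"
    using a_pos ev1 dsq_fin P_fin
  proof eventually_elim
    case (elim n)
    then show ?case
      unfolding U_def[abs_def]
      by (intro block_array_scaled[OF _ _ _ \<sigma> \<rho> s_def \<tau>_def _ _ r_def])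
         (use mk[of n] in \<open>auto simp: x_def\<close>)
  qed
  interpret seq: block_array_sequence M "\<lambda>n j. F (m n * j)" U k \<tau> r g \<rho>
  proof unfold_locales
    show "\<forall>\<^sub>F n in sequentially. block_array M (\<lambda>j. F (m n * j)) (U n) (\<tau> n) (r n) \<rho>" by (rule array)
    show "\<forall>\<^sub>F n in sequentially. subgaussian
        (block_array.total_drift M (\<lambda>j. F (m n * j)) (U n) (k n)) (g n * sqrt (real (k n) * \<tau> n))"
      using a_pos ev1 tendsto_enn2real_0(2)[OF gam] array
    proof eventually_elim
      case (elim n)
      have "subgaussian (\<lambda>\<omega>. \<Sum>j<k n. real_cond_exp M (F (m n * j)) (\<lambda>\<omega>. s n * block_sum X (m n) (Suc j) \<omega>) \<omega>)
          (g n * x n)"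
        unfolding g_def
        by (rule total_drift_subgaussian[OF _ _ _ \<sigma> _ s_def]) (use mk[of n] elim in \<open>auto simp: x_def\<close>)
      moreover have "sqrt (real (k n) * \<tau> n) = x n" using elim by (simp add: v x_def)
      moreover have "block_array.total_drift M (\<lambda>j. F (m n * j)) (U n) (k n) =
          (\<lambda>\<omega>. \<Sum>j<k n. real_cond_exp M (F (m n * j)) (\<lambda>\<omega>. s n * block_sum X (m n) (Suc j) \<omega>) \<omega>)"
        unfolding block_array.total_drift_def[OF elim(4), abs_def] block_array.drift_def[OF elim(4)]
        unfolding U_def[abs_def] ..
      ultimately show ?case by simp
    qed
    show "\<forall>\<^sub>F n in sequentially. 0 < g n"
      by (simp add: g_def add_nonneg_pos)
  qed (fact \<tau>_0 r_0 g_0 v_top)+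

  have W: "\<forall>\<^sub>F n in sequentially. 0 < a n \<and> sqrt (1 / (a n)\<^sup>2) = 1 / a n \<and> seq.v n = 1 / (a n)\<^sup>2 \<and> seq.W n = block_W X n (m n)"
    using a_pos ev1 array
  proof eventually_elim
    case (elim n)
    then have "0 < s n" using mk[of n] \<sigma> by (simp add: s_def x_def)
    from block_W_eq_self_norm[OF elim(3)[unfolded U_def[abs_def]] this]
    have "seq.W n = block_W X n (m n)" by (simp add: k_def U_def[abs_def])
    moreover have "seq.v n = (1 / a n)\<^sup>2" using v[OF elim(2)] by (simp add: x_def)
    ultimately show ?case using elim by (simp add: power_divide real_sqrt_divide)
  qed
  let ?Z = "\<lambda>n \<omega>. a n * block_W X n (m n) \<omega>"
  have upper: "\<forall>\<^sub>F n in sequentially. prob {\<omega> \<in> space M. y \<le> \<bar>?Z n \<omega>\<bar>} \<le> exp ((- (y\<^sup>2 / 2) + \<epsilon>) / (a n)\<^sup>2)"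
    if "0 < y" "0 < \<epsilon>" for y \<epsilon>
    using seq.upper_tail[OF that] W
  proof eventually_elim
    case (elim n)
    have "y * (1 / a n) \<le> \<bar>w\<bar> \<longleftrightarrow> y \<le> \<bar>a n * w\<bar>" for w
      using elim(2) by (simp add: abs_mult field_simps)
    moreover have "exp (1 / (a n)\<^sup>2 * (- (y\<^sup>2 / 2) + \<epsilon>)) = exp ((- (y\<^sup>2 / 2) + \<epsilon>) / (a n)\<^sup>2)" by simp
    ultimately show ?case using elim by (simp only:)
  qed
  have lower: "\<forall>\<^sub>F n in sequentially. exp (- (y\<^sup>2 / 2 + \<epsilon>) / (a n)\<^sup>2) \<le> prob {\<omega> \<in> space M. \<bar>?Z n \<omega> - y\<bar> < e}"
    if "0 < e" "0 < \<epsilon>" for y e \<epsilon>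
    using seq.local_lower[OF that, of y] W
  proof eventually_elim
    case (elim n)
    have "\<bar>w - y * (1 / a n)\<bar> < e * (1 / a n) \<longleftrightarrow> \<bar>a n * w - y\<bar> < e" for w
    proof -
      have "\<bar>a n * w - y\<bar> = a n * \<bar>w - y * (1 / a n)\<bar>"
        using elim(2) by (simp add: abs_mult_pos' right_diff_distrib)
      then show ?thesis using elim(2) by (simp add: field_simps)
    qed
    moreover have "exp (- (1 / (a n)\<^sup>2 * (y\<^sup>2 / 2 + \<epsilon>))) = exp (- (y\<^sup>2 / 2 + \<epsilon>) / (a n)\<^sup>2)" unfolding minus_divide_left[symmetric] by simp
    ultimately show ?case using elim by (simp only:)
  qed
  have Z: "?Z n \<in> borel_measurable M" for n by measurable
  note mdp = moderate_deviation_principle[of ?Z a B, OF Z a_pos upper lower \<open>B \<in> sets borel\<close>]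
  show ?thesis by (intro conjI mdp Liminf_le_Limsup) simp_all
qed

end
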